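(* (a) The family $$\{({}_n\Sigma,G_\sigma)\mid n\in\omega\}\cup\{(\Sigma_{\bf p},G_\sigma)\mid{\bf p}\in\mathcal{P}\}$$ is a $\preceq^i_c$-basis of size $\aleph_0$ for the class of graphs, induced by the shift of a countable two-sided subshift with Cantor-Bendixson rank at most two, having no continuous 2-coloring. Moreover, choosing the lexicographically minimal element $\min_{\rm lex}\mathcal{F}_{\bf p}$ of $\mathcal{F}_{\bf p}:=\{{\bf p}'\in\mathcal{P}\mid(\Sigma_{{\bf p}'},G_\sigma)\equiv^i_c(\Sigma_{\bf p},G_\sigma)\}$ for each ${\bf p}\in\mathcal{P}$ provides a $\preceq^i_c$-antichain basis of size $\aleph_0$ for the same class; that is, $$\{({}_n\Sigma,G_\sigma)\mid n\in\omega\}\cup\{(\Sigma_{\bf m},G_\sigma)\mid{\bf m}=\textstyle\min_{\rm lex}\mathcal{F}_{\bf p}\text{ for some }{\bf p}\in\mathcal{P}\}$$ is a $\preceq^i_c$-antichain basis of size $\aleph_0$. (b) If $\xi\geq 3$ is a countable ordinal, then there is a $\preceq^i_c$-basis made of minimal elements for the class of graphs, induced by the shift of a countable two-sided subshift with Cantor-Bendixson rank at most $\xi$, having no continuous 2-coloring, and any such basis must have size $2^{\aleph_0}$. (c) If $\xi$ is a countable ordinal, then any $\preceq^i_c$-basis made of minimal elements for the class of graphs, induced by the shift of a two-sided subshift with Cantor-Bendixson rank at most $\xi$, having no continuous 2-coloring, must have size $2^{\aleph_0}$.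
   Context: Subshifts. For a finite set $A$ with at least two elements, $A^{\mathbb{Z}}$ has the product topology ($A$ discrete) and $\sigma:A^{\mathbb{Z}}\to A^{\mathbb{Z}}$ is the shift $\sigma(\alpha)(k):=\alpha(k+1)$. A two-sided subshift is a closed $\sigma$-invariant subset $\Sigma$ of some such $A^{\mathbb{Z}}$. The graph induced by its shift is $(\Sigma,G_\sigma)$, where $G_\sigma:=\{(x,y)\in\Sigma^2\mid x\neq y\text{ and }(y=\sigma(x)\text{ or }x=\sigma(y))\}$. $\mathrm{Orb}_\sigma(x):=\{\sigma^k(x)\mid k\in\mathbb{Z}\}$. If $x$ is a left-infinite sequence $\cdots x(-1)x(0)$ and $y=y(0)y(1)\cdots$ is right-infinite, $z:=x\cdot y\in A^{\mathbb{Z}}$ is defined by $z(i):=y(i)$ and $z(-i-1):=x(-i)$ for $i\in\omega$. For a nonempty finite word $w$, $w^{-\infty}:=\cdots ww$, $w^\infty:=ww\cdots$ and $w^{\mathbb{Z}}:=w^{-\infty}\cdot w^\infty$. Colorings and quasi-order. A continuous 2-coloring of $(X,R)$ is a continuous map $c:X\to\{0,1\}$ (discrete) with $c(x)\neq c(y)$ whenever $(x,y)\in R$. $(X,R)\preceq^i_c(Y,S)$ means that there is an injective continuous $h:X\to Y$ with $(h(x),h(y))\in S$ whenever $(x,y)\in R$; $\equiv^i_c$ is $\preceq^i_c\cap(\preceq^i_c)^{-1}$. A basis for a class $\mathcal{Q}$ is a subclass $\mathcal{B}\subseteq\mathcal{Q}$ such that every element of $\mathcal{Q}$ is $\preceq^i_c$-above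 an element of $\mathcal{B}$. An antichain is a family of pairwise $\preceq^i_c$-incomparable elements. An element $m\in\mathcal{Q}$ is minimal if every $x\in\mathcal{Q}$ with $x\preceq^i_c m$ satisfies $m\preceq^i_c x$. In (b) and (c), the size of a basis made of minimal elements is counted up to $\equiv^i_c$, i.e. it is the number of $\equiv^i_c$-classes it meets (equivalently, the cardinality of the antichain basis obtained by choosing one element in each of these classes). Cantor-Bendixson rank. $X'$ is the set of limit points of $X$; $X^0:=X$, $X^{\alpha+1}:=(X^\alpha)'$, $X^\lambda:=\bigcap_{\alpha<\lambda}X^\alpha$ for $\lambda$ limit. The Cantor-Bendixson rank of a Polish space $X$ is the least countable ordinal $\alpha_0$ with $X^\alpha=X^{\alpha_0}$ for all $\alpha\geq\alpha_0$; for a countable metrizable compact space it is the least $\alpha_0$ with $X^{\alpha_0}=\emptyset$. The subshifts ${}_n\Sigma$. ${}_0\Sigma:=\mathrm{Orb}_\sigma(0^{\mathbb{Z}})\cup\mathrm{Orb}_\sigma(0^{-\infty}\cdot 10^\infty)$; ${}_1\Sigma:=\mathrm{Orb}_\sigma(0^{\mathbb{Z}})\cup\mathrm{Orb}_\sigma(1^{\mathbb{Z}})\cup\mathrm{Orb}_\sigma(0^{-\infty}\cdot 1^\infty)$; and, for $q\in\omega$, ${}_{2q+2}\Sigma:=\mathrm{Orb}_\sigma(0^{\mathbb{Z}})\cup\mathrm{Orb}_\sigma\big((1,\dots,2q+2)^{\mathbb{Z}}\big)\cup\mathrm{Orb}_\sigma\big(0^{-\infty}\cdot(1,\dots,2q+2)^\infty\big)$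 and ${}_{2q+3}\Sigma:=\mathrm{Orb}_\sigma\big((0,1,\dots,2q+2)^{\mathbb{Z}}\big)$. The subshifts $\Sigma_{\bf p}$. $\mathcal{P}$ is the set of tuples ${\bf p}=(l,\lambda_0,\dots,\lambda_l,m,\varepsilon_0,\dots,\varepsilon_{l-1})\in\omega^{l+3}\times\{0,1\}^l$ with $l\in\omega$, every $\lambda_i>0$ even ($i\leq l$), and $m<\lambda_0$ odd. Fix disjoint injective families of symbols $(a^i_j)_{i,j\in\omega}$, $(b_i)_{i\in\omega}$. For ${\bf p}\in\mathcal{P}$, let $A_{\bf p}:=\{a^i_j\mid i\leq l,\ j<\lambda_i\}\cup\{b_i\mid i<m\}$, $w_i:=a^i_0\cdots a^i_{\lambda_i-1}$ for $i\leq l$, and define the subshift of $A_{\bf p}^{\mathbb{Z}}$ $$\Sigma_{\bf p}:=\bigcup_{i\leq l}\mathrm{Orb}_\sigma(w_i^{\mathbb{Z}})\cup\bigcup_{i<l}\mathrm{Orb}_\sigma(w_{i+\varepsilon_i}^{-\infty}\cdot w_{i+1-\varepsilon_i}^\infty)\cup\mathrm{Orb}_\sigma\big(w_l^{-\infty}\cdot b_0\cdots b_{m-1}w_0^\infty\big).$$ The tuples in $\mathcal{P}$ are compared lexicographically as finite sequences of natural numbers; the sets $\mathcal{F}_{\bf p}$ are finite. *)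

theory Defs
  imports "HOL-Analysis.Analysis" "HOL-Library.Equipollence"
begin

text \<open>The countable ordinals are the elements of the well-order \<^term>\<open>cardSuc natLeq\<close>, whose
  order type is the first uncountable ordinal.\<close>

typedef omega1 = "Field (cardSuc natLeq)"
proof -
  have "infinite (Field (cardSuc natLeq))"
    using cardSuc_finite[OF natLeq_Card_order] by (simp add: Field_natLeq)
  then show ?thesis
    by (metis ex_in_conv finite.emptyI)
qed

lemma Well_order_omega1: "Well_order (cardSuc natLeq)"
  using cardSuc_Card_order[OF natLeq_Card_order] card_order_on_well_order_on by blast

instantiation omega1 :: wellorder
begin

definition less_eq_omega1 :: "omega1 \<Rightarrow> omega1 \<Rightarrow> bool" where
  "\<alpha> \<le> \<beta> \<longleftrightarrow> (Rep_omega1 \<alpha>, Rep_omega1 \<beta>) \<in> cardSuc natLeq"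

definition less_omega1 :: "omega1 \<Rightarrow> omega1 \<Rightarrow> bool" where
  "\<alpha> < \<beta> \<longleftrightarrow> \<alpha> \<le> \<beta> \<and> \<not> \<beta> \<le> (\<alpha>::omega1)"

instance
proof
  note W = Well_order_omega1[unfolded well_order_on_def linear_order_on_def partial_order_on_def
      preorder_on_def]
  show "\<alpha> < \<beta> \<longleftrightarrow> \<alpha> \<le> \<beta> \<and> \<not> \<beta> \<le> \<alpha>" for \<alpha> \<beta> :: omega1
    by (rule less_omega1_def)
  show refl: "\<alpha> \<le> \<alpha>" for \<alpha> :: omega1
    using W Rep_omega1[of \<alpha>] by (auto simp: less_eq_omega1_def refl_on_def)
  show "\<alpha> \<le> \<gamma>" if "\<alpha> \<le> \<beta>" "\<beta> \<le> \<gamma>" for \<alpha> \<beta> \<gamma> :: omega1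
    using W that by (meson less_eq_omega1_def transE)
  show antisym: "\<alpha> = \<beta>" if "\<alpha> \<le> \<beta>" "\<beta> \<le> \<alpha>" for \<alpha> \<beta> :: omega1
    using W that by (meson less_eq_omega1_def antisymD Rep_omega1_inject)
  show "\<alpha> \<le> \<beta> \<or> \<beta> \<le> \<alpha>" for \<alpha> \<beta> :: omega1
    using W Rep_omega1[of \<alpha>] Rep_omega1[of \<beta>] refl
    by (metis less_eq_omega1_def total_on_def Rep_omega1_inject)
  show "P \<alpha>" if IH: "\<And>\<beta>. (\<And>\<gamma>. \<gamma> < \<beta> \<Longrightarrow> P \<gamma>) \<Longrightarrow> P \<beta>" for P and \<alpha> :: omega1
  proof -
    have wf: "wf (inv_image (cardSuc natLeq - Id) Rep_omega1)"
      using W by (blast intro: wf_inv_image)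
    show ?thesis
    proof (induction \<alpha> rule: wf_induct_rule[OF wf])
      case (1 \<alpha>)
      show ?case
      proof (rule IH)
        fix \<gamma> :: omega1 assume g: "\<gamma> < \<alpha>"
        then have "\<gamma> \<noteq> \<alpha>" by (auto simp: less_omega1_def)
        with g have "(\<gamma>, \<alpha>) \<in> inv_image (cardSuc natLeq - Id) Rep_omega1"
          by (auto simp: less_omega1_def less_eq_omega1_def Rep_omega1_inject)
        then show "P \<gamma>" by (rule 1)
      qed
    qed
  qed
qed

end

lemma countable_lessThan_omega1:
  includes cardinal_syntax
  shows "countable {..<(\<alpha>::omega1)}"
proof -
  let ?r = "cardSuc natLeq"
  have "|underS ?r (Rep_omega1 \<alpha>)| <o ?r"
    by (rule card_of_underS[OF cardSuc_Card_order[OF natLeq_Card_order] Rep_omega1])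
  then have "|underS ?r (Rep_omega1 \<alpha>)| \<le>o natLeq"
    using cardSuc_ordLeq_ordLess[OF natLeq_Card_order card_of_Card_order] by blast
  then have "|underS ?r (Rep_omega1 \<alpha>)| \<le>o |UNIV :: nat set|"
    using ordLeq_ordIso_trans[OF _ ordIso_symmetric[OF card_of_nat]] by blast
  then have c: "countable (underS ?r (Rep_omega1 \<alpha>))"
    unfolding countable_def by (metis card_of_ordLeq)
  have "Rep_omega1 ` {..<\<alpha>} \<subseteq> underS ?r (Rep_omega1 \<alpha>)"
    by (auto simp: underS_def less_le less_eq_omega1_def Rep_omega1_inject)
  then have "countable (Rep_omega1 ` {..<\<alpha>})"
    using c countable_subset by blast
  then show ?thesis
    by (rule countable_image_inj_on) (simp add: inj_on_def Rep_omega1_inject)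
qed

lemma uncountable_omega1:
  includes cardinal_syntax
  shows "uncountable (UNIV :: omega1 set)"
proof
  let ?r = "cardSuc natLeq"
  assume "countable (UNIV :: omega1 set)"
  then have "countable (range Rep_omega1)" by (rule countable_image)
  then have "countable (Field ?r)"
    by (metis type_definition.Rep_range type_definition_omega1)
  then have "|Field ?r| \<le>o |UNIV :: nat set|"
    unfolding countable_def by (auto simp: card_of_ordLeq[symmetric])
  then have "?r \<le>o natLeq"
    using card_of_Field_ordIso[OF cardSuc_Card_order[OF natLeq_Card_order]] card_of_nat
    by (meson ordIso_ordLeq_trans ordIso_symmetric ordLeq_ordIso_trans)
  then show False
    using cardSuc_greater[OF natLeq_Card_order] not_ordLess_ordLeq by blast
qed

instantiation omega1 :: zero
begin

definition zero_omega1 :: omega1 where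
  "0 = (LEAST \<alpha>::omega1. True)"

instance ..

end

definition osuc :: "omega1 \<Rightarrow> omega1" where
  "osuc \<alpha> = (LEAST \<beta>. \<alpha> < \<beta>)"

definition ord_of_nat :: "nat \<Rightarrow> omega1" where
  "ord_of_nat n = (osuc ^^ n) 0"

lemma zero_le_omega1: "0 \<le> (\<alpha>::omega1)"
  unfolding zero_omega1_def by (simp add: Least_le)

lemma less_osuc: "\<alpha> < osuc \<alpha>"
proof -
  have "\<exists>\<beta>. \<alpha> < \<beta>"
  proof (rule ccontr)
    assume "\<nexists>\<beta>. \<alpha> < \<beta>"
    then have "UNIV = insert \<alpha> {..<\<alpha>}" by (auto simp: not_less order.order_iff_strict)
    then show False
      using countable_lessThan_omega1[of \<alpha>] uncountable_omega1 by (metis countable_insert)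
  qed
  then show ?thesis unfolding osuc_def by (rule LeastI_ex)
qed

lemma osuc_le: "\<alpha> < \<beta> \<Longrightarrow> osuc \<alpha> \<le> \<beta>"
  unfolding osuc_def by (rule Least_le)

lemma osuc_inject: "osuc \<alpha> = osuc \<beta> \<longleftrightarrow> \<alpha> = \<beta>"
  by (metis leD less_osuc linorder_neqE osuc_le)

lemma the_osuc: "(THE \<beta>. osuc \<alpha> = osuc \<beta>) = \<alpha>"
  by (simp add: osuc_inject)

function cb_deriv :: "'x topology \<Rightarrow> omega1 \<Rightarrow> 'x set" where
  "cb_deriv T \<alpha> =
    (if \<alpha> = 0 then topspace T
     else if \<exists>\<beta>. \<alpha> = osuc \<beta> then
       (let S = cb_deriv T (THE \<beta>. \<alpha> = osuc \<beta>) in subtopology T S derived_set_of S)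
     else (\<Inter>\<beta>\<in>{..<\<alpha>}. cb_deriv T \<beta>))"
  by pat_completeness auto
termination
  by (relation "inv_image {(\<alpha>, \<beta>). \<alpha> < \<beta>} snd") (auto simp: wf less_osuc the_osuc)

declare cb_deriv.simps [simp del]

lemma cb_deriv_0: "cb_deriv T 0 = topspace T"
  by (simp add: cb_deriv.simps)

lemma cb_deriv_osuc:
  "cb_deriv T (osuc \<alpha>) = subtopology T (cb_deriv T \<alpha>) derived_set_of cb_deriv T \<alpha>"
proof -
  have "osuc \<alpha> \<noteq> 0" using less_osuc[of \<alpha>] zero_le_omega1[of \<alpha>] by auto
  then show ?thesis
    by (subst cb_deriv.simps) (auto simp: the_osuc Let_def)
qed

lemma cb_deriv_limit:
  "\<alpha> \<noteq> 0 \<Longrightarrow> \<nexists>\<beta>. \<alpha> = osuc \<beta> \<Longrightarrow> cb_deriv T \<alpha> = (\<Inter>\<beta>\<in>{..<\<alpha>}. cb_deriv T \<beta>)"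
  by (subst cb_deriv.simps) simp

definition cb_rank :: "'x topology \<Rightarrow> omega1" where
  "cb_rank T = (LEAST \<alpha>. \<forall>\<beta>\<ge>\<alpha>. cb_deriv T \<beta> = cb_deriv T \<alpha>)"

type_synonym 'x tgraph = "'x topology \<times> ('x \<times> 'x) set"

definition has_cont_2coloring :: "'x tgraph \<Rightarrow> bool" where
  "has_cont_2coloring G \<longleftrightarrow>
    (\<exists>c. continuous_map (fst G) (discrete_topology {0, 1::nat}) c \<and>
         (\<forall>(x, y)\<in>snd G. c x \<noteq> c y))"

definition ic_le :: "'x tgraph \<Rightarrow> 'y tgraph \<Rightarrow> bool" (infix \<open>\<preceq>ic\<close> 50) where
  "G \<preceq>ic H \<longleftrightarrow>
    (\<exists>h. continuous_map (fst G) (fst H) h \<and> inj_on h (topspace (fst G)) \<and>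
         (\<forall>(x, y)\<in>snd G. (h x, h y) \<in> snd H))"

definition ic_equiv :: "'x tgraph \<Rightarrow> 'y tgraph \<Rightarrow> bool" (infix \<open>\<equiv>ic\<close> 50) where
  "G \<equiv>ic H \<longleftrightarrow> G \<preceq>ic H \<and> H \<preceq>ic G"

definition is_basis :: "'x tgraph set \<Rightarrow> 'x tgraph set \<Rightarrow> bool" where
  "is_basis Q B \<longleftrightarrow> B \<subseteq> Q \<and> (\<forall>G\<in>Q. \<exists>H\<in>B. H \<preceq>ic G)"

definition is_antichain :: "'x tgraph set \<Rightarrow> bool" where
  "is_antichain B \<longleftrightarrow> (\<forall>G\<in>B. \<forall>H\<in>B. G \<noteq> H \<longrightarrow> \<not> G \<preceq>ic H \<and> \<not> H \<preceq>ic G)"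

definition is_minimal_in :: "'x tgraph set \<Rightarrow> 'x tgraph \<Rightarrow> bool" where
  "is_minimal_in Q M \<longleftrightarrow> M \<in> Q \<and> (\<forall>G\<in>Q. G \<preceq>ic M \<longrightarrow> M \<preceq>ic G)"

definition is_basis_of_minimals :: "'x tgraph set \<Rightarrow> 'x tgraph set \<Rightarrow> bool" where
  "is_basis_of_minimals Q B \<longleftrightarrow> is_basis Q B \<and> (\<forall>M\<in>B. is_minimal_in Q M)"

definition ic_classes :: "'x tgraph set \<Rightarrow> 'x tgraph set set" where
  "ic_classes B = B // {(G, H). G \<equiv>ic H}"

definition shift :: "(int \<Rightarrow> 'a) \<Rightarrow> (int \<Rightarrow> 'a)" where
  "shift x = (\<lambda>k. x (k + 1))"

lemma shift_funpow: "(shift ^^ n) x = (\<lambda>i. x (i + int n))"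
  by (induction n) (auto simp: shift_def algebra_simps)

definition orb :: "(int \<Rightarrow> 'a) \<Rightarrow> (int \<Rightarrow> 'a) set" where
  "orb x = {(\<lambda>i. x (i + k)) | k. True}"

text \<open>Invariance is \<open>\<sigma>(\<Sigma>) = \<Sigma>\<close>, so that a subshift contains the two-sided orbits of its points.\<close>

definition subshift :: "(int \<Rightarrow> 'a) set \<Rightarrow> bool" where
  "subshift \<Sigma> \<longleftrightarrow>
    (\<exists>A. finite A \<and> 2 \<le> card A \<and>
         closedin (product_topology (\<lambda>_. discrete_topology A) UNIV) \<Sigma> \<and> shift ` \<Sigma> = \<Sigma>)"

definition subshift_topology :: "(int \<Rightarrow> 'a) set \<Rightarrow> (int \<Rightarrow> 'a) topology" where
  "subshift_topology \<Sigma> = subtopology (product_topology (\<lambda>_. discrete_topology UNIV) UNIV) \<Sigma>"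

lemma subshift_topology_alphabet:
  assumes "\<And>x i. x \<in> \<Sigma> \<Longrightarrow> x i \<in> A"
  shows "subshift_topology \<Sigma> = subtopology (product_topology (\<lambda>_. discrete_topology A) UNIV) \<Sigma>"
proof -
  let ?T = "product_topology (\<lambda>_::int. discrete_topology UNIV) UNIV"
  let ?P = "\<Pi>\<^sub>E i\<in>(UNIV::int set). A"
  have "subtopology ?T ?P = product_topology (\<lambda>_. discrete_topology A) UNIV"
    by (simp add: subtopology_product_topology)
  moreover have "?P \<inter> \<Sigma> = \<Sigma>" using assms by auto
  ultimately show ?thesis
    unfolding subshift_topology_def by (metis subtopology_subtopology)
qed

definition shift_graph :: "(int \<Rightarrow> 'a) set \<Rightarrow> (int \<Rightarrow> 'a) tgraph" where
  "shift_graph \<Sigma> =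
    (subshift_topology \<Sigma>,
     {(x, y). x \<in> \<Sigma> \<and> y \<in> \<Sigma> \<and> x \<noteq> y \<and> (y = shift x \<or> x = shift y)})"

definition graph_class :: "omega1 \<Rightarrow> (int \<Rightarrow> 'a) tgraph set" where
  "graph_class \<xi> =
    {shift_graph \<Sigma> | \<Sigma>. subshift \<Sigma> \<and> cb_rank (subshift_topology \<Sigma>) \<le> \<xi> \<and>
                      \<not> has_cont_2coloring (shift_graph \<Sigma>)}"

definition countable_graph_class :: "omega1 \<Rightarrow> (int \<Rightarrow> 'a) tgraph set" where
  "countable_graph_class \<xi> =
    {shift_graph \<Sigma> | \<Sigma>. subshift \<Sigma> \<and> countable \<Sigma> \<and> cb_rank (subshift_topology \<Sigma>) \<le> \<xi> \<and>
                      \<not> has_cont_2coloring (shift_graph \<Sigma>)}"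

text \<open>Both one-sided infinite words are functions on \<^typ>\<open>nat\<close>; a left-infinite word
  \<open>\<cdots> x(-1) x(0)\<close> is read from right to left, i.e. \<open>x j\<close> stands for \<open>x(-j)\<close>.\<close>

definition left_power :: "'a list \<Rightarrow> (nat \<Rightarrow> 'a)" where
  "left_power w = (\<lambda>j. rev w ! (j mod length w))"

definition right_power :: "'a list \<Rightarrow> (nat \<Rightarrow> 'a)" where
  "right_power w = (\<lambda>j. w ! (j mod length w))"

definition prepend :: "'a list \<Rightarrow> (nat \<Rightarrow> 'a) \<Rightarrow> (nat \<Rightarrow> 'a)" where
  "prepend u y = (\<lambda>j. if j < length u then u ! j else y (j - length u))"

definition glue :: "(nat \<Rightarrow> 'a) \<Rightarrow> (nat \<Rightarrow> 'a) \<Rightarrow> (int \<Rightarrow> 'a)" where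
  "glue x y = (\<lambda>k. if 0 \<le> k then y (nat k) else x (nat (- k - 1)))"

definition biinf_power :: "'a list \<Rightarrow> (int \<Rightarrow> 'a)" where
  "biinf_power w = glue (left_power w) (right_power w)"

text \<open>\<open>d n\<close> is the symbol written \<open>n\<close>. In the last two cases \<open>n = 2q+2\<close> with words \<open>0\<close> and
  \<open>1 \<dots> n\<close>, respectively \<open>n = 2q+3\<close> with word \<open>0 \<dots> n-1\<close>.\<close>

definition nSigma :: "(nat \<Rightarrow> 'a) \<Rightarrow> nat \<Rightarrow> (int \<Rightarrow> 'a) set" where
  "nSigma d n =
    (if n = 0 then
       orb (biinf_power [d 0]) \<union> orb (glue (left_power [d 0]) (prepend [d 1] (right_power [d 0])))
     else if n = 1 then
       orb (biinf_power [d 0]) \<union> orb (biinf_power [d 1]) \<union>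
       orb (glue (left_power [d 0]) (right_power [d 1]))
     else if even n then
       orb (biinf_power [d 0]) \<union> orb (biinf_power (map d [1..<n + 1])) \<union>
       orb (glue (left_power [d 0]) (right_power (map d [1..<n + 1])))
     else orb (biinf_power (map d [0..<n])))"

text \<open>\<open>(l, [\<lambda>\<^sub>0, \<dots>, \<lambda>\<^sub>l], m, [\<epsilon>\<^sub>0, \<dots>, \<epsilon>\<^sub>l\<^sub>-\<^sub>1])\<close>\<close>

type_synonym ptuple = "nat \<times> nat list \<times> nat \<times> nat list"

definition Ptuples :: "ptuple set" where
  "Ptuples =
    {(l, lam, m, eps). length lam = l + 1 \<and> length eps = l \<and> set eps \<subseteq> {0, 1} \<and>
       (\<forall>i\<le>l. 0 < lam ! i \<and> even (lam ! i)) \<and> m < lam ! 0 \<and> odd m}"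

fun pseq :: "ptuple \<Rightarrow> nat list" where
  "pseq (l, lam, m, eps) = l # lam @ m # eps"

fun pSigma :: "(nat \<Rightarrow> nat \<Rightarrow> 'a) \<Rightarrow> (nat \<Rightarrow> 'a) \<Rightarrow> ptuple \<Rightarrow> (int \<Rightarrow> 'a) set" where
  "pSigma a b (l, lam, m, eps) =
    (let w = (\<lambda>i. map (a i) [0..<lam ! i]) in
      (\<Union>i\<le>l. orb (biinf_power (w i))) \<union>
      (\<Union>i<l. orb (glue (left_power (w (i + eps ! i))) (right_power (w (i + 1 - eps ! i))))) \<union>
      orb (glue (left_power (w l)) (prepend (map b [0..<m]) (right_power (w 0)))))"

definition Fset :: "(nat \<Rightarrow> nat \<Rightarrow> 'a) \<Rightarrow> (nat \<Rightarrow> 'a) \<Rightarrow> ptuple \<Rightarrow> ptuple set" where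
  "Fset a b p = {p' \<in> Ptuples. shift_graph (pSigma a b p') \<equiv>ic shift_graph (pSigma a b p)}"

definition lex_min :: "ptuple set \<Rightarrow> ptuple" where
  "lex_min F = (THE p. p \<in> F \<and> (\<forall>p'\<in>F. p' = p \<or> (pseq p, pseq p') \<in> lexord {(i, j). i < j}))"

definition basis_family ::
  "(nat \<Rightarrow> 'a) \<Rightarrow> (nat \<Rightarrow> nat \<Rightarrow> 'a) \<Rightarrow> (nat \<Rightarrow> 'a) \<Rightarrow> (int \<Rightarrow> 'a) tgraph set" where
  "basis_family d a b =
    {shift_graph (nSigma d n) | n. True} \<union> {shift_graph (pSigma a b p) | p. p \<in> Ptuples}"

definition antichain_family ::
  "(nat \<Rightarrow> 'a) \<Rightarrow> (nat \<Rightarrow> nat \<Rightarrow> 'a) \<Rightarrow> (nat \<Rightarrow> 'a) \<Rightarrow> (int \<Rightarrow> 'a) tgraph set" where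
  "antichain_family d a b =
    {shift_graph (nSigma d n) | n. True} \<union>
    {shift_graph (pSigma a b m) | m. \<exists>p\<in>Ptuples. m = lex_min (Fset a b p)}"

end

theory Submission
  imports Defs
begin

text \<open>
  A colouring or an embedding that is continuous on a subshift depends, up to any given precision,
  on a finite window (compactness). So everything is stated through windows: \<open>agree N x
  y\<close> says that two points coincide on \<open>[-N, N]\<close>, and
  \<open>has_cont_2coloring_iff\<close> and \<open>ic_le_iff\<close> translate the two notions.

  The central notion is that of a \<^emph>\<open>critical\<close> subshift: it has no colouring,
  but every proper subshift of it has one. Non-colourability passes to intersections of chains, so
  by Zorn's lemma every subshift without colouring contains a critical one
  (\<open>exists_critical\<close>). An embedding of a critical subshift maps each orbit onto an
  orbit, forwards or backwards (\<open>emb_orbit\<close>). Hence its image is a subshift again,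
  embeddings between critical subshifts are bijections with continuous inverse, and critical
  subshifts are minimal in the quasi-order (\<open>critical_minimal\<close>). The whole theorem is
  about critical subshifts: in the classes of countable subshifts they form a basis of minimal
  elements, and every basis of a class has to contain an equivalent copy of each critical member.

  \<^item> Rank at most two. Such a countable subshift is a finite union of periodic orbits and of
  orbits that are asymptotic to periodic ones at both ends (\<open>rank_two_hetsys\<close>), and
  two of them with the same combinatorics are isomorphic (\<open>het_iso\<close>). Only three
  things obstruct a colouring: a cycle of odd length greater than one, a fixed point that is not
  isolated, and a closed chain of connecting orbits with an odd total phase. The first two produce
  the subshifts \<open>nSigma\<close>, a shortest chain of the third kind produces a
  \<open>pSigma\<close> (\<open>critical_rank_two\<close>). All of these are critical, so
  comparable ones are equivalent. The periods of their points distinguish the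
  \<open>nSigma\<close> from each other, except that the number of fixed points is needed for the
  first two, and from the \<open>pSigma\<close>; passing to lexicographically minimal tuples
  removes the equivalences among the latter.

  \<^item> Counting. A subshift is determined up to isomorphism by its set of words, so there are
  at most continuum many classes. Conversely it suffices to have continuum many critical subshifts
  over one finite alphabet, each with a dense orbit: an isomorphism is determined by a finite
  block code and by the direction in which it runs through the dense orbit, so each of them is
  isomorphic to only countably many of them (\<open>ic_classes_continuum\<close>). For countable
  subshifts of rank three such a family is \<open>\<Theta>b\<close>: one aperiodic orbit changes
  its phase once and carries increasingly rare marks, whose positions encode a set of natural
  numbers. Without countability such a family is \<open>\<Theta>c\<close>, consisting of infinite
  minimal subshifts generated by Toeplitz sequences with odd periods. These are perfect, so their
  Cantor-Bendixson rank is zero and the answer is the same for every rank.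
\<close>

section \<open>Shift spaces through windows\<close>

definition sh :: "int \<Rightarrow> (int \<Rightarrow> 'a) \<Rightarrow> (int \<Rightarrow> 'a)" where
  "sh k x = (\<lambda>i. x (i + k))"

definition agree :: "int \<Rightarrow> (int \<Rightarrow> 'a) \<Rightarrow> (int \<Rightarrow> 'a) \<Rightarrow> bool" where
  "agree N x y \<longleftrightarrow> (\<forall>k. \<bar>k\<bar> \<le> N \<longrightarrow> x k = y k)"

text \<open>The sets \<^term>\<open>{y. agree N x y}\<close> form a neighbourhood base at \<open>x\<close>, so this is closedness in
  the product topology.\<close>

definition wclosed :: "(int \<Rightarrow> 'a) set \<Rightarrow> bool" where
  "wclosed C \<longleftrightarrow> (\<forall>y. (\<forall>N. \<exists>z\<in>C. agree N z y) \<longrightarrow> y \<in> C)"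

text \<open>The alphabet may have fewer than two symbols, since symbols can always be added.\<close>

definition subsh :: "(int \<Rightarrow> 'a) set \<Rightarrow> bool" where
  "subsh C \<longleftrightarrow> (\<exists>A. finite A \<and> (\<forall>x\<in>C. \<forall>k. x k \<in> A)) \<and> wclosed C \<and> (\<forall>x\<in>C. \<forall>k. sh k x \<in> C)"

lemma sh_0 [simp]: "sh 0 x = x"
  by (simp add: sh_def)

lemma sh_sh [simp]: "sh j (sh k x) = sh (j + k) x"
  by (simp add: sh_def algebra_simps)

lemma sh_apply: "sh k x i = x (i + k)"
  by (simp add: sh_def)

lemma shift_eq_sh: "shift x = sh 1 x"
  by (simp add: sh_def shift_def)

lemma sh_inject [simp]: "sh k x = sh k y \<longleftrightarrow> x = y"
proof
  assume "sh k x = sh k y"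
  then have "sh (-k) (sh k x) = sh (-k) (sh k y)" by simp
  then show "x = y" by simp
qed simp

lemma sh_eq_iff: "sh k x = sh m y \<longleftrightarrow> sh (k - m) x = y"
proof -
  have "sh k x = sh m (sh (k - m) x)" by simp
  then show ?thesis by (metis sh_inject)
qed

lemma orb_eq: "orb x = range (\<lambda>k. sh k x)"
  by (auto simp: orb_def sh_def)

lemma orbD: "y \<in> orb x \<Longrightarrow> \<exists>k. y = sh k x"
  by (auto simp: orb_eq)

lemma orb_self [simp]: "x \<in> orb x"
  unfolding orb_eq by (metis rangeI sh_0)

lemma sh_in_orb [simp]: "sh k x \<in> orb x"
  unfolding orb_eq by blast

lemma sh_orb: "x \<in> orb y \<Longrightarrow> sh k x \<in> orb y"
  unfolding orb_eq by auto

lemma countable_orb: "countable (orb x)"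
  unfolding orb_eq by simp

lemma agree_refl [simp]: "agree N x x"
  by (simp add: agree_def)

lemma agree_sym: "agree N x y \<Longrightarrow> agree N y x"
  by (simp add: agree_def)

lemma agree_trans: "agree N x y \<Longrightarrow> agree N y z \<Longrightarrow> agree N x z"
  by (simp add: agree_def)

lemma agree_mono: "agree M x y \<Longrightarrow> N \<le> M \<Longrightarrow> agree N x y"
  by (auto simp: agree_def)

lemma agreeD: "agree N x y \<Longrightarrow> \<bar>k\<bar> \<le> N \<Longrightarrow> x k = y k"
  by (auto simp: agree_def)

lemma agree_all: "(\<And>N. agree N x y) \<Longrightarrow> x = y"
proof
  fix k assume "\<And>N. agree N x y"
  then show "x k = y k" using agreeD[of "\<bar>k\<bar>" x y k] by simp
qed

lemma agree_sh: "agree M x y \<Longrightarrow> N + \<bar>k\<bar> \<le> M \<Longrightarrow> agree N (sh k x) (sh k y)"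
  by (auto simp: agree_def sh_def)

lemma wclosedD: "wclosed C \<Longrightarrow> (\<And>N. \<exists>z\<in>C. agree N z y) \<Longrightarrow> y \<in> C"
  by (auto simp: wclosed_def)

lemma wclosed_Inter: "(\<And>C. C \<in> F \<Longrightarrow> wclosed C) \<Longrightarrow> wclosed (\<Inter>F)"
  unfolding wclosed_def by blast

lemma wclosed_Un:
  assumes "wclosed C" "wclosed D" shows "wclosed (C \<union> D)"
  unfolding wclosed_def
proof (intro allI impI, rule ccontr)
  fix y assume a: "\<forall>N. \<exists>z\<in>C \<union> D. agree N z y" and "y \<notin> C \<union> D"
  then obtain M N where "\<forall>z\<in>C. \<not> agree M z y" "\<forall>z\<in>D. \<not> agree N z y"
    using assms unfolding wclosed_def by blast
  moreover obtain z where "z \<in> C \<union> D" "agree (max M N) z y" using a by blast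
  ultimately show False using agree_mono[of "max M N" z y] by auto
qed

lemma wclosed_empty [simp]: "wclosed {}"
  by (simp add: wclosed_def)

lemma wclosed_single [simp]: "wclosed {x}"
  unfolding wclosed_def using agree_all by blast

lemma wclosed_UN: "finite I \<Longrightarrow> (\<And>i. i \<in> I \<Longrightarrow> wclosed (C i)) \<Longrightarrow> wclosed (\<Union>i\<in>I. C i)"
  by (induction I rule: finite_induct) (auto intro: wclosed_Un)

lemma wclosed_finite: "finite F \<Longrightarrow> wclosed F"
  using wclosed_UN[of F "\<lambda>x. {x}"] by simp

lemma subsh_sh: "subsh C \<Longrightarrow> x \<in> C \<Longrightarrow> sh k x \<in> C"
  by (auto simp: subsh_def)

lemma subsh_orb: "subsh C \<Longrightarrow> x \<in> C \<Longrightarrow> orb x \<subseteq> C"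
  by (auto simp: orb_eq subsh_sh)

lemma subsh_wclosed: "subsh C \<Longrightarrow> wclosed C"
  by (auto simp: subsh_def)

lemma subsh_subset:
  assumes "subsh C" "D \<subseteq> C" "wclosed D" "\<And>x k. x \<in> D \<Longrightarrow> sh k x \<in> D"
  shows "subsh D"
proof -
  obtain A where "finite A" "\<forall>x\<in>C. \<forall>k. x k \<in> A" using assms(1) by (auto simp: subsh_def)
  then have "\<exists>A. finite A \<and> (\<forall>x\<in>D. \<forall>k. x k \<in> A)" using assms(2) by (intro exI[of _ A]) auto
  then show ?thesis using assms(3,4) by (simp add: subsh_def)
qed

subsection \<open>Translation from the product topology\<close>

abbreviation full_topology :: "(int \<Rightarrow> 'a) topology" where
  "full_topology \<equiv> product_topology (\<lambda>_. discrete_topology UNIV) UNIV"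

lemma openin_full_iff:
  fixes U :: "(int \<Rightarrow> 'a) set"
  shows "openin full_topology U \<longleftrightarrow> (\<forall>x\<in>U. \<exists>N. \<forall>y. agree N x y \<longrightarrow> y \<in> U)"
proof
  assume o: "openin full_topology U"
  show "\<forall>x\<in>U. \<exists>N. \<forall>y. agree N x y \<longrightarrow> y \<in> U"
  proof
    fix x assume "x \<in> U"
    with o obtain V :: "int \<Rightarrow> 'a set" where V: "finite {i. V i \<noteq> UNIV}" "x \<in> Pi\<^sub>E UNIV V" "Pi\<^sub>E UNIV V \<subseteq> U"
      unfolding openin_product_topology_alt by auto
    obtain N where N: "\<And>i. V i \<noteq> UNIV \<Longrightarrow> \<bar>i\<bar> \<le> N"
    proof
      show "\<bar>i\<bar> \<le> Max (insert 0 (abs ` {i. V i \<noteq> UNIV}))" if "V i \<noteq> UNIV" for i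
        by (rule Max_ge) (use that V(1) in auto)
    qed
    have "y \<in> U" if "agree N x y" for y
    proof -
      have "y i \<in> V i" for i
      proof (cases "V i = UNIV")
        case False
        then have "x i = y i" using N agreeD[OF that] by blast
        moreover have "x i \<in> V i" using PiE_mem[OF V(2), of i] by simp
        ultimately show ?thesis by simp
      qed auto
      then show ?thesis using V(3) by auto
    qed
    then show "\<exists>N. \<forall>y. agree N x y \<longrightarrow> y \<in> U" by blast
  qed
next
  assume r: "\<forall>x\<in>U. \<exists>N. \<forall>y. agree N x y \<longrightarrow> y \<in> U"
  show "openin full_topology U"
    unfolding openin_product_topology_alt
  proof (intro ballI)
    fix x assume "x \<in> U"
    then obtain N where N: "\<And>y. agree N x y \<Longrightarrow> y \<in> U" using r by blast
    let ?V = "\<lambda>i. if \<bar>i\<bar> \<le> N then {x i} else UNIV"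
    have "{i. ?V i \<noteq> UNIV} \<subseteq> {-N..N}" by (auto split: if_splits)
    then have "finite {i. ?V i \<noteq> UNIV}" using finite_subset by blast
    moreover have "Pi\<^sub>E UNIV ?V \<subseteq> U"
    proof
      fix y assume y: "y \<in> Pi\<^sub>E UNIV ?V"
      have "x k = y k" if "\<bar>k\<bar> \<le> N" for k
        using PiE_mem[OF y, of k] that by simp
      then show "y \<in> U" by (intro N) (simp add: agree_def)
    qed
    ultimately show "\<exists>V. finite {i \<in> UNIV. V i \<noteq> topspace (discrete_topology UNIV)} \<and>
        (\<forall>i\<in>UNIV. openin (discrete_topology UNIV) (V i)) \<and> x \<in> Pi\<^sub>E UNIV V \<and> Pi\<^sub>E UNIV V \<subseteq> U"
      by (intro exI[of _ ?V]) auto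
  qed
qed

lemma closedin_full_iff: "closedin full_topology C \<longleftrightarrow> wclosed (C :: (int \<Rightarrow> 'a) set)"
proof -
  have "closedin full_topology C \<longleftrightarrow> openin full_topology (- C)"
    by (simp add: closedin_def Compl_eq_Diff_UNIV)
  also have "\<dots> \<longleftrightarrow> (\<forall>y. y \<notin> C \<longrightarrow> (\<exists>N. \<forall>z. agree N y z \<longrightarrow> z \<notin> C))"
    unfolding openin_full_iff by auto
  also have "\<dots> \<longleftrightarrow> (\<forall>y. y \<notin> C \<longrightarrow> (\<exists>N. \<forall>z\<in>C. \<not> agree N z y))"
    using agree_sym by blast
  also have "\<dots> \<longleftrightarrow> wclosed C"
    unfolding wclosed_def by blast
  finally show ?thesis .
qed

lemma topspace_subshift [simp]: "topspace (subshift_topology C) = C"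
  by (simp add: subshift_topology_def)

lemma openin_subshift_iff:
  "openin (subshift_topology C) U \<longleftrightarrow> U \<subseteq> C \<and> (\<forall>x\<in>U. \<exists>N. \<forall>y\<in>C. agree N x y \<longrightarrow> y \<in> U)"
proof
  assume "openin (subshift_topology C) U"
  then show "U \<subseteq> C \<and> (\<forall>x\<in>U. \<exists>N. \<forall>y\<in>C. agree N x y \<longrightarrow> y \<in> U)"
    unfolding subshift_topology_def openin_subtopology openin_full_iff by blast
next
  assume r: "U \<subseteq> C \<and> (\<forall>x\<in>U. \<exists>N. \<forall>y\<in>C. agree N x y \<longrightarrow> y \<in> U)"
  let ?V = "{y. \<exists>x\<in>U. \<exists>N. agree N x y \<and> (\<forall>z\<in>C. agree N x z \<longrightarrow> z \<in> U)}"
  have "openin full_topology ?V"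
    unfolding openin_full_iff
  proof
    fix y assume "y \<in> ?V"
    then obtain x N where "x \<in> U" "agree N x y" "\<forall>z\<in>C. agree N x z \<longrightarrow> z \<in> U" by blast
    then show "\<exists>N. \<forall>z. agree N y z \<longrightarrow> z \<in> ?V" using agree_trans by blast
  qed
  moreover have "U = ?V \<inter> C" using r agree_refl by blast
  ultimately show "openin (subshift_topology C) U"
    unfolding subshift_topology_def openin_subtopology by blast
qed

lemma closedin_subshift_iff:
  assumes "wclosed C"
  shows "closedin (subshift_topology C) D \<longleftrightarrow> D \<subseteq> C \<and> wclosed D"
  using assms closedin_closed_subtopology[of full_topology C D] unfolding subshift_topology_def
  by (auto simp: closedin_full_iff simp del: topspace_product_topology)

lemma subshift_iff:
  fixes C :: "(int \<Rightarrow> 'a) set"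
  assumes inf: "infinite (UNIV :: 'a set)"
  shows "subshift C \<longleftrightarrow> subsh C"
proof -
  have top: "product_topology (\<lambda>_. discrete_topology A) UNIV
      = subtopology full_topology (Pi\<^sub>E (UNIV::int set) (\<lambda>_. A))" for A :: "'a set"
    by (simp add: subtopology_product_topology)
  have cl: "wclosed (Pi\<^sub>E (UNIV::int set) (\<lambda>_. A))" for A :: "'a set"
    unfolding wclosed_def
  proof (intro allI impI)
    fix y assume y: "\<forall>N. \<exists>z\<in>Pi\<^sub>E (UNIV::int set) (\<lambda>_. A). agree N z y"
    have "y k \<in> A" for k
    proof -
      obtain z where "z \<in> Pi\<^sub>E (UNIV::int set) (\<lambda>_. A)" "agree \<bar>k\<bar> z y" using y by blast
      then show ?thesis using agreeD[of "\<bar>k\<bar>" z y k] PiE_mem[of z UNIV "\<lambda>_. A" k] by simp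
    qed
    then show "y \<in> Pi\<^sub>E UNIV (\<lambda>_. A)" by auto
  qed
  have closed: "closedin (product_topology (\<lambda>_. discrete_topology A) UNIV) C \<longleftrightarrow>
      wclosed C \<and> (\<forall>x\<in>C. \<forall>k. x k \<in> A)" for A
  proof -
    have "closedin full_topology (Pi\<^sub>E (UNIV::int set) (\<lambda>_. A))" using cl by (simp only: closedin_full_iff)
    from closedin_closed_subtopology[OF this, of C]
    have "closedin (product_topology (\<lambda>_. discrete_topology A) UNIV) C \<longleftrightarrow>
        wclosed C \<and> C \<subseteq> Pi\<^sub>E (UNIV::int set) (\<lambda>_. A)"
      by (simp only: closedin_full_iff top[of A, symmetric])
    then show ?thesis by (auto simp: PiE_iff)
  qed
  have img: "shift ` C = C \<longleftrightarrow> (\<forall>x\<in>C. \<forall>k. sh k x \<in> C)"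
  proof
    assume s: "shift ` C = C"
    have up: "x \<in> C \<Longrightarrow> sh (int n) x \<in> C" for n x
    proof (induction n)
      case (Suc n)
      then have "sh 1 (sh (int n) x) \<in> C" using s by (metis imageI shift_eq_sh)
      then show ?case by (simp add: algebra_simps)
    qed simp
    have down: "x \<in> C \<Longrightarrow> sh (- int n) x \<in> C" for n x
    proof (induction n)
      case (Suc n)
      then obtain z where z: "z \<in> C" "sh (- int n) x = sh 1 z" using s by (metis imageE shift_eq_sh)
      then have "sh (-1) (sh (- int n) x) = z" by simp
      then show ?case using z(1) by (simp add: algebra_simps)
    qed simp
    show "\<forall>x\<in>C. \<forall>k. sh k x \<in> C"
    proof (intro ballI allI)
      fix x k assume "x \<in> C"
      then show "sh k x \<in> C" using up[of x "nat k"] down[of x "nat (-k)"] by (cases "0 \<le> k") auto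
    qed
  next
    assume i: "\<forall>x\<in>C. \<forall>k. sh k x \<in> C"
    have "x \<in> shift ` C" if "x \<in> C" for x
    proof -
      have "x = shift (sh (-1) x)" by (simp add: shift_eq_sh)
      then show ?thesis using i that by blast
    qed
    then show "shift ` C = C" using i by (auto simp: shift_eq_sh)
  qed
  show ?thesis
  proof
    assume "subshift C" then show "subsh C"
      unfolding subshift_def subsh_def closed img by blast
  next
    assume s: "subsh C"
    then obtain A where A: "finite A" "\<forall>x\<in>C. \<forall>k. x k \<in> A" by (auto simp: subsh_def)
    obtain B :: "'a set" where B: "finite B" "card B = 2" using inf infinite_arbitrarily_large by blast
    have "2 \<le> card (A \<union> B)" using A(1) B card_mono[of "A \<union> B" B] by simp
    moreover have "closedin (product_topology (\<lambda>_. discrete_topology (A \<union> B)) UNIV) C"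
      using s A(2) unfolding closed by (auto simp: subsh_def)
    ultimately show "subshift C"
      using s A(1) B(1) img unfolding subshift_def subsh_def by blast
  qed
qed

subsection \<open>Compactness\<close>

lemma subsh_compact:
  assumes "subsh C" shows "compact_space (subshift_topology C)"
proof -
  obtain A where A: "finite A" "\<forall>x\<in>C. \<forall>k. x k \<in> A" using assms by (auto simp: subsh_def)
  have "compact_space (product_topology (\<lambda>_::int. discrete_topology A) UNIV)"
    by (simp add: compact_space_product_topology compact_space_discrete_topology A(1))
  moreover have "subshift_topology C = subtopology (product_topology (\<lambda>_. discrete_topology A) UNIV) C"
    by (rule subshift_topology_alphabet) (use A(2) in blast)
  moreover have "closedin (product_topology (\<lambda>_::int. discrete_topology A) UNIV) C"
  proof -
    have "product_topology (\<lambda>_::int. discrete_topology A) UNIV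
        = subtopology full_topology (Pi\<^sub>E UNIV (\<lambda>_. A))"
      by (simp add: subtopology_product_topology)
    moreover have "closedin (subtopology full_topology (Pi\<^sub>E UNIV (\<lambda>_. A))) C"
      unfolding closedin_subtopology using A(2) subsh_wclosed[OF assms]
      by (intro exI[of _ C]) (auto simp: closedin_full_iff)
    ultimately show ?thesis by simp
  qed
  ultimately show ?thesis
    by (simp add: closedin_compact_space compact_space_subtopology)
qed

text \<open>The points that the tail of the sequence approaches on the window of radius \<open>n\<close> form
  nested nonempty closed sets.\<close>

lemma subsh_cluster_point:
  assumes C: "subsh C" and x: "\<And>n::nat. x n \<in> C"
  shows "\<exists>y\<in>C. \<forall>N m. \<exists>n\<ge>m. agree N (x n) y"
proof -
  let ?K = "\<lambda>n::nat. {y\<in>C. \<exists>m\<ge>n. agree (int n) (x m) y}"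
  have cl: "closedin (subshift_topology C) (?K n)" for n
    unfolding closedin_subshift_iff[OF subsh_wclosed[OF C]] wclosed_def
  proof (intro conjI allI impI)
    fix y assume a: "\<forall>N. \<exists>z\<in>?K n. agree N z y"
    then have "y \<in> C" using wclosedD[OF subsh_wclosed[OF C], of y] by blast
    moreover obtain z where "z \<in> ?K n" "agree (int n) z y" using a by blast
    ultimately show "y \<in> ?K n" using agree_trans by blast
  qed auto
  have "(\<Inter>n. ?K n) \<noteq> {}"
  proof (rule compact_space_imp_nest[OF subsh_compact[OF C] cl])
    show "?K n \<noteq> {}" for n using x[of n] agree_refl[of "int n" "x n"] by blast
    show "decseq ?K" unfolding decseq_def
    proof (intro allI impI subsetI)
      fix m n :: nat and y assume "m \<le> n" "y \<in> ?K n"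
      then obtain k where "k \<ge> n" "agree (int n) (x k) y" "y \<in> C" by blast
      then show "y \<in> ?K m" using \<open>m \<le> n\<close> agree_mono[of "int n" "x k" y "int m"]
        by (intro CollectI conjI exI[of _ k]) auto
    qed
  qed
  then obtain y where y: "\<And>n. y \<in> ?K n" by blast
  show ?thesis
  proof (intro bexI allI)
    show "y \<in> C" using y by blast
    fix N m show "\<exists>n\<ge>m. agree N (x n) y"
    proof -
      obtain k where "k \<ge> max m (nat N)" "agree (int (max m (nat N))) (x k) y" using y by blast
      then show ?thesis using agree_mono[of "int (max m (nat N))" "x k" y N] by auto
    qed
  qed
qed

lemma finite_chain_Inter:
  assumes "finite F" "F \<noteq> {}" "\<And>X Y. X \<in> F \<Longrightarrow> Y \<in> F \<Longrightarrow> X \<subseteq> Y \<or> Y \<subseteq> X"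
  shows "\<Inter>F \<in> F"
  using assms
proof (induction F rule: finite_ne_induct)
  case (insert X F)
  then have IF: "\<Inter>F \<in> F" by simp
  then consider "X \<subseteq> \<Inter>F" | "\<Inter>F \<subseteq> X" using insert.prems[of X "\<Inter>F"] by auto
  then show ?case
  proof cases
    case 1
    then have "\<Inter>(insert X F) = X" by auto
    then show ?thesis by simp
  next
    case 2
    then have "\<Inter>(insert X F) = \<Inter>F" by auto
    then show ?thesis using IF by simp
  qed
qed simp

text \<open>The condition \<open>P\<close> depends on a window, so it cuts out a compact set of each member of
  the chain.\<close>

lemma subsh_chain_point:
  assumes ne: "\<C> \<noteq> {}" and sub: "\<And>Z. Z \<in> \<C> \<Longrightarrow> subsh Z"
    and ch: "\<And>Z W. Z \<in> \<C> \<Longrightarrow> W \<in> \<C> \<Longrightarrow> Z \<subseteq> W \<or> W \<subseteq> Z"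
    and P: "\<And>x y. agree N x y \<Longrightarrow> P x \<Longrightarrow> P y"
    and ex: "\<And>Z. Z \<in> \<C> \<Longrightarrow> \<exists>z\<in>Z. P z"
  shows "\<exists>z\<in>\<Inter>\<C>. P z"
proof -
  obtain Z0 where Z0: "Z0 \<in> \<C>" using ne by blast
  let ?U = "(\<lambda>Z. {z\<in>Z. P z}) ` {Z\<in>\<C>. Z \<subseteq> Z0}"
  have cl: "closedin (subshift_topology Z0) X" if "X \<in> ?U" for X
  proof -
    obtain Z where Z: "Z \<in> \<C>" "Z \<subseteq> Z0" "X = {z\<in>Z. P z}" using \<open>X \<in> ?U\<close> by blast
    have "wclosed X"
      unfolding wclosed_def
    proof (intro allI impI)
      fix y assume a: "\<forall>N. \<exists>z\<in>X. agree N z y"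
      then have "y \<in> Z" using wclosedD[OF subsh_wclosed[OF sub[OF Z(1)]], of y] Z(3) by blast
      then show "y \<in> X" using a P Z(3) by blast
    qed
    then show ?thesis using Z closedin_subshift_iff[OF subsh_wclosed[OF sub[OF Z0]]] by blast
  qed
  have "\<Inter>F \<noteq> {}" if F: "finite F" "F \<subseteq> ?U" for F
  proof (cases "F = {}")
    case False
    have "X \<subseteq> Y \<or> Y \<subseteq> X" if XY: "X \<in> F" "Y \<in> F" for X Y
    proof -
      obtain Z where Z: "Z \<in> \<C>" "Z \<subseteq> Z0" "X = {z\<in>Z. P z}" using subsetD[OF F(2) XY(1)] by blast
      obtain W where W: "W \<in> \<C>" "W \<subseteq> Z0" "Y = {z\<in>W. P z}" using subsetD[OF F(2) XY(2)] by blast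
      show ?thesis using ch[OF Z(1) W(1)] Z(3) W(3) by blast
    qed
    then have "\<Inter>F \<in> F" by (rule finite_chain_Inter[OF F(1) False])
    then have "\<Inter>F \<in> ?U" by (rule subsetD[OF F(2)])
    then obtain Z where Z: "Z \<in> \<C>" "Z \<subseteq> Z0" "\<Inter>F = {z\<in>Z. P z}" by blast
    then show ?thesis using ex[OF Z(1)] by auto
  qed simp
  then have "\<Inter>?U \<noteq> {}"
    by (intro subsh_compact[OF sub[OF Z0], unfolded compact_space_fip, rule_format, of ?U] conjI ballI allI impI)
      (simp_all only: cl, blast)
  then obtain z where "z \<in> \<Inter>?U" by blast
  then have z: "z \<in> Z \<and> P z" if "Z \<in> \<C>" "Z \<subseteq> Z0" for Z using that by auto
  have "z \<in> Z" if "Z \<in> \<C>" for Z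
    using ch[OF that Z0] z[OF that] z[OF Z0] by auto
  then show ?thesis using z[OF Z0] by blast
qed

text \<open>Otherwise pairs of points that agree on longer and longer windows and have different values would
  cluster at one point, where \<open>c\<close> is locally constant.\<close>

lemma subsh_uniform:
  assumes C: "subsh C" and c: "\<And>x. x \<in> C \<Longrightarrow> \<exists>M. \<forall>y\<in>C. agree M x y \<longrightarrow> c x = c y"
  shows "\<exists>M. \<forall>x\<in>C. \<forall>y\<in>C. agree M x y \<longrightarrow> c x = c y"
proof (rule ccontr)
  assume "\<not> ?thesis"
  then have "\<forall>n::nat. \<exists>x y. x \<in> C \<and> y \<in> C \<and> agree (int n) x y \<and> c x \<noteq> c y" by blast
  from choice[OF this] obtain x where "\<forall>n::nat. \<exists>y. x n \<in> C \<and> y \<in> C \<and> agree (int n) (x n) y \<and> c (x n) \<noteq> c y" ..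
  from choice[OF this] obtain y where
    y: "\<forall>n::nat. x n \<in> C \<and> y n \<in> C \<and> agree (int n) (x n) (y n) \<and> c (x n) \<noteq> c (y n)" ..
  then have xy: "\<And>n::nat. x n \<in> C" "\<And>n. y n \<in> C"
      "\<And>n. agree (int n) (x n) (y n)" "\<And>n. c (x n) \<noteq> c (y n)" by simp_all
  obtain z where z: "z \<in> C" "\<forall>N m. \<exists>n\<ge>m. agree N (x n) z"
    using subsh_cluster_point[of C x, OF C xy(1)] ..
  obtain M where M: "\<And>w. w \<in> C \<Longrightarrow> agree M z w \<Longrightarrow> c z = c w" using c[OF z(1)] by blast
  obtain n where n: "n \<ge> nat M" "agree M (x n) z" using z(2) by blast
  have "agree M (x n) (y n)" using agree_mono[OF xy(3)[of n], of M] n(1) by simp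
  then have "c z = c (x n)" "c z = c (y n)"
    using M[OF xy(1)[of n]] M[OF xy(2)[of n]] agree_sym[OF n(2)] agree_trans by blast+
  then show False using xy(4)[of n] by simp
qed

section \<open>Colourings and embeddings in terms of windows\<close>

text \<open>By compactness a continuous colouring depends on one window of the point, so the uniform
  formulation below loses nothing; it has no topology left in it.\<close>

definition colorable :: "(int \<Rightarrow> 'a) set \<Rightarrow> bool" where
  "colorable C \<longleftrightarrow> (\<exists>(c :: (int \<Rightarrow> 'a) \<Rightarrow> bool) M. (\<forall>x\<in>C. \<forall>y\<in>C. agree M x y \<longrightarrow> c x = c y) \<and>
     (\<forall>x\<in>C. sh 1 x \<noteq> x \<longrightarrow> c (sh 1 x) \<noteq> c x))"

lemma colorableE:
  assumes "colorable C"
  obtains c :: "(int \<Rightarrow> 'a) \<Rightarrow> bool" and M where "\<forall>x\<in>C. \<forall>y\<in>C. agree M x y \<longrightarrow> c x = c y"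
    "\<forall>x\<in>C. sh 1 x \<noteq> x \<longrightarrow> c (sh 1 x) \<noteq> c x"
proof -
  from assms obtain c :: "(int \<Rightarrow> 'a) \<Rightarrow> bool" where "\<exists>M. (\<forall>x\<in>C. \<forall>y\<in>C. agree M x y \<longrightarrow> c x = c y) \<and>
     (\<forall>x\<in>C. sh 1 x \<noteq> x \<longrightarrow> c (sh 1 x) \<noteq> c x)" unfolding colorable_def ..
  then obtain M where "(\<forall>x\<in>C. \<forall>y\<in>C. agree M x y \<longrightarrow> c x = c y) \<and>
     (\<forall>x\<in>C. sh 1 x \<noteq> x \<longrightarrow> c (sh 1 x) \<noteq> c x)" ..
  then show thesis by (intro that[of M c]) (rule conjunct1, assumption, rule conjunct2)
qed

text \<open>An edge joins \<open>x\<close> and \<open>sh 1 x\<close> without direction, so its image may be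
  run through backwards; a fixed point has no edge.\<close>

definition emb :: "((int \<Rightarrow> 'a) \<Rightarrow> (int \<Rightarrow> 'b)) \<Rightarrow> (int \<Rightarrow> 'a) set \<Rightarrow> (int \<Rightarrow> 'b) set \<Rightarrow> bool" where
  "emb h T S \<longleftrightarrow> h ` T \<subseteq> S \<and> inj_on h T \<and>
     (\<forall>N. \<exists>M. \<forall>x\<in>T. \<forall>y\<in>T. agree M x y \<longrightarrow> agree N (h x) (h y)) \<and>
     (\<forall>x\<in>T. sh 1 x \<noteq> x \<longrightarrow> h (sh 1 x) = sh 1 (h x) \<or> h (sh 1 x) = sh (-1) (h x))"

definition embeds :: "(int \<Rightarrow> 'a) set \<Rightarrow> (int \<Rightarrow> 'b) set \<Rightarrow> bool" where
  "embeds T S \<longleftrightarrow> (\<exists>h. emb h T S)"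

text \<open>With the entries outside the window forgotten, a continuous map becomes locally constant, so that
  \<open>subsh_uniform\<close> applies to embeddings too.\<close>

definition win :: "int \<Rightarrow> (int \<Rightarrow> 'a) \<Rightarrow> (int \<Rightarrow> 'a)" where
  "win N x = (\<lambda>k. if \<bar>k\<bar> \<le> N then x k else undefined)"

lemma win_eq_iff: "win N x = win N y \<longleftrightarrow> agree N x y"
  by (auto simp: win_def agree_def fun_eq_iff)

lemma has_cont_2coloring_iff:
  assumes C: "subsh C"
  shows "has_cont_2coloring (shift_graph C) \<longleftrightarrow> colorable C"
proof
  assume "has_cont_2coloring (shift_graph C)"
  then obtain c where cont: "continuous_map (subshift_topology C) (discrete_topology {0, 1::nat}) c"
    and e: "\<And>x y. x \<in> C \<Longrightarrow> y \<in> C \<Longrightarrow> x \<noteq> y \<Longrightarrow> y = shift x \<or> x = shift y \<Longrightarrow> c x \<noteq> c y"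
    unfolding has_cont_2coloring_def shift_graph_def by auto
  have "\<exists>M. \<forall>y\<in>C. agree M x y \<longrightarrow> c x = c y" if x: "x \<in> C" for x
  proof -
    have "c x \<in> {0, 1}" using cont x by (auto simp: continuous_map_def)
    then have "openin (discrete_topology {0, 1}) {c x}" by auto
    from openin_continuous_map_preimage[OF cont this]
    have "openin (subshift_topology C) {y \<in> C. c y = c x}" by simp
    then have "\<forall>z\<in>{y \<in> C. c y = c x}. \<exists>N. \<forall>y\<in>C. agree N z y \<longrightarrow> y \<in> {y \<in> C. c y = c x}"
      unfolding openin_subshift_iff by (rule conjunct2)
    then obtain N where "\<forall>y\<in>C. agree N x y \<longrightarrow> y \<in> {y \<in> C. c y = c x}" using x by auto
    then show ?thesis by (intro exI[of _ N]) auto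
  qed
  then obtain M where M: "\<forall>x\<in>C. \<forall>y\<in>C. agree M x y \<longrightarrow> c x = c y" using subsh_uniform[OF C, of c] by blast
  have v: "c x = 0 \<or> c x = 1" if "x \<in> C" for x using cont that by (auto simp: continuous_map_def)
  show "colorable C"
    unfolding colorable_def
  proof (intro exI[of _ "\<lambda>x. c x = 1"] exI[of _ M] conjI ballI impI)
    fix x assume x: "x \<in> C" "sh 1 x \<noteq> x"
    have s: "sh 1 x \<in> C" using subsh_sh[OF C x(1)] .
    have "c x \<noteq> c (sh 1 x)" using e[OF x(1) s] x(2) by (auto simp: shift_eq_sh)
    then show "(c (sh 1 x) = 1) \<noteq> (c x = 1)" using v[OF x(1)] v[OF s] by auto
  next
    fix x y assume "x \<in> C" "y \<in> C" "agree M x y"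
    then have "c x = c y" using M by metis
    then show "(c x = 1) = (c y = 1)" by simp
  qed
next
  assume "colorable C"
  then obtain c :: "_ \<Rightarrow> bool" and M where cM: "\<forall>x\<in>C. \<forall>y\<in>C. agree M x y \<longrightarrow> c x = c y"
      "\<forall>x\<in>C. sh 1 x \<noteq> x \<longrightarrow> c (sh 1 x) \<noteq> c x"
    by (rule colorableE)
  have M: "c x = c y" if "x \<in> C" "y \<in> C" "agree M x y" for x y using cM(1) that by meson
  have e: "c (sh 1 x) \<noteq> c x" if "x \<in> C" "sh 1 x \<noteq> x" for x using cM(2) that by meson
  let ?c = "\<lambda>x. if c x then 1 else 0 :: nat"
  have "continuous_map (subshift_topology C) (discrete_topology {0, 1}) ?c"
    unfolding continuous_map_def
  proof (intro conjI allI impI)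
    fix U :: "nat set"
    show "openin (subshift_topology C) {x \<in> topspace (subshift_topology C). ?c x \<in> U}"
      unfolding openin_subshift_iff
    proof (intro conjI ballI)
      fix x assume x: "x \<in> {x \<in> topspace (subshift_topology C). ?c x \<in> U}"
      show "\<exists>N. \<forall>y\<in>C. agree N x y \<longrightarrow> y \<in> {x \<in> topspace (subshift_topology C). ?c x \<in> U}"
      proof (intro exI[of _ M] ballI impI)
        fix y assume y: "y \<in> C" "agree M x y"
        have "c x = c y" using M[OF _ y] x by simp
        then show "y \<in> {x \<in> topspace (subshift_topology C). ?c x \<in> U}" using x y(1) by simp
      qed
    qed auto
  qed auto
  moreover have "?c x \<noteq> ?c y" if "x \<in> C" "y \<in> C" "x \<noteq> y" "y = shift x \<or> x = shift y" for x y
    using e[of x] e[of y] that by (auto simp: shift_eq_sh)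
  ultimately show "has_cont_2coloring (shift_graph C)"
    unfolding has_cont_2coloring_def shift_graph_def by (intro exI[of _ ?c]) auto
qed

lemma ic_le_iff:
  fixes T :: "(int \<Rightarrow> 'a) set" and S :: "(int \<Rightarrow> 'b) set"
  assumes T: "subsh T" and S: "subsh S"
  shows "shift_graph T \<preceq>ic shift_graph S \<longleftrightarrow> embeds T S"
proof
  assume "shift_graph T \<preceq>ic shift_graph S"
  then obtain h where cont: "continuous_map (subshift_topology T) (subshift_topology S) h"
    and inj: "inj_on h T"
    and e: "\<And>x y. x \<in> T \<Longrightarrow> y \<in> T \<Longrightarrow> x \<noteq> y \<Longrightarrow> y = shift x \<or> x = shift y \<Longrightarrow>
        h y = shift (h x) \<or> h x = shift (h y)"
    unfolding ic_le_def shift_graph_def by auto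
  have im: "h ` T \<subseteq> S" using cont by (auto simp: continuous_map_def)
  have unif: "\<exists>M. \<forall>x\<in>T. \<forall>y\<in>T. agree M x y \<longrightarrow> agree N (h x) (h y)" for N
  proof -
    have "\<exists>M. \<forall>y\<in>T. agree M x y \<longrightarrow> win N (h x) = win N (h y)" if x: "x \<in> T" for x
    proof -
      let ?U = "{z\<in>S. agree N (h x) z}"
      have "openin (subshift_topology S) ?U"
        unfolding openin_subshift_iff by (auto intro: agree_trans)
      from openin_continuous_map_preimage[OF cont this]
      have "openin (subshift_topology T) {y\<in>T. h y \<in> ?U}" by simp
      then have "\<forall>z\<in>{y\<in>T. h y \<in> ?U}. \<exists>M. \<forall>y\<in>T. agree M z y \<longrightarrow> y \<in> {y\<in>T. h y \<in> ?U}"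
        unfolding openin_subshift_iff by (rule conjunct2)
      moreover have "x \<in> {y\<in>T. h y \<in> ?U}" using x im by auto
      ultimately obtain M where "\<forall>y\<in>T. agree M x y \<longrightarrow> y \<in> {y\<in>T. h y \<in> ?U}" by auto
      then show ?thesis unfolding win_eq_iff by (intro exI[of _ M]) auto
    qed
    from subsh_uniform[OF T this] show ?thesis by (simp add: win_eq_iff)
  qed
  have "h (sh 1 x) = sh 1 (h x) \<or> h (sh 1 x) = sh (-1) (h x)" if x: "x \<in> T" "sh 1 x \<noteq> x" for x
  proof -
    have "h (sh 1 x) = sh 1 (h x) \<or> h x = sh 1 (h (sh 1 x))"
      using e[OF x(1) subsh_sh[OF T x(1)], of 1] x(2) by (auto simp: shift_eq_sh)
    then show ?thesis
    proof
      assume "h x = sh 1 (h (sh 1 x))"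
      then have "sh (-1) (h x) = h (sh 1 x)" by simp
      then show ?thesis by simp
    qed simp
  qed
  then show "embeds T S" unfolding embeds_def emb_def using im inj unif by blast
next
  assume "embeds T S"
  then obtain h where h: "h ` T \<subseteq> S" "inj_on h T"
      "\<And>N. \<exists>M. \<forall>x\<in>T. \<forall>y\<in>T. agree M x y \<longrightarrow> agree N (h x) (h y)"
      "\<And>x. x \<in> T \<Longrightarrow> sh 1 x \<noteq> x \<Longrightarrow> h (sh 1 x) = sh 1 (h x) \<or> h (sh 1 x) = sh (-1) (h x)"
    unfolding embeds_def emb_def by auto
  have "continuous_map (subshift_topology T) (subshift_topology S) h"
    unfolding continuous_map_def
  proof (intro conjI allI impI)
    show "h \<in> topspace (subshift_topology T) \<rightarrow> topspace (subshift_topology S)" using h(1) by auto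
    fix U assume U: "openin (subshift_topology S) U"
    show "openin (subshift_topology T) {x \<in> topspace (subshift_topology T). h x \<in> U}"
      unfolding openin_subshift_iff
    proof (intro conjI ballI)
      fix x assume x: "x \<in> {x \<in> topspace (subshift_topology T). h x \<in> U}"
      then obtain N where N: "\<And>y. y \<in> S \<Longrightarrow> agree N (h x) y \<Longrightarrow> y \<in> U"
        using U unfolding openin_subshift_iff by blast
      obtain M where "\<forall>x\<in>T. \<forall>y\<in>T. agree M x y \<longrightarrow> agree N (h x) (h y)" using h(3) by blast
      then show "\<exists>N. \<forall>y\<in>T. agree N x y \<longrightarrow> y \<in> {x \<in> topspace (subshift_topology T). h x \<in> U}"
        using x N h(1) by (intro exI[of _ M]) auto
    qed auto
  qed
  moreover have "h x \<noteq> h y \<and> (h y = shift (h x) \<or> h x = shift (h y))"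
    if xy: "x \<in> T" "y \<in> T" "x \<noteq> y" "y = shift x \<or> x = shift y" for x y
  proof
    show "h x \<noteq> h y" using h(2) xy by (auto simp: inj_on_def)
    have *: "h (sh 1 u) = sh 1 (h u) \<or> h u = sh 1 (h (sh 1 u))" if "u \<in> T" "sh 1 u \<noteq> u" for u
      using h(4)[OF that] by auto
    show "h y = shift (h x) \<or> h x = shift (h y)"
      using xy *[of x] *[of y] by (auto simp: shift_eq_sh)
  qed
  ultimately show "shift_graph T \<preceq>ic shift_graph S"
    unfolding ic_le_def shift_graph_def using h(1,2) by (intro exI[of _ h]) auto
qed

lemma embeds_subset: "T \<subseteq> S \<Longrightarrow> embeds T S"
  unfolding embeds_def emb_def by (intro exI[of _ id]) auto

text \<open>Injectivity keeps the two ends of an edge distinct, so the second map still sees an edge. Pulling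
  back a colouring below works for the same reason.\<close>

lemma embeds_trans:
  assumes T: "subsh T" and "embeds T S" "embeds S R"
  shows "embeds T R"
proof -
  obtain g where g: "g ` T \<subseteq> S" "inj_on g T"
      "\<And>N. \<exists>M. \<forall>x\<in>T. \<forall>y\<in>T. agree M x y \<longrightarrow> agree N (g x) (g y)"
      "\<And>x. x \<in> T \<Longrightarrow> sh 1 x \<noteq> x \<Longrightarrow> g (sh 1 x) = sh 1 (g x) \<or> g (sh 1 x) = sh (-1) (g x)"
    using assms(2) unfolding embeds_def emb_def by auto
  obtain h where h: "h ` S \<subseteq> R" "inj_on h S"
      "\<And>N. \<exists>M. \<forall>x\<in>S. \<forall>y\<in>S. agree M x y \<longrightarrow> agree N (h x) (h y)"
      "\<And>x. x \<in> S \<Longrightarrow> sh 1 x \<noteq> x \<Longrightarrow> h (sh 1 x) = sh 1 (h x) \<or> h (sh 1 x) = sh (-1) (h x)"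
    using assms(3) unfolding embeds_def emb_def by auto
  show ?thesis
    unfolding embeds_def emb_def
  proof (intro exI[of _ "h \<circ> g"] conjI ballI allI impI)
    show "(h \<circ> g) ` T \<subseteq> R" using g(1) h(1) by auto
    show "inj_on (h \<circ> g) T" using g(1,2) h(2) by (meson comp_inj_on inj_on_subset)
    fix N
    obtain M where M: "\<forall>x\<in>S. \<forall>y\<in>S. agree M x y \<longrightarrow> agree N (h x) (h y)" using h(3) by blast
    obtain L where "\<forall>x\<in>T. \<forall>y\<in>T. agree L x y \<longrightarrow> agree M (g x) (g y)" using g(3) by blast
    then show "\<exists>M. \<forall>x\<in>T. \<forall>y\<in>T. agree M x y \<longrightarrow> agree N ((h \<circ> g) x) ((h \<circ> g) y)"
      using M g(1) by (intro exI[of _ L]) (simp add: image_subset_iff)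
  next
    fix x assume x: "x \<in> T" "sh 1 x \<noteq> x"
    have gs: "g x \<in> S" "g (sh 1 x) \<in> S" using g(1) x(1) subsh_sh[OF T x(1), of 1] by auto
    have ne: "g (sh 1 x) \<noteq> g x" using g(2) x subsh_sh[OF T x(1), of 1] by (auto simp: inj_on_def)
    from g(4)[OF x] show "(h \<circ> g) (sh 1 x) = sh 1 ((h \<circ> g) x) \<or> (h \<circ> g) (sh 1 x) = sh (-1) ((h \<circ> g) x)"
    proof
      assume a: "g (sh 1 x) = sh 1 (g x)"
      then show ?thesis using h(4)[OF gs(1)] ne by simp
    next
      assume a: "g (sh 1 x) = sh (-1) (g x)"
      then have b: "g x = sh 1 (g (sh 1 x))" by simp
      then have "h (g x) = sh 1 (h (g (sh 1 x))) \<or> h (g x) = sh (-1) (h (g (sh 1 x)))"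
        using h(4)[OF gs(2)] ne by simp
      then show ?thesis by auto
    qed
  qed
qed

lemma colorable_embeds:
  assumes T: "subsh T" and "embeds T S" "colorable S"
  shows "colorable T"
proof -
  obtain h where h: "h ` T \<subseteq> S" "inj_on h T"
      "\<And>N. \<exists>M. \<forall>x\<in>T. \<forall>y\<in>T. agree M x y \<longrightarrow> agree N (h x) (h y)"
      "\<And>x. x \<in> T \<Longrightarrow> sh 1 x \<noteq> x \<Longrightarrow> h (sh 1 x) = sh 1 (h x) \<or> h (sh 1 x) = sh (-1) (h x)"
    using assms(2) unfolding embeds_def emb_def by auto
  obtain c :: "_ \<Rightarrow> bool" and M where cM: "\<forall>x\<in>S. \<forall>y\<in>S. agree M x y \<longrightarrow> c x = c y" "\<forall>x\<in>S. sh 1 x \<noteq> x \<longrightarrow> c (sh 1 x) \<noteq> c x"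
    using assms(3) by (rule colorableE)
  have M: "c x = c y" if "x \<in> S" "y \<in> S" "agree M x y" for x y using cM(1) that by meson
  have e: "c (sh 1 x) \<noteq> c x" if "x \<in> S" "sh 1 x \<noteq> x" for x using cM(2) that by meson
  obtain L where L: "\<forall>x\<in>T. \<forall>y\<in>T. agree L x y \<longrightarrow> agree M (h x) (h y)" using h(3) by blast
  show ?thesis
    unfolding colorable_def
  proof (intro exI[of _ "c \<circ> h"] exI[of _ L] conjI ballI impI)
    fix x y assume "x \<in> T" "y \<in> T" "agree L x y"
    then show "(c \<circ> h) x = (c \<circ> h) y" using M[of "h x" "h y"] L h(1) by auto
  next
    fix x assume x: "x \<in> T" "sh 1 x \<noteq> x"
    have gs: "h x \<in> S" "h (sh 1 x) \<in> S" using h(1) x(1) subsh_sh[OF T x(1), of 1] by auto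
    have ne: "h (sh 1 x) \<noteq> h x" using h(2) x subsh_sh[OF T x(1), of 1] by (auto simp: inj_on_def)
    from h(4)[OF x] show "(c \<circ> h) (sh 1 x) \<noteq> (c \<circ> h) x"
    proof
      assume a: "h (sh 1 x) = sh 1 (h x)"
      then show ?thesis using e[OF gs(1)] ne by simp
    next
      assume a: "h (sh 1 x) = sh (-1) (h x)"
      then have b: "h x = sh 1 (h (sh 1 x))" by simp
      then show ?thesis using e[OF gs(2)] ne by auto
    qed
  qed
qed

section \<open>Critical subshifts\<close>

text \<open>Inclusion is easier to handle than embeddings; \<open>critical_minimal\<close> shows that
  inclusion-minimality also yields minimality for \<open>embeds\<close>.\<close>

definition critical :: "(int \<Rightarrow> 'a) set \<Rightarrow> bool" where
  "critical C \<longleftrightarrow> subsh C \<and> \<not> colorable C \<and> (\<forall>D. subsh D \<and> D \<subset> C \<longrightarrow> colorable D)"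

definition lim_pts :: "(int \<Rightarrow> 'a) set \<Rightarrow> (int \<Rightarrow> 'a) set" where
  "lim_pts C = {x\<in>C. \<forall>N. \<exists>y\<in>C. y \<noteq> x \<and> agree N x y}"

lemma fixed_sh: "sh 1 x = x \<Longrightarrow> sh k x = x"
proof (induction k rule: int_induct[of _ 0])
  case (step1 i)
  then have "sh 1 (sh i x) = x" by simp
  then show ?case by (simp add: add.commute)
next
  case (step2 i)
  have "sh (-1) x = x" using arg_cong[OF step2.prems, of "sh (-1)"] by simp
  then have "sh (-1) (sh i x) = x" using step2 by simp
  then show ?case by simp
qed simp

lemma fixed_const: "sh 1 x = x \<Longrightarrow> x k = x 0"
  using fixed_sh[of x k] sh_apply[of k x 0] by simp

text \<open>Colours of the intersection are copied to nearby points of a late member of the chain. A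
  colouring that depends on the window of radius \<open>M\<close> isolates the fixed points by the window of
  radius \<open>M + 1\<close>, and a point all of whose shifts stay that close to a fixed point is that point;
  this is why fixed points of the intersection, which carry no edge, do no harm.\<close>

lemma noncolorable_chain_Inter:
  assumes ne: "\<C> \<noteq> {}" and sub: "\<And>Z. Z \<in> \<C> \<Longrightarrow> subsh Z \<and> \<not> colorable Z"
    and ch: "\<And>Z W. Z \<in> \<C> \<Longrightarrow> W \<in> \<C> \<Longrightarrow> Z \<subseteq> W \<or> W \<subseteq> Z"
  shows "subsh (\<Inter>\<C>) \<and> \<not> colorable (\<Inter>\<C>)"
proof -
  define I where I_def: "I = \<Inter>\<C>"
  have I_sub: "x \<in> Z" if "x \<in> I" "Z \<in> \<C>" for x Z using that by (simp add: I_def)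
  obtain Z0 where Z0: "Z0 \<in> \<C>" using ne by blast
  have I: "subsh I"
  proof (rule subsh_subset)
    show "subsh Z0" using sub Z0 by blast
    show "wclosed I" unfolding I_def using sub subsh_wclosed by (intro wclosed_Inter) blast
    show "sh k x \<in> I" if "x \<in> I" for x k
      unfolding I_def using sub subsh_sh I_sub[OF that] by (intro InterI) blast
    show "I \<subseteq> Z0" using I_sub Z0 by blast
  qed
  moreover have "\<not> colorable I"
  proof
    assume "colorable I"
    then obtain c :: "_ \<Rightarrow> bool" and M0 where cM: "\<forall>x\<in>I. \<forall>y\<in>I. agree M0 x y \<longrightarrow> c x = c y"
        "\<forall>x\<in>I. sh 1 x \<noteq> x \<longrightarrow> c (sh 1 x) \<noteq> c x"
      by (rule colorableE)
    have M0: "c x = c y" if "x \<in> I" "y \<in> I" "agree M0 x y" for x y using cM(1) that by meson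
    have e: "c (sh 1 x) \<noteq> c x" if "x \<in> I" "sh 1 x \<noteq> x" for x using cM(2) that by meson
    define M where "M = max M0 0"
    have M: "c x = c y" if "x \<in> I" "y \<in> I" "agree M x y" for x y
      by (rule M0[OF that(1,2)], rule agree_mono[OF that(3)]) (simp add: M_def)
    \<comment> \<open>The margin of two covers one shift and the isolation of fixed points.\<close>
    have "\<exists>Z\<in>\<C>. \<forall>z\<in>Z. \<exists>x\<in>I. agree (M+2) z x"
    proof (rule ccontr)
      assume "\<not> ?thesis"
      then have a: "\<exists>z\<in>Z. \<forall>x\<in>I. \<not> agree (M+2) z x" if "Z \<in> \<C>" for Z using that by blast
      have "\<exists>z\<in>\<Inter>\<C>. \<forall>x\<in>I. \<not> agree (M+2) z x"
      proof (rule subsh_chain_point[OF ne])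
        show "\<forall>x\<in>I. \<not> agree (M+2) v x" if "agree (M+2) u v" "\<forall>x\<in>I. \<not> agree (M+2) u x" for u v
          using that agree_trans by blast
      qed (use sub ch a in \<open>auto simp: I_def[symmetric]\<close>)
      then show False using agree_refl unfolding I_def[symmetric] by blast
    qed
    then obtain Z where Z1: "Z \<in> \<C>" "\<forall>z\<in>Z. \<exists>x\<in>I. agree (M+2) z x" ..
    then have Z: "Z \<in> \<C>" "\<forall>z\<in>Z. \<exists>x. x \<in> I \<and> agree (M+2) z x" by blast+
    obtain g where g: "\<forall>z\<in>Z. g z \<in> I \<and> agree (M+2) z (g z)" using bchoice[OF Z(2)] by blast
    have subZ: "subsh Z" using sub Z(1) by blast
    \<comment> \<open>Near a fixed point \<open>x\<close> both \<open>y\<close> and its shift would get the colour of \<open>x\<close>.\<close>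
    have iso: "y = x" if x: "x \<in> I" "sh 1 x = x" and y: "y \<in> I" "agree (M+1) y x" for x y
    proof -
      have "agree M (sh 1 y) (sh 1 x)" by (rule agree_sh[OF y(2)]) simp
      then have "c (sh 1 y) = c x" using M[OF subsh_sh[OF I y(1)] x(1), of 1] x(2) by simp
      moreover have "c y = c x" using M[OF y(1) x(1)] agree_mono[OF y(2), of M] by simp
      ultimately have "sh 1 y = y" using e[OF y(1)] by auto
      moreover have "y 0 = x 0" using agreeD[OF y(2), of 0] by (simp add: M_def)
      ultimately show ?thesis using fixed_const[of y] fixed_const[OF x(2)] by (metis ext)
    qed
    have near: "agree (M+1) (g (sh k z)) (sh k (g z))" if z: "z \<in> Z" and k: "\<bar>k\<bar> \<le> 1" for z k
    proof -
      have "agree (M+2) (sh k z) (g (sh k z))" using g subsh_sh[OF subZ z] by blast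
      moreover have "agree (M+1) (sh k z) (sh k (g z))"
        by (rule agree_sh[of "M+2"]) (use g z k in auto)
      ultimately show ?thesis using agree_mono[of "M+2" "sh k z" "g (sh k z)" "M+1"]
        by (auto intro: agree_trans agree_sym)
    qed
    have "colorable Z"
      unfolding colorable_def
    proof (intro exI[of _ "\<lambda>z. c (g z)"] exI[of _ "M+2"] conjI ballI impI)
      fix z w assume zw: "z \<in> Z" "w \<in> Z" "agree (M+2) z w"
      have "agree (M+2) (g z) (g w)" using g zw agree_trans agree_sym by metis
      then show "c (g z) = c (g w)" using M[of "g z" "g w"] g zw(1,2) agree_mono[of "M+2" "g z" "g w" M] by auto
    next
      fix z assume z: "z \<in> Z" "sh 1 z \<noteq> z"
      have gz: "g z \<in> I" "g (sh 1 z) \<in> I" using g z(1) subsh_sh[OF subZ z(1), of 1] by blast+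
      have "c (g (sh 1 z)) = c (sh 1 (g z))"
        by (rule M[OF gz(2) subsh_sh[OF I gz(1)]]) (use agree_mono[OF near[OF z(1), of 1], of M] in auto)
      moreover have "sh 1 (g z) \<noteq> g z"
      proof
        assume fx: "sh 1 (g z) = g z"
        have all: "g (sh k z) = g z" for k
        proof (induction k rule: int_induct[of _ 0])
          case (step1 i)
          have "agree (M+1) (g (sh 1 (sh i z))) (sh 1 (g (sh i z)))"
            by (rule near) (use subsh_sh[OF subZ z(1)] in auto)
          then have "agree (M+1) (g (sh (i+1) z)) (g z)" using step1 fx by (simp add: add.commute)
          then show ?case using iso[OF gz(1) fx] g subsh_sh[OF subZ z(1), of "i+1"] by blast
        next
          case (step2 i)
          have "agree (M+1) (g (sh (-1) (sh i z))) (sh (-1) (g (sh i z)))"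
            by (rule near) (use subsh_sh[OF subZ z(1)] in auto)
          then have "agree (M+1) (g (sh (i-1) z)) (g z)" using step2 fixed_sh[OF fx, of "-1"] by simp
          then show ?case using iso[OF gz(1) fx] g subsh_sh[OF subZ z(1), of "i-1"] by blast
        qed simp
        have "z k = g z 0" for k
        proof -
          have "agree (M+2) (sh k z) (g z)" using g subsh_sh[OF subZ z(1), of k] all[of k] by metis
          then have "sh k z 0 = g z 0" by (rule agreeD) (simp add: M_def)
          then show ?thesis by (simp add: sh_apply)
        qed
        then have "sh 1 z = z" by (simp add: fun_eq_iff sh_apply)
        then show False using z(2) by simp
      qed
      ultimately show "c (g (sh 1 z)) \<noteq> c (g z)" using e[OF gz(1)] by simp
    qed
    then show False using sub Z(1) by blast
  qed
  ultimately show ?thesis by (simp add: I_def)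
qed

text \<open>Zorn's lemma for descending chains, that is, for the complements.\<close>

lemma exists_critical:
  assumes S: "subsh S" "\<not> colorable S"
  shows "\<exists>T\<subseteq>S. critical T"
proof -
  let ?A = "{- Z |Z. Z \<subseteq> S \<and> subsh Z \<and> \<not> colorable Z}"
  have "\<exists>M\<in>?A. \<forall>X\<in>?A. M \<subseteq> X \<longrightarrow> X = M"
  proof (rule subset_Zorn_nonempty)
    show "?A \<noteq> {}" using S by blast
    fix \<C> assume c: "\<C> \<noteq> {}" "subset.chain ?A \<C>"
    let ?D = "uminus ` \<C>"
    have D: "Z \<subseteq> S \<and> subsh Z \<and> \<not> colorable Z" if Z: "Z \<in> ?D" for Z
    proof -
      have "- Z \<in> \<C>" using Z by auto
      then have "- Z \<in> ?A" using c(2) by (meson subsetD subset_chain_def)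
      then show ?thesis by auto
    qed
    have ch: "Z \<subseteq> W \<or> W \<subseteq> Z" if "Z \<in> ?D" "W \<in> ?D" for Z W
    proof -
      have "- Z \<in> \<C>" "- W \<in> \<C>" using that by auto
      then have "- Z \<subseteq> - W \<or> - W \<subseteq> - Z" using c(2) by (meson subset_chain_def)
      then show ?thesis by auto
    qed
    have i: "subsh (\<Inter>?D) \<and> \<not> colorable (\<Inter>?D)"
      by (rule noncolorable_chain_Inter) (use c(1) D ch in auto)
    obtain X where X: "X \<in> \<C>" using c(1) by blast
    then have "\<Inter>?D \<subseteq> - X" by auto
    also have "- X \<subseteq> S" using D[of "- X"] X by auto
    finally have "\<Inter>?D \<subseteq> S" .
    moreover have "\<Union>\<C> = - \<Inter>?D" by auto
    ultimately show "\<Union>\<C> \<in> ?A" using i by (intro CollectI exI[of _ "\<Inter>?D"]) simp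
  qed
  then obtain Y where Y: "Y \<in> ?A" and m: "\<forall>X\<in>?A. Y \<subseteq> X \<longrightarrow> X = Y" ..
  define Z where "Z = - Y"
  have Z: "Z \<subseteq> S" "subsh Z" "\<not> colorable Z" using Y unfolding Z_def by auto
  have "colorable D" if D: "subsh D" "D \<subset> Z" for D
  proof (rule ccontr)
    assume "\<not> colorable D"
    then have "- D \<in> ?A" using D Z(1) by (intro CollectI exI[of _ D]) auto
    moreover have "Y \<subseteq> - D" using D(2) unfolding Z_def by auto
    ultimately have "- D = Y" using m by blast
    then show False using D(2) unfolding Z_def by auto
  qed
  then have "critical Z" unfolding critical_def using Z(2,3) by simp
  then show ?thesis using Z(1) by (intro exI[of _ Z]) simp
qed

lemma period2_sh:
  assumes "sh 2 x = x" shows "sh k x = (if even k then x else sh 1 x)"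
proof -
  have ev: "sh (2 * j) x = x" for j
  proof (induction j rule: int_induct[of _ 0])
    case (step1 i)
    have "sh 2 (sh (2 * i) x) = x" using step1 assms by simp
    moreover have "sh 2 (sh (2 * i) x) = sh (2 * (i + 1)) x" by (simp add: algebra_simps)
    ultimately show ?case by simp
  next
    case (step2 i)
    have "sh (-2) x = x" using arg_cong[OF assms, of "sh (-2)"] by simp
    then have "sh (-2) (sh (2 * i) x) = x" using step2 by simp
    moreover have "sh (-2) (sh (2 * i) x) = sh (2 * (i - 1)) x" by (simp add: algebra_simps)
    ultimately show ?case by simp
  qed simp
  show ?thesis
  proof (cases "even k")
    case True
    then obtain j where "k = 2 * j" by (elim evenE)
    then show ?thesis using ev by simp
  next
    case False
    then obtain j where "k = 2 * j + 1" by (elim oddE)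
    then have "sh k x = sh 1 (sh (2 * j) x)" by (simp add: add.commute)
    then show ?thesis using ev False by simp
  qed
qed

lemma period2_agree_eq:
  assumes "sh 2 x = x" "sh 2 y = y" "agree 1 x y" shows "x = y"
proof
  fix k
  have "x 0 = y 0" "x 1 = y 1" using agreeD[OF assms(3)] by auto
  moreover have *: "z k = (if even k then z 0 else z 1)" if "sh 2 z = z" for z :: "int \<Rightarrow> 'a"
    using fun_cong[OF period2_sh[OF that, of k], of 0] by (simp add: sh_apply split: if_splits)
  ultimately show "x k = y k" using *[OF assms(1)] *[OF assms(2)] by (cases "even k") auto
qed

lemma not_lim_ptsD: "x \<in> C \<Longrightarrow> x \<notin> lim_pts C \<Longrightarrow> \<exists>N. \<forall>y\<in>C. agree N x y \<longrightarrow> y = x"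
  by (auto simp: lim_pts_def)

lemma lim_ptsD: "x \<in> lim_pts C \<Longrightarrow> \<exists>y\<in>C. y \<noteq> x \<and> agree N x y"
  by (auto simp: lim_pts_def)

text \<open>An isolated orbit with at most two points can be coloured on its own, so criticality does
  not tolerate one.\<close>

lemma critical_nonisolated:
  assumes T: "critical T" and x: "x \<in> T" "sh 2 x = x"
  shows "x \<in> lim_pts T"
proof (rule ccontr)
  have S: "subsh T" using T by (simp add: critical_def)
  assume "x \<notin> lim_pts T"
  then obtain N where N: "\<forall>y\<in>T. agree N x y \<longrightarrow> y = x" using not_lim_ptsD[OF x(1)] by auto
  have orb: "y \<in> orb x \<longleftrightarrow> y = x \<or> y = sh 1 x" for y
  proof
    assume "y \<in> orb x"
    then obtain k where "y = sh k x" unfolding orb_eq by auto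
    then show "y = x \<or> y = sh 1 x" using period2_sh[OF x(2), of k] by auto
  qed auto
  have iso: "z = y" if y: "y \<in> orb x" and z: "z \<in> T" "agree (N+1) y z" for y z
  proof -
    obtain k where k: "y = sh k x" "\<bar>k\<bar> \<le> 1" using y orb by (metis abs_0 abs_1 order_refl sh_0 zero_le_one)
    have "agree N (sh (-k) y) (sh (-k) z)" by (rule agree_sh[OF z(2)]) (use k(2) in simp)
    then have "sh (-k) z = x" using N subsh_sh[OF S z(1)] k(1) by simp
    then show ?thesis using k(1) by (metis add.right_inverse sh_0 sh_sh)
  qed
  let ?D = "T - orb x"
  have D: "subsh ?D"
  proof (rule subsh_subset[OF S])
    show "wclosed ?D"
      unfolding wclosed_def
    proof (intro allI impI)
      fix y assume a: "\<forall>N. \<exists>z\<in>?D. agree N z y"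
      have yT: "y \<in> T" using wclosedD[OF subsh_wclosed[OF S]] a by blast
      obtain z where z: "z \<in> ?D" "agree (N+1) z y" using a by blast
      then have "y \<notin> orb x" using iso[of y z] agree_sym by blast
      then show "y \<in> ?D" using yT by simp
    qed
    show "sh k y \<in> ?D" if "y \<in> ?D" for k y
    proof -
      have "y \<in> orb x" if "sh k y \<in> orb x" using sh_orb[OF that, of "-k"] by simp
      then show ?thesis using subsh_sh[OF S] \<open>y \<in> ?D\<close> by blast
    qed
  qed auto
  have "?D \<subset> T" using x(1) orb_self[of x] by blast
  then have "colorable ?D" using T D by (simp add: critical_def)
  then obtain c :: "_ \<Rightarrow> bool" and M where cM: "\<forall>x\<in>?D. \<forall>y\<in>?D. agree M x y \<longrightarrow> c x = c y"
      "\<forall>x\<in>?D. sh 1 x \<noteq> x \<longrightarrow> c (sh 1 x) \<noteq> c x" by (rule colorableE)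
  let ?c = "\<lambda>y. if y \<in> orb x then y = x else c y"
  have "colorable T"
    unfolding colorable_def
  proof (intro exI[of _ ?c] exI[of _ "max M (N+1)"] conjI ballI impI)
    fix y z assume yz: "y \<in> T" "z \<in> T" "agree (max M (N+1)) y z"
    have 1: "agree (N+1) y z" "agree (N+1) z y" "agree M y z"
      using agree_mono[OF yz(3)] agree_mono[OF agree_sym[OF yz(3)]] by auto
    show "?c y = ?c z"
    proof (cases "y \<in> orb x \<or> z \<in> orb x")
      case True
      then have "y = z" using iso[of y z] iso[of z y] yz 1 by metis
      then show ?thesis by simp
    next
      case False
      then show ?thesis using cM(1) yz(1,2) 1(3) by simp
    qed
  next
    fix y assume y: "y \<in> T" "sh 1 y \<noteq> y"
    have eq: "sh 1 y \<in> orb x \<longleftrightarrow> y \<in> orb x" using sh_orb[of y x 1] sh_orb[of "sh 1 y" x "-1"] by auto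
    show "?c (sh 1 y) \<noteq> ?c y"
    proof (cases "y \<in> orb x")
      case True
      then have "y = x \<or> y = sh 1 x" using orb by simp
      then show ?thesis
      proof
        assume "y = x" then show ?thesis using eq True y(2) by simp
      next
        assume "y = sh 1 x"
        then have "sh 1 y = x" using x(2) by simp
        then show ?thesis using eq True y(2) by auto
      qed
    next
      case False
      then show ?thesis using cM(2) y eq by simp
    qed
  qed
  then show False using T by (simp add: critical_def)
qed

lemma abs_int_cases1: "\<bar>k\<bar> = (1::int) \<Longrightarrow> k = 1 \<or> k = -1"
  by linarith

text \<open>A path \<open>\<int>\<close> or a cycle of length at least three can be mapped injectively along edges only in
  one direction. Shorter orbits are limits of longer ones, hence the same holds for them, with a
  direction that does not matter.\<close>

lemma emb_orbit:
  assumes T: "critical T" and h: "emb h T S" and x: "x \<in> T"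
  shows "(\<forall>k. h (sh k x) = sh k (h x)) \<or> (\<forall>k. h (sh k x) = sh (-k) (h x))"
proof -
  have S: "subsh T" using T by (simp add: critical_def)
  have inj: "u = v" if "u \<in> T" "v \<in> T" "h u = h v" for u v
    using h that unfolding emb_def inj_on_def by blast
  have unif: "\<exists>M. \<forall>x\<in>T. \<forall>y\<in>T. agree M x y \<longrightarrow> agree N (h x) (h y)" for N
    using h unfolding emb_def by blast
  have hom: "h (sh 1 u) = sh 1 (h u) \<or> h (sh 1 u) = sh (-1) (h u)" if "u \<in> T" "sh 1 u \<noteq> u" for u
    using h that unfolding emb_def by blast
  have long: "\<exists>e. \<bar>e\<bar> = 1 \<and> (\<forall>k. h (sh k y) = sh (e * k) (h y))" if y: "y \<in> T" "sh 2 y \<noteq> y" for y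
  proof -
    have yT: "sh k y \<in> T" for k using subsh_sh[OF S y(1)] .
    have ne1: "sh (k + 1) y \<noteq> sh k y" for k
    proof
      assume "sh (k + 1) y = sh k y"
      then have "sh 1 y = y" by (subst (asm) sh_eq_iff) simp
      then show False using fixed_sh[of y 2] y(2) by simp
    qed
    have ne2: "sh (k + 2) y \<noteq> sh k y" for k
    proof
      assume "sh (k + 2) y = sh k y"
      then have "sh 2 y = y" by (subst (asm) sh_eq_iff) simp
      then show False using y(2) by simp
    qed
    have step: "h (sh (k + 1) y) = sh 1 (h (sh k y)) \<or> h (sh (k + 1) y) = sh (-1) (h (sh k y))" for k
      using hom[OF yT[of k]] ne1[of k] by (simp add: add.commute)
    obtain e where e: "\<bar>e\<bar> = 1" "h (sh 1 y) = sh e (h y)" 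
    proof -
      consider "h (sh 1 y) = sh 1 (h y)" | "h (sh 1 y) = sh (-1) (h y)" using step[of 0] by auto
      then show thesis by cases (use that[of 1] that[of "-1"] in auto)
    qed
    have all: "h (sh (k + 1) y) = sh e (h (sh k y))" for k
    proof (induction k rule: int_induct[of _ 0])
      case base
      then show ?case using e by simp
    next
      case (step1 i)
      show ?case
      proof (rule ccontr)
        assume "\<not> ?case"
        then have "h (sh (i + 1 + 1) y) = sh (- e) (h (sh (i + 1) y))"
          using step[of "i + 1"] abs_int_cases1[OF e(1)] by auto
        also have "\<dots> = h (sh i y)" using step1 by simp
        finally have "sh (i + 2) y = sh i y" using inj[OF yT yT] by (simp add: add.assoc)
        then show False using ne2 by simp
      qed
    next
      case (step2 i)
      show ?case
      proof (rule ccontr)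
        assume "\<not> ?case"
        then have "h (sh (i - 1 + 1) y) = sh (- e) (h (sh (i - 1) y))"
          using step[of "i - 1"] abs_int_cases1[OF e(1)] by auto
        then have "sh e (h (sh i y)) = h (sh (i - 1) y)" by simp
        then have "h (sh (i + 1) y) = h (sh (i - 1) y)" using step2 by simp
        then have "sh (i + 1) y = sh (i - 1) y" using inj[OF yT yT] by blast
        then show False using ne2[of "i - 1"] by (simp add: algebra_simps)
      qed
    qed
    have "h (sh k y) = sh (e * k) (h y)" for k
    proof (induction k rule: int_induct[of _ 0])
      case (step1 i)
      then show ?case using all[of i] by (simp add: algebra_simps)
    next
      case (step2 i)
      have "h (sh i y) = sh e (h (sh (i - 1) y))" using all[of "i - 1"] by simp
      then have "sh (-e) (h (sh i y)) = h (sh (i - 1) y)" by simp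
      then show ?case using step2 by (simp add: algebra_simps)
    qed simp
    then show ?thesis using e(1) by blast
  qed
  show ?thesis
  proof (cases "sh 2 x = x")
    case False
    then obtain e where "\<bar>e\<bar> = 1" "\<forall>k. h (sh k x) = sh (e * k) (h x)" using long[OF x] by blast
    then show ?thesis using abs_int_cases1[of e] by auto
  next
    case True
    have near: "\<exists>e. \<bar>e\<bar> = 1 \<and> agree N (sh e (h x)) (h (sh 1 x)) \<and> agree N (sh (2 * e) (h x)) (h x)" for N
    proof -
      obtain M where M: "\<forall>x\<in>T. \<forall>y\<in>T. agree M x y \<longrightarrow> agree (N+2) (h x) (h y)" using unif by blast
      obtain y where y: "y \<in> T" "y \<noteq> x" "agree (max M 1 + 2) x y"
        using lim_ptsD[OF critical_nonisolated[OF T x True]] by blast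
      have "sh 2 y \<noteq> y"
        using period2_agree_eq[OF True, of y] y(2) agree_mono[OF y(3), of 1] by auto
      then obtain e where e: "\<bar>e\<bar> = 1" "\<forall>k. h (sh k y) = sh (e * k) (h y)" using long[OF y(1)] by blast
      have close: "agree (N+2) (h (sh k x)) (h (sh k y))" if "\<bar>k\<bar> \<le> 2" for k
      proof -
        have "agree M (sh k x) (sh k y)" by (rule agree_sh[OF y(3)]) (use that in auto)
        then show ?thesis using M subsh_sh[OF S x] subsh_sh[OF S y(1)] by blast
      qed
      have 0: "agree (N+2) (h x) (h y)" using close[of 0] by simp
      have "agree N (sh e (h x)) (sh e (h y))" by (rule agree_sh[OF 0]) (use e(1) in simp)
      moreover have "agree N (h (sh 1 x)) (sh e (h y))"
        using agree_mono[OF close[of 1], of N] e(2) by simp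
      moreover have "agree N (sh (2*e) (h x)) (sh (2*e) (h y))" by (rule agree_sh[OF 0]) (use e(1) in simp)
      moreover have "agree N (h x) (sh (2*e) (h y))"
        using agree_mono[OF close[of 2], of N] e(2) True by (simp add: mult.commute)
      ultimately show ?thesis using e(1) agree_sym agree_trans by blast
    qed
    have two: "sh 2 (h x) = h x"
    proof (rule agree_all)
      fix N
      obtain e where e: "\<bar>e\<bar> = 1" "agree (N+2) (sh (2 * e) (h x)) (h x)" using near[of "N+2"] by blast
      show "agree N (sh 2 (h x)) (h x)"
      proof (cases "e = 1")
        case True
        then show ?thesis using agree_mono[OF e(2), of N] by simp
      next
        case False
        then have "e = -1" using abs_int_cases1[OF e(1)] by simp
        then have "agree (N+2) (sh (-2) (h x)) (h x)" using e(2) by simp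
        from agree_sh[OF this, of N 2] have "agree N (sh 2 (sh (-2) (h x))) (sh 2 (h x))" by simp
        then show ?thesis by (simp add: agree_sym)
      qed
    qed
    have one: "h (sh 1 x) = sh 1 (h x)"
    proof (rule agree_all)
      fix N
      obtain e where e: "\<bar>e\<bar> = 1" "agree N (sh e (h x)) (h (sh 1 x))" using near[of N] by blast
      have "odd e" using abs_int_cases1[OF e(1)] by auto
      then have "sh e (h x) = sh 1 (h x)" using period2_sh[OF two, of e] by simp
      then show "agree N (h (sh 1 x)) (sh 1 (h x))" using e(2) agree_sym by simp
    qed
    have "h (sh k x) = sh k (h x)" for k
      using period2_sh[OF True, of k] period2_sh[OF two, of k] one by simp
    then show ?thesis by blast
  qed
qed

text \<open>Orbits are mapped onto orbits, which gives invariance; closedness is compactness of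
  \<open>T\<close>.\<close>

lemma image_subsh:
  assumes T: "critical T" and S: "subsh S" and h: "emb h T S"
  shows "subsh (h ` T)"
proof (rule subsh_subset[OF S])
  have sT: "subsh T" using T by (simp add: critical_def)
  show sub: "h ` T \<subseteq> S" using h unfolding emb_def by blast
  show "sh k y \<in> h ` T" if y: "y \<in> h ` T" for y k
  proof -
    obtain x where x: "x \<in> T" "y = h x" using y by blast
    from emb_orbit[OF T h x(1)] have "sh k y = h (sh k x) \<or> sh k y = h (sh (-k) x)"
      using x(2) by (metis minus_minus)
    then show ?thesis using subsh_sh[OF sT x(1)] by blast
  qed
  show "wclosed (h ` T)"
    unfolding wclosed_def
  proof (intro allI impI)
    fix y assume a: "\<forall>N. \<exists>z\<in>h ` T. agree N z y"
    have "\<forall>n::nat. \<exists>x. x \<in> T \<and> agree (int n) (h x) y" using a by blast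
    from choice[OF this] obtain x where x: "\<forall>n::nat. x n \<in> T \<and> agree (int n) (h (x n)) y" ..
    then have xT: "\<And>n. x n \<in> T" by simp
    obtain z where z: "z \<in> T" "\<forall>N m. \<exists>n\<ge>m. agree N (x n) z"
      using subsh_cluster_point[OF sT, of x, OF xT] ..
    have "h z = y"
    proof (rule agree_all)
      fix N
      obtain M where M: "\<forall>x\<in>T. \<forall>y\<in>T. agree M x y \<longrightarrow> agree N (h x) (h y)" using h unfolding emb_def by blast
      obtain n where n: "n \<ge> nat N" "agree M (x n) z" using z(2) by blast
      have "agree N (h (x n)) (h z)" using M n(2) xT z(1) by blast
      moreover have "agree (int n) (h (x n)) y" using x by simp
      then have "agree N (h (x n)) y" using n(1) by (elim agree_mono) simp
      ultimately show "agree N (h z) y" using agree_sym agree_trans by blast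
    qed
    then show "y \<in> h ` T" using z(1) by blast
  qed
qed

text \<open>The image is a subshift without colouring, hence everything. The inverse is continuous by
  compactness, and it preserves edges because \<open>h\<close> intertwines the shift with itself or
  with its inverse on each orbit.\<close>

lemma critical_embedding:
  assumes T: "critical T" and S: "critical S" and h: "emb h T S"
  shows "h ` T = S" and "embeds S T"
proof -
  have sT: "subsh T" and nT: "\<not> colorable T" and sS: "subsh S" using T S by (simp_all add: critical_def)
  have im: "subsh (h ` T)" by (rule image_subsh[OF T sS h])
  have "emb h T (h ` T)" using h unfolding emb_def by blast
  then have "\<not> colorable (h ` T)" using colorable_embeds[OF sT] nT unfolding embeds_def by blast
  moreover have "h ` T \<subseteq> S" using h unfolding emb_def by blast
  ultimately show eq: "h ` T = S" using S im unfolding critical_def by blast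
  define g where "g = inv_into T h"
  have inj: "inj_on h T" using h unfolding emb_def by blast
  have gT: "g u \<in> T" and hg: "h (g u) = u" if "u \<in> S" for u
    using that eq unfolding g_def by (auto simp: inv_into_into f_inv_into_f)
  have gh: "g (h x) = x" if "x \<in> T" for x using that inj unfolding g_def by simp
  have unif: "\<exists>M. \<forall>u\<in>S. \<forall>v\<in>S. agree M u v \<longrightarrow> agree N (g u) (g v)" for N
  proof -
    have "\<exists>M. \<forall>v\<in>S. agree M u v \<longrightarrow> win N (g u) = win N (g v)" if u: "u \<in> S" for u
    proof (rule ccontr)
      assume "\<not> ?thesis"
      then have "\<forall>n::nat. \<exists>v. v \<in> S \<and> agree (int n) u v \<and> \<not> agree N (g u) (g v)"
        unfolding win_eq_iff by blast
      from choice[OF this] obtain v where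
        v: "\<forall>n::nat. v n \<in> S \<and> agree (int n) u (v n) \<and> \<not> agree N (g u) (g (v n))" ..
      have vT: "g (v n) \<in> T" for n using v gT by simp
      obtain z where z: "z \<in> T" "\<forall>N m. \<exists>n\<ge>m. agree N (g (v n)) z"
        using subsh_cluster_point[OF sT, of "\<lambda>n. g (v n)", OF vT] ..
      have "h z = u"
      proof (rule agree_all)
        fix K
        obtain M where M: "\<forall>x\<in>T. \<forall>y\<in>T. agree M x y \<longrightarrow> agree K (h x) (h y)" using h unfolding emb_def by blast
        obtain n where n: "n \<ge> nat K" "agree M (g (v n)) z" using z(2) by blast
        have "agree K (h (g (v n))) (h z)" using M n(2) vT z(1) by blast
        then have "agree K (v n) (h z)" using hg v by simp
        moreover have "agree (int n) u (v n)" using v by simp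
        then have "agree K u (v n)" using n(1) by (elim agree_mono) simp
        ultimately show "agree K (h z) u" using agree_sym agree_trans by blast
      qed
      then have "g u = z" using gh z(1) by blast
      moreover obtain n where "agree N (g (v n)) z" using z(2) by blast
      ultimately show False using v agree_sym by blast
    qed
    from subsh_uniform[OF sS this] show ?thesis by (simp add: win_eq_iff)
  qed
  have "g (sh 1 u) = sh 1 (g u) \<or> g (sh 1 u) = sh (-1) (g u)" if u: "u \<in> S" for u
  proof -
    have "sh 1 u = h (sh 1 (g u)) \<or> sh 1 u = h (sh (-1) (g u))"
      using emb_orbit[OF T h gT[OF u]] hg[OF u] by (metis minus_minus)
    then show ?thesis using gh subsh_sh[OF sT gT[OF u]] by metis
  qed
  moreover have "g ` S \<subseteq> T" using gT by blast
  moreover have "inj_on g S" using hg by (metis inj_onI)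
  ultimately have "emb g S T" using unif unfolding emb_def by blast
  then show "embeds S T" unfolding embeds_def by blast
qed

text \<open>A critical subshift inside \<open>T\<close> is mapped onto \<open>S\<close>, and that embedding
  can be inverted.\<close>

lemma critical_minimal:
  assumes S: "critical S" and T: "subsh T" "\<not> colorable T" and e: "embeds T S"
  shows "embeds S T"
proof -
  obtain R where R: "R \<subseteq> T" "critical R" using exists_critical[OF T] by blast
  have sS: "subsh S" and sR: "subsh R" using S R(2) by (simp_all add: critical_def)
  have "embeds R S" using embeds_trans[OF sR embeds_subset[OF R(1)] e] .
  then obtain h where "emb h R S" unfolding embeds_def by blast
  then have "embeds S R" by (rule critical_embedding(2)[OF R(2) S])
  then show ?thesis using embeds_trans[OF sS _ embeds_subset[OF R(1)]] by blast
qed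

section \<open>Finite unions of eventually periodic orbits\<close>

definition periodic :: "(int \<Rightarrow> 'a) \<Rightarrow> bool" where
  "periodic x \<longleftrightarrow> (\<exists>n>0. sh n x = x)"

text \<open>Over a discrete alphabet two points are forward asymptotic only if they agree from some time on.\<close>

definition fwd :: "(int \<Rightarrow> 'a) \<Rightarrow> (int \<Rightarrow> 'a) \<Rightarrow> bool" where
  "fwd x q \<longleftrightarrow> (\<exists>K. \<forall>k\<ge>K. x k = q k)"

definition bwd :: "(int \<Rightarrow> 'a) \<Rightarrow> (int \<Rightarrow> 'a) \<Rightarrow> bool" where
  "bwd x q \<longleftrightarrow> (\<exists>K. \<forall>k\<le>K. x k = q k)"

lemma sh_mult: "sh n x = x \<Longrightarrow> sh (j * n) x = x"
proof (induction j rule: int_induct[of _ 0])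
  case (step1 i)
  then have "sh n (sh (i * n) x) = x" by simp
  moreover have "sh n (sh (i * n) x) = sh ((i + 1) * n) x" by (simp add: algebra_simps)
  ultimately show ?case by simp
next
  case (step2 i)
  have "sh (-n) x = x" using arg_cong[OF step2.prems, of "sh (-n)"] by simp
  then have "sh (-n) (sh (i * n) x) = x" using step2 by simp
  moreover have "sh (-n) (sh (i * n) x) = sh ((i - 1) * n) x" by (simp add: algebra_simps)
  ultimately show ?case by simp
qed simp

lemma sh_add_eq: "sh n x = x \<Longrightarrow> sh (k + n) x = sh k x"
  by (metis sh_sh)

lemma per_sh: "periodic x \<Longrightarrow> periodic (sh k x)"
  unfolding periodic_def by (metis add.commute sh_sh)

lemma per_sh_iff [simp]: "periodic (sh k x) \<longleftrightarrow> periodic x"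
  using per_sh[of x k] per_sh[of "sh k x" "-k"] by auto

lemma minimal_period:
  assumes "periodic x"
  obtains n where "n > 0" "\<forall>k. sh k x = x \<longleftrightarrow> n dvd k"
proof -
  define n where "n = (LEAST n::nat. n > 0 \<and> sh (int n) x = x)"
  obtain m :: int where m: "m > 0" "sh m x = x" using assms unfolding periodic_def by blast
  then have "nat m > 0 \<and> sh (int (nat m)) x = x" by simp
  then have n: "n > 0" "sh (int n) x = x"
    unfolding n_def by (metis (mono_tags, lifting) LeastI)+
  have "int n dvd k" if k: "sh k x = x" for k
  proof -
    have "sh (k mod int n) x = x"
    proof -
      have "sh (k mod int n + (k div int n) * int n) x = sh (k mod int n) x"
        by (rule sh_add_eq) (rule sh_mult[OF n(2)])
      then show ?thesis using k by simp
    qed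
    moreover have "k mod int n < int n" "k mod int n \<ge> 0" using n(1) by auto
    ultimately have "\<not> 0 < nat (k mod int n)"
      using not_less_Least[of "nat (k mod int n)" "\<lambda>n. n > 0 \<and> sh (int n) x = x"] unfolding n_def by auto
    then show ?thesis using \<open>k mod int n \<ge> 0\<close> by (simp add: dvd_eq_mod_eq_0)
  qed
  moreover have "sh k x = x" if "int n dvd k" for k
    using that sh_mult[OF n(2)] by (metis dvd_def mult.commute)
  ultimately show thesis using n(1) that[of "int n"] by auto
qed

lemma per_finite_orb: "periodic x \<longleftrightarrow> finite (orb x)"
proof
  assume "periodic x"
  then obtain n where n: "n > 0" "sh n x = x" unfolding periodic_def by blast
  have "sh k x = sh (k mod n) x" for k
    using sh_add_eq[OF sh_mult[OF n(2), of "k div n"], of "k mod n"] by simp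
  moreover have "k mod n \<in> {0..<n}" for k using n(1) by simp
  ultimately have "orb x \<subseteq> (\<lambda>k. sh k x) ` {0..<n}" unfolding orb_eq by blast
  then show "finite (orb x)" by (rule finite_subset) simp
next
  assume "finite (orb x)"
  then have "\<not> inj (\<lambda>k. sh k x)" unfolding orb_eq using finite_imageD infinite_UNIV_int by blast
  then obtain k m where km: "k \<noteq> m" "sh k x = sh m x" unfolding inj_def by blast
  then have "sh (k - m) x = x" "sh (m - k) x = x" using sh_eq_iff[of k x m x] sh_eq_iff[of m x k x] by auto
  then show "periodic x" unfolding periodic_def using km(1) by (metis diff_gt_0_iff_gt linorder_neqE)
qed

lemma fwd_refl [simp]: "fwd x x" by (simp add: fwd_def)
lemma bwd_refl [simp]: "bwd x x" by (simp add: bwd_def)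

lemma fwd_sh: "fwd x q \<Longrightarrow> fwd (sh k x) (sh k q)"
  unfolding fwd_def
proof (elim exE)
  fix K assume "\<forall>k\<ge>K. x k = q k"
  then show "\<exists>K. \<forall>i\<ge>K. sh k x i = sh k q i" by (intro exI[of _ "K - k"]) (simp add: sh_apply)
qed

lemma bwd_sh: "bwd x q \<Longrightarrow> bwd (sh k x) (sh k q)"
  unfolding bwd_def
proof (elim exE)
  fix K assume "\<forall>k\<le>K. x k = q k"
  then show "\<exists>K. \<forall>i\<le>K. sh k x i = sh k q i" by (intro exI[of _ "K - k"]) (simp add: sh_apply)
qed

lemma fwd_eucl: "fwd x p \<Longrightarrow> fwd x q \<Longrightarrow> fwd p q"
  unfolding fwd_def
proof (elim exE)
  fix K L assume "\<forall>k\<ge>K. x k = p k" "\<forall>k\<ge>L. x k = q k"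
  then show "\<exists>K. \<forall>k\<ge>K. p k = q k" by (intro exI[of _ "max K L"]) auto
qed

lemma bwd_eucl: "bwd x p \<Longrightarrow> bwd x q \<Longrightarrow> bwd p q"
  unfolding bwd_def
proof (elim exE)
  fix K L assume "\<forall>k\<le>K. x k = p k" "\<forall>k\<le>L. x k = q k"
  then show "\<exists>K. \<forall>k\<le>K. p k = q k" by (intro exI[of _ "min K L"]) auto
qed

lemma common_period:
  assumes "periodic x" "periodic y"
  obtains n where "n > 0" "\<forall>t. sh (t * n) x = x" "\<forall>t. sh (t * n) y = y"
proof -
  obtain a b where a: "a > 0" "sh a x = x" and b: "b > 0" "sh b y = y" using assms unfolding periodic_def by blast
  have "sh (t * (a * b)) x = x" for t using sh_mult[OF a(2), of "t * b"] by (simp add: algebra_simps)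
  moreover have "sh (t * (a * b)) y = y" for t using sh_mult[OF b(2), of "t * a"] by (simp add: algebra_simps)
  moreover have "a * b > 0" using a(1) b(1) by simp
  ultimately show thesis using that[of "a * b"] by blast
qed

text \<open>A common period carries the agreement on a half-line to all places.\<close>

lemma fwd_per_eq:
  assumes "periodic x" "periodic q" "fwd x q" shows "x = q"
proof
  fix k
  obtain K where K: "\<forall>k\<ge>K. x k = q k" using assms(3) unfolding fwd_def by blast
  obtain n where n: "n > 0" "\<forall>t. sh (t * n) x = x" "\<forall>t. sh (t * n) q = q"
    using common_period[OF assms(1,2)] by blast
  define t where "t = \<bar>K\<bar> + \<bar>k\<bar>"
  have "t * 1 \<le> t * n" using n(1) by (intro mult_left_mono) (auto simp: t_def)
  then have "K \<le> k + t * n" using t_def by linarith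
  then have "x (k + t * n) = q (k + t * n)" using K by blast
  moreover have "x (k + t * n) = x k" using n(2) by (metis sh_apply)
  moreover have "q (k + t * n) = q k" using n(3) by (metis sh_apply)
  ultimately show "x k = q k" by simp
qed

lemma bwd_per_eq:
  assumes "periodic x" "periodic q" "bwd x q" shows "x = q"
proof
  fix k
  obtain K where K: "\<forall>k\<le>K. x k = q k" using assms(3) unfolding bwd_def by blast
  obtain n where n: "n > 0" "\<forall>t. sh (t * n) x = x" "\<forall>t. sh (t * n) q = q"
    using common_period[OF assms(1,2)] by blast
  define t where "t = - (\<bar>K\<bar> + \<bar>k\<bar>)"
  have "t * n \<le> t * 1" using n(1) by (intro mult_left_mono_neg) (auto simp: t_def)
  then have "k + t * n \<le> K" using t_def by linarith
  then have "x (k + t * n) = q (k + t * n)" using K by blast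
  moreover have "x (k + t * n) = x k" using n(2) by (metis sh_apply)
  moreover have "q (k + t * n) = q k" using n(3) by (metis sh_apply)
  ultimately show "x k = q k" by simp
qed

lemma fwd_unique: "fwd x p \<Longrightarrow> fwd x q \<Longrightarrow> periodic p \<Longrightarrow> periodic q \<Longrightarrow> p = q"
  using fwd_per_eq fwd_eucl by blast

lemma bwd_unique: "bwd x p \<Longrightarrow> bwd x q \<Longrightarrow> periodic p \<Longrightarrow> periodic q \<Longrightarrow> p = q"
  using bwd_per_eq bwd_eucl by blast

lemma fwd_agree:
  assumes "fwd x q" shows "\<exists>K. \<forall>k\<ge>K. agree N (sh k x) (sh k q)"
proof -
  obtain K where K: "\<forall>k\<ge>K. x k = q k" using assms unfolding fwd_def by blast
  show ?thesis
  proof (intro exI[of _ "K + \<bar>N\<bar>"] allI impI)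
    fix k assume "k \<ge> K + \<bar>N\<bar>"
    then show "agree N (sh k x) (sh k q)" using K unfolding agree_def sh_apply by auto
  qed
qed

lemma bwd_agree:
  assumes "bwd x q" shows "\<exists>K. \<forall>k\<le>K. agree N (sh k x) (sh k q)"
proof -
  obtain K where K: "\<forall>k\<le>K. x k = q k" using assms unfolding bwd_def by blast
  show ?thesis
  proof (intro exI[of _ "K - \<bar>N\<bar>"] allI impI)
    fix k assume "k \<le> K - \<bar>N\<bar>"
    then show "agree N (sh k x) (sh k q)" using K unfolding agree_def sh_apply by auto
  qed
qed

lemma per_finite_range: "periodic x \<Longrightarrow> finite (range x)"
proof -
  assume "periodic x"
  then have "finite ((\<lambda>z. z 0) ` orb x)" using per_finite_orb by blast
  moreover have "range x = (\<lambda>z. z 0) ` orb x" unfolding orb_eq by (auto simp: sh_apply image_image)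
  ultimately show ?thesis by simp
qed

lemma asymptotic_finite_range:
  assumes "fwd x q" "bwd x r" "periodic q" "periodic r" shows "finite (range x)"
proof -
  obtain K L where KL: "\<forall>k\<ge>K. x k = q k" "\<forall>k\<le>L. x k = r k" using assms(1,2) unfolding fwd_def bwd_def by blast
  have "x k \<in> range q \<union> range r \<union> x ` {L..K}" for k
    using KL by (cases "k \<ge> K"; cases "k \<le> L") auto
  then have "range x \<subseteq> range q \<union> range r \<union> x ` {L..K}" by blast
  then show ?thesis using per_finite_range[OF assms(3)] per_finite_range[OF assms(4)]
    by (elim finite_subset) simp
qed

text \<open>All but finitely many points of the piece are close to \<open>Q\<close>, so a limit of the piece
  belongs to it or is a limit of points of \<open>Q\<close>.\<close>

lemma wclosed_orbit_piece:
  assumes Q: "wclosed Q" and S: "S \<subseteq> orb e"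
    and far: "\<And>N. \<exists>K. \<forall>k. K \<le> \<bar>k\<bar> \<and> sh k e \<in> S \<longrightarrow> (\<exists>q\<in>Q. agree N (sh k e) q)"
  shows "wclosed (S \<union> Q)"
  unfolding wclosed_def
proof (intro allI impI, rule ccontr)
  fix y assume a: "\<forall>N. \<exists>z\<in>S \<union> Q. agree N z y" and "y \<notin> S \<union> Q"
  then have yQ: "y \<notin> Q" "y \<notin> S" by auto
  obtain N0 where N0: "\<forall>q\<in>Q. \<not> agree N0 q y" using Q yQ(1) unfolding wclosed_def by blast
  obtain K where K: "\<forall>k. K \<le> \<bar>k\<bar> \<and> sh k e \<in> S \<longrightarrow> (\<exists>q\<in>Q. agree N0 (sh k e) q)" using far by blast
  let ?F = "S \<inter> (\<lambda>k. sh k e) ` {-\<bar>K\<bar>..\<bar>K\<bar>}"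
  have "wclosed ?F" by (rule wclosed_finite) simp
  moreover have "\<exists>z\<in>?F. agree N z y" for N
  proof -
    obtain z where z: "z \<in> S \<union> Q" "agree (max N N0) z y" using a by blast
    have z0: "agree N0 z y" "agree N z y" using agree_mono[OF z(2)] by auto
    then have zS: "z \<in> S" using N0 z(1) by blast
    then obtain k where k: "z = sh k e" using S unfolding orb_eq by blast
    have "\<not> K \<le> \<bar>k\<bar>"
    proof
      assume "K \<le> \<bar>k\<bar>"
      then obtain q where "q \<in> Q" "agree N0 z q" using K zS k by blast
      then show False using N0 z0(1) agree_sym agree_trans by blast
    qed
    then have "k \<in> {-\<bar>K\<bar>..\<bar>K\<bar>}" by auto
    then show ?thesis using z0(2) zS k by blast
  qed
  ultimately have "y \<in> ?F" by (rule wclosedD)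
  then show False using yQ(2) by blast
qed

text \<open>The set \<open>E\<close> lists representatives of the orbits. By \<open>hetsys_lim_pts2\<close>
  and \<open>rank_two_hetsys\<close> these systems are exactly the subshifts whose second derivative
  is empty.\<close>

definition hetsys :: "(int \<Rightarrow> 'a) set \<Rightarrow> (int \<Rightarrow> 'a) set \<Rightarrow> bool" where
  "hetsys E X \<longleftrightarrow> finite E \<and> X = (\<Union>e\<in>E. orb e) \<and>
     (\<forall>e\<in>E. (\<exists>q\<in>X. periodic q \<and> fwd e q) \<and> (\<exists>r\<in>X. periodic r \<and> bwd e r))"

lemma hetsys_sh: "hetsys E X \<Longrightarrow> x \<in> X \<Longrightarrow> sh k x \<in> X"
  unfolding hetsys_def using sh_orb by blast

lemma hetsys_finite_per:
  assumes "hetsys E X" shows "finite {x\<in>X. periodic x}"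
proof -
  have "{x\<in>X. periodic x} \<subseteq> (\<Union>e\<in>{e\<in>E. periodic e}. orb e)"
  proof
    fix x assume x: "x \<in> {x\<in>X. periodic x}"
    then obtain e k where e: "e \<in> E" "x = sh k e" using assms unfolding hetsys_def orb_eq by blast
    then have "periodic e" using x by simp
    then show "x \<in> (\<Union>e\<in>{e\<in>E. periodic e}. orb e)" using e by auto
  qed
  then show ?thesis using assms per_finite_orb unfolding hetsys_def by (elim finite_subset) auto
qed

text \<open>Away from finitely many times an orbit follows its two periodic ends; so it is enough that
  membership in \<open>S\<close> is inherited by the ends.\<close>

lemma hetsys_wclosed:
  assumes X: "hetsys E X" and S: "S \<subseteq> X"
    and f: "\<And>e q. e \<in> E \<Longrightarrow> q \<in> X \<Longrightarrow> periodic q \<Longrightarrow> fwd e q \<Longrightarrow> \<exists>K. \<forall>k\<ge>K. sh k e \<in> S \<longrightarrow> sh k q \<in> S"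
    and b: "\<And>e q. e \<in> E \<Longrightarrow> q \<in> X \<Longrightarrow> periodic q \<Longrightarrow> bwd e q \<Longrightarrow> \<exists>K. \<forall>k\<le>K. sh k e \<in> S \<longrightarrow> sh k q \<in> S"
  shows "wclosed S"
proof -
  let ?Q = "{x\<in>S. periodic x}"
  have "finite ?Q" using hetsys_finite_per[OF X] by (rule rev_finite_subset) (use S in auto)
  then have Q: "wclosed ?Q" by (rule wclosed_finite)
  have "wclosed ((S \<inter> orb e) \<union> ?Q)" if e: "e \<in> E" for e
  proof (rule wclosed_orbit_piece[OF Q])
    obtain q r where q: "q \<in> X" "periodic q" "fwd e q" and r: "r \<in> X" "periodic r" "bwd e r"
      using X e unfolding hetsys_def by blast
    obtain K1 where K1: "\<forall>k\<ge>K1. sh k e \<in> S \<longrightarrow> sh k q \<in> S" using f[OF e q] ..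
    obtain K2 where K2: "\<forall>k\<le>K2. sh k e \<in> S \<longrightarrow> sh k r \<in> S" using b[OF e r] ..
    fix N
    obtain K3 where K3: "\<forall>k\<ge>K3. agree N (sh k e) (sh k q)" using fwd_agree[OF q(3)] ..
    obtain K4 where K4: "\<forall>k\<le>K4. agree N (sh k e) (sh k r)" using bwd_agree[OF r(3)] ..
    show "\<exists>K. \<forall>k. K \<le> \<bar>k\<bar> \<and> sh k e \<in> S \<inter> orb e \<longrightarrow> (\<exists>q\<in>?Q. agree N (sh k e) q)"
    proof (intro exI[of _ "\<bar>K1\<bar> + \<bar>K2\<bar> + \<bar>K3\<bar> + \<bar>K4\<bar>"] allI impI)
      fix k assume k: "\<bar>K1\<bar> + \<bar>K2\<bar> + \<bar>K3\<bar> + \<bar>K4\<bar> \<le> \<bar>k\<bar> \<and> sh k e \<in> S \<inter> orb e"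
      show "\<exists>q\<in>?Q. agree N (sh k e) q"
      proof (cases "k \<ge> 0")
        case True
        then have "k \<ge> K1" "k \<ge> K3" using k by linarith+
        then have "sh k q \<in> ?Q" "agree N (sh k e) (sh k q)" using K1 K3 k q(2) by auto
        then show ?thesis by blast
      next
        case False
        then have "k \<le> K2" "k \<le> K4" using k by linarith+
        then have "sh k r \<in> ?Q" "agree N (sh k e) (sh k r)" using K2 K4 k r(2) by auto
        then show ?thesis by blast
      qed
    qed
  qed auto
  then have "wclosed (\<Union>e\<in>E. (S \<inter> orb e) \<union> ?Q)" using X unfolding hetsys_def by (intro wclosed_UN) auto
  moreover have "(\<Union>e\<in>E. (S \<inter> orb e) \<union> ?Q) = S" using S X unfolding hetsys_def by auto
  ultimately show ?thesis by simp
qed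

lemma hetsys_subsh:
  assumes X: "hetsys E X" shows "subsh X"
  unfolding subsh_def
proof (intro conjI ballI allI)
  show "\<exists>A. finite A \<and> (\<forall>x\<in>X. \<forall>k. x k \<in> A)"
  proof (intro exI[of _ "\<Union>e\<in>E. range e"] conjI ballI allI)
    show "finite (\<Union>e\<in>E. range e)"
    proof (rule finite_UN_I)
      show "finite (range e)" if e: "e \<in> E" for e
      proof -
        obtain q r where q: "q \<in> X" "periodic q" "fwd e q" and r: "r \<in> X" "periodic r" "bwd e r"
          using X e unfolding hetsys_def by blast
        then show ?thesis using asymptotic_finite_range by blast
      qed
    qed (use X in \<open>simp add: hetsys_def\<close>)
    show "x k \<in> (\<Union>e\<in>E. range e)" if x: "x \<in> X" for x k
    proof -
      obtain e j where e: "e \<in> E" "x = sh j e" using X x unfolding hetsys_def orb_eq by blast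
      then have "x k \<in> range e" by (simp add: sh_apply)
      then show ?thesis using e(1) by blast
    qed
  qed
  show "wclosed X"
    by (rule hetsys_wclosed[OF X]) (use hetsys_sh[OF X] in auto)
  show "sh k x \<in> X" if "x \<in> X" for x k using hetsys_sh[OF X that] .
qed

lemma hetsys_countable: "hetsys E X \<Longrightarrow> countable X"
  unfolding hetsys_def by (auto intro: countable_finite countable_orb)

lemma wclosed_remove_lim: "wclosed (C - {x}) \<Longrightarrow> x \<notin> lim_pts C"
proof
  assume w: "wclosed (C - {x})" and "x \<in> lim_pts C"
  then have "\<exists>z\<in>C - {x}. agree N z x" for N unfolding lim_pts_def using agree_sym by blast
  then have "x \<in> C - {x}" using wclosedD[OF w] by blast
  then show False by simp
qed

lemma lim_pts_subset: "lim_pts C \<subseteq> C"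
  by (auto simp: lim_pts_def)

lemma lim_pts_mono: "C \<subseteq> D \<Longrightarrow> lim_pts C \<subseteq> lim_pts D"
  unfolding lim_pts_def by blast

lemma lim_pts_finite: "finite C \<Longrightarrow> lim_pts C = {}"
  using wclosed_remove_lim[of C] wclosed_finite[of "C - {_}"] lim_pts_subset[of C] by blast

lemma hetsys_lim_pts:
  assumes X: "hetsys E X" shows "lim_pts X \<subseteq> {x\<in>X. periodic x}"
proof
  fix z assume z: "z \<in> lim_pts X"
  have "periodic z"
  proof (rule ccontr)
    assume np: "\<not> periodic z"
    have ne: "sh k q \<noteq> z" if "periodic q" for q k using np that by auto
    have "wclosed (X - {z})"
      by (rule hetsys_wclosed[OF X]) (use ne hetsys_sh[OF X] in auto)
    then show False using wclosed_remove_lim z by blast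
  qed
  then show "z \<in> {x\<in>X. periodic x}" using z lim_pts_subset by blast
qed

lemma hetsys_lim_pts2: "hetsys E X \<Longrightarrow> lim_pts (lim_pts X) = {}"
  using hetsys_lim_pts hetsys_finite_per lim_pts_finite finite_subset by metis

text \<open>Two such systems with the same periods and the same ends are isomorphic: matching the orbits is
  continuous, because near a periodic point only tails of orbits have to be compared.\<close>

lemma het_iso:
  fixes x :: "'i \<Rightarrow> int \<Rightarrow> 'a" and y :: "'i \<Rightarrow> int \<Rightarrow> 'b"
  assumes I: "finite I"
    and pr: "\<And>i k. i \<in> I \<Longrightarrow> sh k (x i) = x i \<longleftrightarrow> sh k (y i) = y i"
    and dx: "\<And>i j k. i \<in> I \<Longrightarrow> j \<in> I \<Longrightarrow> sh k (x i) = x j \<Longrightarrow> i = j"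
    and dy: "\<And>i j k. i \<in> I \<Longrightarrow> j \<in> I \<Longrightarrow> sh k (y i) = y j \<Longrightarrow> i = j"
    and f: "\<And>i. i \<in> I \<Longrightarrow> \<exists>j\<in>I. \<exists>s. periodic (x j) \<and> fwd (x i) (sh s (x j)) \<and> fwd (y i) (sh s (y j))"
    and b: "\<And>i. i \<in> I \<Longrightarrow> \<exists>j\<in>I. \<exists>s. periodic (x j) \<and> bwd (x i) (sh s (x j)) \<and> bwd (y i) (sh s (y j))"
    and Y: "\<And>i k. i \<in> I \<Longrightarrow> sh k (y i) \<in> Y"
  shows "hetsys (x ` I) (\<Union>i\<in>I. orb (x i))" and "embeds (\<Union>i\<in>I. orb (x i)) Y"
proof -
  define X where "X = (\<Union>i\<in>I. orb (x i))"
  have xX: "sh k (x i) \<in> X" if "i \<in> I" for i k using that sh_in_orb[of k "x i"] unfolding X_def by blast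
  show "hetsys (x ` I) (\<Union>i\<in>I. orb (x i))"
    unfolding hetsys_def X_def[symmetric]
  proof (intro conjI ballI)
    show "X = (\<Union>e\<in>x ` I. orb e)" by (simp add: X_def)
    fix e assume "e \<in> x ` I"
    then obtain i where i: "i \<in> I" "e = x i" by blast
    show "\<exists>q\<in>X. periodic q \<and> fwd e q"
    proof -
      obtain j s where "j \<in> I" "periodic (x j)" "fwd (x i) (sh s (x j))" using f[OF i(1)] by blast
      then show ?thesis using xX i(2) by (intro bexI[of _ "sh s (x j)"]) auto
    qed
    show "\<exists>q\<in>X. periodic q \<and> bwd e q"
    proof -
      obtain j s where "j \<in> I" "periodic (x j)" "bwd (x i) (sh s (x j))" using b[OF i(1)] by blast
      then show ?thesis using xX i(2) by (intro bexI[of _ "sh s (x j)"]) auto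
    qed
  qed (use I in simp)
  then have het: "hetsys (x ` I) X" by (simp add: X_def)
  have XE: "\<exists>i\<in>I. \<exists>k. z = sh k (x i)" if "z \<in> X" for z using that unfolding X_def orb_eq by blast
  define idx where "idx z = (SOME p. fst p \<in> I \<and> z = sh (snd p) (x (fst p)))" for z
  define h where "h z = sh (snd (idx z)) (y (fst (idx z)))" for z
  have hx: "h (sh k (x i)) = sh k (y i)" if i: "i \<in> I" for i k
  proof -
    obtain j m where jm1: "idx (sh k (x i)) = (j, m)" by (cases "idx (sh k (x i))")
    have "fst (i, k) \<in> I \<and> sh k (x i) = sh (snd (i, k)) (x (fst (i, k)))" using i by simp
    from someI[of "\<lambda>p. fst p \<in> I \<and> sh k (x i) = sh (snd p) (x (fst p))", OF this]
    have jm: "idx (sh k (x i)) = (j, m)" "j \<in> I" "sh k (x i) = sh m (x j)"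
      using jm1 unfolding idx_def[symmetric] by simp_all
    then have e: "sh (k - m) (x i) = x j" by (simp add: sh_eq_iff)
    then have "i = j" using dx[OF i jm(2)] by blast
    then have "sh (k - m) (y i) = y i" using e pr[OF i] by simp
    then have "sh k (y i) = sh m (y i)" by (simp add: sh_eq_iff)
    then show ?thesis using jm(1) \<open>i = j\<close> unfolding h_def by simp
  qed
  have eq: "h (sh m z) = sh m (h z)" if "z \<in> X" for z m
  proof -
    obtain i k where i: "i \<in> I" "z = sh k (x i)" using XE[OF \<open>z \<in> X\<close>] by blast
    then have "h (sh m z) = sh (m + k) (y i)" using hx[OF i(1)] by simp
    then show ?thesis using hx[OF i(1)] i(2) by simp
  qed
  have "inj_on h X"
  proof (rule inj_onI)
    fix z w assume zw: "z \<in> X" "w \<in> X" "h z = h w"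
    obtain i k where i: "i \<in> I" "z = sh k (x i)" using XE[OF zw(1)] by blast
    obtain j m where j: "j \<in> I" "w = sh m (x j)" using XE[OF zw(2)] by blast
    have "sh k (y i) = sh m (y j)" using zw(3) i j hx by simp
    then have e: "sh (k - m) (y i) = y j" by (simp add: sh_eq_iff)
    then have "i = j" using dy[OF i(1) j(1)] by blast
    then have "sh (k - m) (x i) = x i" using e pr[OF i(1)] by simp
    then show "z = w" using i j \<open>i = j\<close> by (simp add: sh_eq_iff)
  qed
  have closed: "wclosed {z\<in>X. h z 0 \<noteq> v}" for v
  proof (rule hetsys_wclosed[OF het])
    fix e q assume e: "e \<in> x ` I" and q: "q \<in> X" "periodic q" "fwd e q"
    obtain i where i: "i \<in> I" "e = x i" using e by blast
    obtain j s where j: "j \<in> I" "periodic (x j)" "fwd (x i) (sh s (x j))" "fwd (y i) (sh s (y j))"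
      using f[OF i(1)] by blast
    have qe: "q = sh s (x j)" using fwd_unique[of e q "sh s (x j)"] q j i by simp
    obtain K where K: "\<forall>k\<ge>K. y i k = sh s (y j) k" using j(4) unfolding fwd_def by blast
    show "\<exists>K. \<forall>k\<ge>K. sh k e \<in> {z\<in>X. h z 0 \<noteq> v} \<longrightarrow> sh k q \<in> {z\<in>X. h z 0 \<noteq> v}"
      using K hx[OF i(1)] hx[OF j(1)] xX[OF j(1)] unfolding qe i(2)
      by (intro exI[of _ K]) (auto simp: sh_apply)
  next
    fix e q assume e: "e \<in> x ` I" and q: "q \<in> X" "periodic q" "bwd e q"
    obtain i where i: "i \<in> I" "e = x i" using e by blast
    obtain j s where j: "j \<in> I" "periodic (x j)" "bwd (x i) (sh s (x j))" "bwd (y i) (sh s (y j))"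
      using b[OF i(1)] by blast
    have qe: "q = sh s (x j)" using bwd_unique[of e q "sh s (x j)"] q j i by simp
    obtain K where K: "\<forall>k\<le>K. y i k = sh s (y j) k" using j(4) unfolding bwd_def by blast
    show "\<exists>K. \<forall>k\<le>K. sh k e \<in> {z\<in>X. h z 0 \<noteq> v} \<longrightarrow> sh k q \<in> {z\<in>X. h z 0 \<noteq> v}"
      using K hx[OF i(1)] hx[OF j(1)] xX[OF j(1)] unfolding qe i(2)
      by (intro exI[of _ K]) (auto simp: sh_apply)
  qed auto
  have "\<exists>M. \<forall>w\<in>X. agree M z w \<longrightarrow> h z 0 = h w 0" if z: "z \<in> X" for z
  proof (rule ccontr)
    assume a: "\<not> ?thesis"
    have "\<exists>w\<in>{w\<in>X. h w 0 \<noteq> h z 0}. agree N w z" for N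
    proof -
      obtain w where "w \<in> X" "agree N z w" "h z 0 \<noteq> h w 0" using a by blast
      then show ?thesis using agree_sym[of N z w] by auto
    qed
    then have "z \<in> {w\<in>X. h w 0 \<noteq> h z 0}" by (rule wclosedD[OF closed])
    then show False by simp
  qed
  then obtain M where M: "\<forall>z\<in>X. \<forall>w\<in>X. agree M z w \<longrightarrow> h z 0 = h w 0"
    using subsh_uniform[OF hetsys_subsh[OF het], of "\<lambda>z. h z 0"] by blast
  have "\<exists>L. \<forall>z\<in>X. \<forall>w\<in>X. agree L z w \<longrightarrow> agree N (h z) (h w)" for N
  proof (intro exI[of _ "M + \<bar>N\<bar>"] ballI impI)
    fix z w assume zw: "z \<in> X" "w \<in> X" "agree (M + \<bar>N\<bar>) z w"
    show "agree N (h z) (h w)"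
      unfolding agree_def
    proof (intro allI impI)
      fix k assume k: "\<bar>k\<bar> \<le> N"
      have "agree M (sh k z) (sh k w)" by (rule agree_sh[OF zw(3)]) (use k in linarith)
      then have "h (sh k z) 0 = h (sh k w) 0" using M hetsys_sh[OF het] zw(1,2) by blast
      then show "h z k = h w k" using eq zw(1,2) by (simp add: sh_apply)
    qed
  qed
  moreover have "h ` X \<subseteq> Y"
  proof
    fix u assume "u \<in> h ` X"
    then obtain z where z: "z \<in> X" "u = h z" by blast
    then obtain i k where "i \<in> I" "z = sh k (x i)" using XE by blast
    then show "u \<in> Y" using Y hx z(2) by simp
  qed
  ultimately have "emb h X Y" unfolding emb_def using \<open>inj_on h X\<close> eq by blast
  then show "embeds (\<Union>i\<in>I. orb (x i)) Y" unfolding embeds_def X_def by blast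
qed

section \<open>Eventually periodic points given by words\<close>

text \<open>The integer remainder avoids the case distinction at position zero that glued one-sided words
  need.\<close>

definition pw :: "'a list \<Rightarrow> int \<Rightarrow> 'a" where
  "pw w k = w ! nat (k mod int (length w))"

text \<open>The point \<open>\<cdots> u u v w w \<cdots>\<close> in which \<open>v\<close> begins at position
  zero.\<close>

definition brk :: "'a list \<Rightarrow> 'a list \<Rightarrow> 'a list \<Rightarrow> int \<Rightarrow> 'a" where
  "brk u v w k = (if k < 0 then pw u k else if k < int (length v) then v ! nat k else pw w (k - int (length v)))"

lemma left_power_pw:
  assumes "w \<noteq> []" "k < 0" shows "left_power w (nat (- k - 1)) = pw w k"
proof -
  define n where "n = length w"
  define j where "j = nat (- k - 1)"
  have n: "n > 0" using assms(1) by (simp add: n_def)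
  have jk: "k = - int j - 1" using assms(2) by (simp add: j_def)
  have lt: "j mod n < n" using n by simp
  have dm: "j = n * (j div n) + j mod n" by simp
  have "k = int n * (- int (j div n) - 1) + int (n - 1 - j mod n)"
  proof -
    have "int j = int (n * (j div n) + j mod n)" using dm by simp
    then have "int j = int n * int (j div n) + int (j mod n)" by (simp only: of_nat_add of_nat_mult)
    moreover have "int (n - 1 - j mod n) = int n - 1 - int (j mod n)" using lt by simp
    ultimately show ?thesis using jk by (simp add: algebra_simps)
  qed
  then have "k mod int n = int (n - 1 - j mod n)"
    using lt by (intro int_mod_pos_eq) auto
  then have "pw w k = w ! (n - 1 - j mod n)" unfolding pw_def n_def by simp
  moreover have "rev w ! (j mod n) = w ! (n - 1 - j mod n)" using lt by (simp add: rev_nth n_def)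
  ultimately show ?thesis unfolding left_power_def j_def n_def by simp
qed

lemma right_power_pw: "0 \<le> k \<Longrightarrow> right_power w (nat k) = pw w k"
  unfolding right_power_def pw_def by (simp add: nat_mod_distrib)

lemma biinf_power_eq: "w \<noteq> [] \<Longrightarrow> biinf_power w = pw w"
  unfolding biinf_power_def glue_def by (intro ext) (auto simp: left_power_pw right_power_pw)

lemma glue_prepend_eq:
  assumes "u \<noteq> []" shows "glue (left_power u) (prepend v (right_power w)) = brk u v w"
proof
  fix k
  have "right_power w (nat k - length v) = pw w (k - int (length v))" if "k \<ge> int (length v)"
  proof -
    have "nat k - length v = nat (k - int (length v))" using that by simp
    then show ?thesis using that by (simp add: right_power_pw)
  qed
  then show "glue (left_power u) (prepend v (right_power w)) k = brk u v w k"
    unfolding glue_def prepend_def brk_def using left_power_pw[OF assms, of k] by (auto simp: not_less nat_less_iff)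
qed

lemma glue_eq:
  assumes "u \<noteq> []" shows "glue (left_power u) (right_power w) = brk u [] w"
  using glue_prepend_eq[OF assms, of "[]" w] by (simp add: prepend_def)

lemma pw_in: "w \<noteq> [] \<Longrightarrow> pw w k \<in> set w"
  unfolding pw_def by (intro nth_mem) (simp add: nat_less_iff)

lemma pw_nth: "i < length w \<Longrightarrow> pw w (int i) = w ! i"
  unfolding pw_def by simp

lemma range_pw: "w \<noteq> [] \<Longrightarrow> range (pw w) = set w"
  using pw_in[of w] pw_nth[of _ w] by (auto simp: in_set_conv_nth) (metis rangeI)

lemma sh_pw: "int (length w) dvd k \<Longrightarrow> sh k (pw w) = pw w"
  by (intro ext) (simp add: sh_apply pw_def mod_add_right_eq[symmetric])

lemma per_pw: "w \<noteq> [] \<Longrightarrow> periodic (pw w)"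
  unfolding periodic_def using sh_pw[of w "int (length w)"] by (intro exI[of _ "int (length w)"]) simp

lemma sh_pw_iff:
  assumes "distinct w" "w \<noteq> []"
  shows "sh k (pw w) = pw w \<longleftrightarrow> int (length w) dvd k"
proof
  assume "sh k (pw w) = pw w"
  then have "pw w k = pw w 0" using sh_apply[of k "pw w" 0] by simp
  then have "w ! nat (k mod int (length w)) = w ! 0" by (simp add: pw_def)
  moreover have "nat (k mod int (length w)) < length w" using assms(2) by (simp add: nat_less_iff)
  ultimately have "nat (k mod int (length w)) = 0" using assms nth_eq_iff_index_eq by fastforce
  moreover have "0 \<le> k mod int (length w)" using assms(2) by simp
  ultimately show "int (length w) dvd k" by (simp add: dvd_eq_mod_eq_0)
qed (rule sh_pw)

lemma bwd_brk: "bwd (brk u v w) (pw u)"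
  unfolding bwd_def brk_def by (intro exI[of _ "-1"]) auto

lemma fwd_brk: "fwd (brk u v w) (sh (- int (length v)) (pw w))"
  unfolding fwd_def brk_def by (intro exI[of _ "int (length v)"]) (auto simp: sh_apply)

lemma fwd_brk0: "fwd (brk u [] w) (pw w)"
  using fwd_brk[of u "[]" w] by simp

lemma range_brk:
  assumes "u \<noteq> []" "w \<noteq> []" shows "range (brk u v w) = set u \<union> set v \<union> set w"
proof
  show "range (brk u v w) \<subseteq> set u \<union> set v \<union> set w"
    using pw_in[OF assms(1)] pw_in[OF assms(2)] unfolding brk_def by (auto simp: nat_less_iff)
  have "x \<in> range (brk u v w)" if x: "x \<in> set u" for x
  proof -
    obtain i where i: "i < length u" "u ! i = x" using x by (auto simp: in_set_conv_nth)
    have "pw u (int i - int (length u)) = x" using i by (simp add: pw_def)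
    then have "brk u v w (int i - int (length u)) = x" using i(1) unfolding brk_def by simp
    then show ?thesis by blast
  qed
  moreover have "x \<in> range (brk u v w)" if x: "x \<in> set v" for x
  proof -
    obtain i where i: "i < length v" "v ! i = x" using x by (auto simp: in_set_conv_nth)
    then have "brk u v w (int i) = x" unfolding brk_def by simp
    then show ?thesis by blast
  qed
  moreover have "x \<in> range (brk u v w)" if x: "x \<in> set w" for x
  proof -
    obtain i where i: "i < length w" "w ! i = x" using x by (auto simp: in_set_conv_nth)
    have "pw w (int i) = x" using i pw_nth by blast
    then have "brk u v w (int i + int (length v)) = x" using i(1) unfolding brk_def by simp
    then show ?thesis by blast
  qed
  ultimately show "set u \<union> set v \<union> set w \<subseteq> range (brk u v w)" by blast
qed

lemma range_sh: "range (sh k x) = range x"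
proof
  show "range (sh k x) \<subseteq> range x" unfolding sh_def by blast
  show "range x \<subseteq> range (sh k x)"
  proof
    fix z assume "z \<in> range x"
    then obtain i where "z = x i" ..
    then have "z = sh k x (i - k)" unfolding sh_apply by simp
    then show "z \<in> range (sh k x)" by (rule range_eqI)
  qed
qed

lemma sh_eq_range: "sh k x = y \<Longrightarrow> range x = range y"
  using range_sh by metis

lemma nonper_sh: "\<not> periodic x \<Longrightarrow> sh k x = x \<longleftrightarrow> k = 0"
proof
  assume np: "\<not> periodic x" and "sh k x = x"
  then have "sh (-1 * k) x = x" "sh k x = x" using sh_mult by blast+
  then show "k = 0" using np unfolding periodic_def by (metis linorder_neqE minus_mult_commute mult_1 neg_0_less_iff_less)
qed simp

text \<open>If the point were periodic, its backward end would determine it, so only symbols of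
  \<open>u\<close> could occur.\<close>

lemma brk_nonper:
  assumes "u \<noteq> []" "w \<noteq> []" "x \<in> set v \<union> set w" "x \<notin> set u" shows "\<not> periodic (brk u v w)"
proof
  assume "periodic (brk u v w)"
  then have "brk u v w = pw u" using bwd_per_eq[OF _ per_pw bwd_brk] assms(1) by blast
  then have "range (brk u v w) = range (pw u)" by (rule arg_cong)
  then have "set u \<union> set v \<union> set w = set u" unfolding range_brk[OF assms(1,2)] range_pw[OF assms(1)] .
  then show False using assms(3,4) by auto
qed

section \<open>Obstructions to colourings\<close>

lemma color_alternates:
  assumes X: "subsh X" and c: "\<forall>x\<in>X. sh 1 x \<noteq> x \<longrightarrow> c (sh 1 x) \<noteq> (c x :: bool)"
    and x: "x \<in> X" "sh 1 x \<noteq> x"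
  shows "c (sh k x) = (c x = even k)"
proof -
  have ne: "sh (k + 1) x \<noteq> sh k x" for k using x(2) by (simp add: sh_eq_iff)
  have st: "c (sh (k + 1) x) \<noteq> c (sh k x)" for k
    using c[rule_format, OF subsh_sh[OF X x(1), of k]] ne[of k] by (simp add: add.commute)
  show ?thesis
  proof (induction k rule: int_induct[of _ 0])
    case (step1 i) then show ?case using st[of i] by auto
  next
    case (step2 i) then show ?case using st[of "i - 1"] by auto
  qed simp
qed

text \<open>After an even number of steps the points are so close that they have the same colour, and an even
  shift restores the original colours. The same holds in the past.\<close>

lemma color_fwd:
  assumes X: "subsh X" and c: "\<forall>x\<in>X. sh 1 x \<noteq> x \<longrightarrow> c (sh 1 x) \<noteq> (c x :: bool)"
    and M: "\<forall>x\<in>X. \<forall>y\<in>X. agree M x y \<longrightarrow> c x = c y"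
    and e: "e \<in> X" "sh 1 e \<noteq> e" and q: "q \<in> X" "sh 1 q \<noteq> q" "fwd e q"
  shows "c e = c q"
proof -
  obtain K where K: "\<forall>k\<ge>K. agree M (sh k e) (sh k q)" using fwd_agree[OF q(3)] by blast
  have "agree M (sh (2 * \<bar>K\<bar>) e) (sh (2 * \<bar>K\<bar>) q)" using K by simp
  then have "c (sh (2 * \<bar>K\<bar>) e) = c (sh (2 * \<bar>K\<bar>) q)"
    using M subsh_sh[OF X e(1)] subsh_sh[OF X q(1)] by meson
  then show ?thesis using color_alternates[OF X c e] color_alternates[OF X c q(1,2)] by simp
qed

lemma color_bwd:
  assumes X: "subsh X" and c: "\<forall>x\<in>X. sh 1 x \<noteq> x \<longrightarrow> c (sh 1 x) \<noteq> (c x :: bool)"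
    and M: "\<forall>x\<in>X. \<forall>y\<in>X. agree M x y \<longrightarrow> c x = c y"
    and e: "e \<in> X" "sh 1 e \<noteq> e" and q: "q \<in> X" "sh 1 q \<noteq> q" "bwd e q"
  shows "c e = c q"
proof -
  obtain K where K: "\<forall>k\<le>K. agree M (sh k e) (sh k q)" using bwd_agree[OF q(3)] by blast
  have "agree M (sh (- 2 * \<bar>K\<bar>) e) (sh (- 2 * \<bar>K\<bar>) q)" using K by simp
  then have "c (sh (- 2 * \<bar>K\<bar>) e) = c (sh (- 2 * \<bar>K\<bar>) q)"
    using M subsh_sh[OF X e(1)] subsh_sh[OF X q(1)] by meson
  then show ?thesis using color_alternates[OF X c e] color_alternates[OF X c q(1,2)] by simp
qed

text \<open>Far in the past two consecutive points of the orbit both have the colour of the fixed point.\<close>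

lemma noncolorable_fixed_limit:
  assumes X: "subsh X" and f: "f \<in> X" "sh 1 f = f" and e: "e \<in> X" "\<not> periodic e" "bwd e f"
  shows "\<not> colorable X"
proof
  assume "colorable X"
  then obtain c :: "_ \<Rightarrow> bool" and M where M: "\<forall>x\<in>X. \<forall>y\<in>X. agree M x y \<longrightarrow> c x = c y"
    and c: "\<forall>x\<in>X. sh 1 x \<noteq> x \<longrightarrow> c (sh 1 x) \<noteq> c x" by (rule colorableE)
  obtain K where K: "\<forall>k\<le>K. agree M (sh k e) (sh k f)" using bwd_agree[OF e(3)] by blast
  have cf: "c (sh k e) = c f" if "k \<le> K" for k
    using M K that subsh_sh[OF X e(1), of k] f(1) fixed_sh[OF f(2), of k] by metis
  have "sh 1 e \<noteq> e" using e(2) nonper_sh[of e 1] by simp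
  then have "sh 1 (sh (K - 1) e) \<noteq> sh (K - 1) e" by (simp add: sh_eq_iff)
  then have "c (sh 1 (sh (K - 1) e)) \<noteq> c (sh (K - 1) e)" using c subsh_sh[OF X e(1)] by meson
  then show False using cf[of K] cf[of "K - 1"] by simp
qed

lemma noncolorable_odd_cycle:
  assumes X: "subsh X" and x: "x \<in> X" "sh 1 x \<noteq> x" "sh n x = x" "odd n"
  shows "\<not> colorable X"
proof
  assume "colorable X"
  then obtain c :: "_ \<Rightarrow> bool" and M where "\<forall>x\<in>X. \<forall>y\<in>X. agree M x y \<longrightarrow> c x = c y"
    and c: "\<forall>x\<in>X. sh 1 x \<noteq> x \<longrightarrow> c (sh 1 x) \<noteq> c x" by (rule colorableE)
  show False using color_alternates[OF X c x(1,2), of n] x(3,4) by simp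
qed

lemma colorable_by_symbol:
  fixes \<kappa> :: "'a \<Rightarrow> bool"
  assumes "\<And>x. x \<in> X \<Longrightarrow> sh 1 x \<noteq> x \<Longrightarrow> \<kappa> (x 1) \<noteq> \<kappa> (x 0)"
  shows "colorable X"
  unfolding colorable_def
proof (intro exI[of _ "\<lambda>x. \<kappa> (x 0)"] exI[of _ 0] conjI ballI impI)
  fix x y :: "int \<Rightarrow> 'a" assume "agree 0 x y"
  then show "\<kappa> (x 0) = \<kappa> (y 0)" using agreeD[of 0 x y 0] by simp
next
  fix x assume "x \<in> X" "sh 1 x \<noteq> x"
  then show "\<kappa> (sh 1 x 0) \<noteq> \<kappa> (x 0)" using assms by (simp add: sh_apply)
qed

lemma subsh_fwd_end:
  assumes Y: "subsh Y" and e: "e \<in> Y" and q: "periodic q" "fwd e q" shows "q \<in> Y"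
proof (rule wclosedD[OF subsh_wclosed[OF Y]])
  fix N
  obtain n where n: "n > 0" "sh n q = q" using q(1) unfolding periodic_def by blast
  obtain K where K: "\<forall>k\<ge>K. agree N (sh k e) (sh k q)" using fwd_agree[OF q(2)] by blast
  have "\<bar>K\<bar> * 1 \<le> \<bar>K\<bar> * n" using n(1) by (intro mult_left_mono) auto
  then have "K \<le> \<bar>K\<bar> * n" by linarith
  then have "agree N (sh (\<bar>K\<bar> * n) e) q" using K sh_mult[OF n(2), of "\<bar>K\<bar>"] by metis
  then show "\<exists>z\<in>Y. agree N z q" using subsh_sh[OF Y e] by blast
qed

lemma subsh_bwd_end:
  assumes Y: "subsh Y" and e: "e \<in> Y" and q: "periodic q" "bwd e q" shows "q \<in> Y"
proof (rule wclosedD[OF subsh_wclosed[OF Y]])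
  fix N
  obtain n where n: "n > 0" "sh n q = q" using q(1) unfolding periodic_def by blast
  obtain K where K: "\<forall>k\<le>K. agree N (sh k e) (sh k q)" using bwd_agree[OF q(2)] by blast
  have "\<bar>K\<bar> * 1 \<le> \<bar>K\<bar> * n" using n(1) by (intro mult_left_mono) auto
  then have "(- \<bar>K\<bar>) * n \<le> K" by (simp add: algebra_simps)
  then have "agree N (sh ((- \<bar>K\<bar>) * n) e) q" using K sh_mult[OF n(2), of "- \<bar>K\<bar>"] by metis
  then show "\<exists>z\<in>Y. agree N z q" using subsh_sh[OF Y e] by blast
qed

section \<open>The subshifts of the basis\<close>

locale symbols =
  fixes d :: "nat \<Rightarrow> 'a" and a :: "nat \<Rightarrow> nat \<Rightarrow> 'a" and b :: "nat \<Rightarrow> 'a"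
  assumes inj_d: "inj d" and inj_a: "inj (\<lambda>(i, j). a i j)" and inj_b: "inj b"
    and disj_ab: "range (\<lambda>(i, j). a i j) \<inter> range b = {}"
begin

lemma d_eq [simp]: "d i = d j \<longleftrightarrow> i = j"
  using inj_d by (auto simp: inj_def)

lemma b_eq [simp]: "b i = b j \<longleftrightarrow> i = j"
  using inj_b by (auto simp: inj_def)

lemma a_eq [simp]: "a i j = a i' j' \<longleftrightarrow> i = i' \<and> j = j'"
  using inj_a by (auto simp: inj_def)

lemma ab_ne [simp]: "a i j \<noteq> b k" "b k \<noteq> a i j"
proof -
  have "a i j \<in> range (\<lambda>(i, j). a i j)" by (rule range_eqI[of _ _ "(i, j)"]) simp
  moreover have "b k \<in> range b" by simp
  ultimately show "a i j \<noteq> b k" "b k \<noteq> a i j" using disj_ab by (metis disjoint_iff)+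
qed

subsection \<open>One orbit asymptotic to a fixed point\<close>

definition right_word :: "nat \<Rightarrow> 'a list" where
  "right_word n = (if n = 0 then [d 0] else map d [1..<n + 1])"

definition gap_word :: "nat \<Rightarrow> 'a list" where
  "gap_word n = (if n = 0 then [d 1] else [])"

text \<open>The aperiodic orbit of \<open>nSigma d n\<close> in the cases with a fixed point. For \<open>n =
  0\<close> both ends are that fixed point, and the word \<open>gap_word n\<close> separates them.\<close>

definition en :: "nat \<Rightarrow> int \<Rightarrow> 'a" where
  "en n = brk [d 0] (gap_word n) (right_word n)"

lemma wn_ne [simp]: "right_word n \<noteq> []" "length (right_word n) = max 1 n" "distinct (right_word n)"
  by (auto simp: right_word_def distinct_map inj_on_def)

lemma d0_wn: "n > 0 \<Longrightarrow> d 0 \<notin> set (right_word n)"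
  by (auto simp: right_word_def)

lemma nSigma_even:
  assumes "even n \<or> n = 1"
  shows "nSigma d n = orb (pw [d 0]) \<union> orb (pw (right_word n)) \<union> orb (en n)"
  using assms unfolding nSigma_def en_def
  by (auto simp: glue_prepend_eq glue_eq biinf_power_eq right_word_def gap_word_def)

lemma nSigma_odd:
  assumes "odd n" "n \<noteq> 1" shows "nSigma d n = orb (pw (map d [0..<n]))"
  using assms unfolding nSigma_def by (auto simp: biinf_power_eq odd_pos)

lemma en_nonper: "\<not> periodic (en n)"
  unfolding en_def
proof (rule brk_nonper)
  show "d 1 \<in> set (gap_word n) \<union> set (right_word n)" by (auto simp: gap_word_def right_word_def)
qed auto

lemma en_bwd: "bwd (en n) (pw [d 0])"
  unfolding en_def by (rule bwd_brk)

lemma sh_pw_single: "sh k (pw [z]) = pw [z]"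
  by (rule sh_pw) simp

lemma en_fwd: "fwd (en n) (pw (right_word n))"
proof (cases "n = 0")
  case True
  have "fwd (en n) (sh (- int (length (gap_word n))) (pw [d 0]))"
    using fwd_brk[of "[d 0]" "gap_word n" "right_word n"] True unfolding en_def by (simp add: right_word_def)
  then show ?thesis unfolding sh_pw_single using True by (simp add: right_word_def)
next
  case False
  then show ?thesis unfolding en_def gap_word_def using fwd_brk0 by simp
qed

lemma range_en: "range (en n) = insert (d 0) (set (gap_word n) \<union> set (right_word n))"
  unfolding en_def by (subst range_brk) auto

definition ptn :: "nat \<Rightarrow> nat \<Rightarrow> int \<Rightarrow> 'a" where
  "ptn n i = (if i = 0 then pw [d 0] else if i = 1 then en n else pw (right_word n))"

text \<open>Indices of the points \<open>ptn n i\<close>, one for each orbit; for \<open>n = 0\<close> the two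
  ends are the same orbit.\<close>

definition idn :: "nat \<Rightarrow> nat set" where
  "idn n = (if n = 0 then {0, 1} else {0, 1, 2})"

lemma nSigma_ptn:
  assumes "even n \<or> n = 1" shows "nSigma d n = (\<Union>i\<in>idn n. orb (ptn n i))"
  unfolding nSigma_even[OF assms] idn_def ptn_def by (auto simp: right_word_def)

lemma ptn_disjoint:
  assumes "i \<in> idn n" "j \<in> idn n" "sh k (ptn n i) = ptn n j" shows "i = j"
proof -
  have r: "range (ptn n i) = range (ptn n j)" by (rule sh_eq_range[OF assms(3)])
  have p: "range (ptn n 0) = {d 0}" "range (ptn n 2) = set (right_word n)"
    "range (ptn n 1) = insert (d 0) (set (gap_word n) \<union> set (right_word n))"
    by (simp_all add: ptn_def range_pw range_en)
  have 1: "d 1 \<in> range (ptn n 1)" unfolding p by (auto simp: gap_word_def right_word_def)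
  show ?thesis
  proof (cases "n = 0")
    case True
    then have ij: "i \<in> {0, 1}" "j \<in> {0, 1}" using assms by (auto simp: idn_def)
    have "d 1 \<notin> range (ptn n 0)" unfolding p by simp
    then have "range (ptn n 0) \<noteq> range (ptn n 1)" using 1 by metis
    then show ?thesis using r ij by auto
  next
    case False
    then have *: "d 0 \<notin> range (ptn n 2)" "d 1 \<in> range (ptn n 2)" unfolding p using d0_wn by (auto simp: right_word_def)
    have ij: "i \<in> {0, 1, 2}" "j \<in> {0, 1, 2}" using assms False by (auto simp: idn_def)
    have "d 0 \<in> range (ptn n 1)" "d 0 \<in> range (ptn n 0)" "d 1 \<notin> range (ptn n 0)" unfolding p by auto
    then have "range (ptn n 0) \<noteq> range (ptn n 1)" "range (ptn n 0) \<noteq> range (ptn n 2)"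
      "range (ptn n 1) \<noteq> range (ptn n 2)" using 1 * by metis+
    then show ?thesis using r ij by auto
  qed
qed

text \<open>The assumptions on \<open>f\<close>, \<open>e\<close> and \<open>q\<close> are the data that
  \<open>het_iso\<close> compares. The lemma is applied both to \<open>nSigma d n\<close> itself,
  for its structure, and to critical subshifts, for the embedding.\<close>

lemma nSigma_embeds_aux:
  assumes n: "even n \<or> n = 1" and X: "\<And>x k. x \<in> X \<Longrightarrow> sh k x \<in> X"
    and f: "f \<in> X" "sh 1 f = f" and e: "e \<in> X" "\<not> periodic e" "bwd e f"
    and q: "q \<in> X" "fwd e q" "\<forall>k. sh k q = q \<longleftrightarrow> int (max 1 n) dvd k" "n > 0 \<longleftrightarrow> q \<noteq> f"
  shows "hetsys (ptn n ` idn n) (nSigma d n) \<and> embeds (nSigma d n) X"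
proof -
  define y where "y i = (if i = 0 then f else if i = 1 then e else q)" for i :: nat
  have pq: "periodic q" using q(3) unfolding periodic_def by (metis dvd_refl max.strict_coboundedI1 of_nat_0_less_iff zero_less_one)
  have pf: "sh k f = f" for k using fixed_sh[OF f(2)] .
  have pf': "periodic f" using pf unfolding periodic_def using zero_less_one by blast
  have perpt: "periodic (ptn n 0)" "periodic (ptn n 2)" by (simp_all add: ptn_def per_pw)
  have pr: "sh k (ptn n i) = ptn n i \<longleftrightarrow> sh k (y i) = y i" if i: "i \<in> idn n" for i k
  proof -
    consider "i = 0" | "i = 1" | "i = 2" using i unfolding idn_def by (metis empty_iff insert_iff)
    then show ?thesis
    proof cases
      case 1 then show ?thesis by (simp add: ptn_def y_def pf sh_pw_single)
    next
      case 2 then show ?thesis by (simp add: ptn_def y_def nonper_sh[OF e(2)] nonper_sh[OF en_nonper])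
    next
      case 3 then show ?thesis using q(3) sh_pw_iff[of "right_word n" k] by (simp add: ptn_def y_def)
    qed
  qed
  have dy: "i = j" if ij: "i \<in> idn n" "j \<in> idn n" "sh k (y i) = y j" for i j k
  proof -
    have "periodic (y i) = periodic (y j)" using ij(3) by (metis per_sh_iff)
    then have 1: "i = 1 \<longleftrightarrow> j = 1" using e(2) pq pf' by (auto simp: y_def split: if_splits)
    have "i = j" if "n > 0" "i \<noteq> 1" "j \<noteq> 1"
    proof (rule ccontr)
      assume "i \<noteq> j"
      then have "(i = 0 \<and> j = 2) \<or> (i = 2 \<and> j = 0)" using ij that by (auto simp: idn_def split: if_splits)
      then have "sh k f = q \<or> sh k q = f" using ij(3) by (auto simp: y_def)
      then have "q = f" using pf by (metis sh_eq_iff sh_0 diff_self)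
      then show False using q(4) that by simp
    qed
    then show ?thesis using 1 ij by (auto simp: idn_def split: if_splits)
  qed
  have f0: "\<exists>j\<in>idn n. \<exists>s. periodic (ptn n j) \<and> fwd (ptn n 1) (sh s (ptn n j)) \<and> fwd (y 1) (sh s (y j))"
  proof (cases "n = 0")
    case True
    then have "fwd (ptn n 1) (sh 0 (ptn n 0))" "fwd (y 1) (sh 0 (y 0))"
      using en_fwd[of n] q(2,4) by (simp_all add: ptn_def y_def right_word_def)
    then show ?thesis using perpt(1) by (intro bexI[of _ 0] exI[of _ 0]) (auto simp: idn_def)
  next
    case False
    then have "fwd (ptn n 1) (sh 0 (ptn n 2))" "fwd (y 1) (sh 0 (y 2))"
      using en_fwd[of n] q(2) by (simp_all add: ptn_def y_def)
    then show ?thesis using perpt(2) False by (intro bexI[of _ 2] exI[of _ 0]) (auto simp: idn_def)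
  qed
  have b0: "\<exists>j\<in>idn n. \<exists>s. periodic (ptn n j) \<and> bwd (ptn n 1) (sh s (ptn n j)) \<and> bwd (y 1) (sh s (y j))"
  proof -
    have "bwd (ptn n 1) (sh 0 (ptn n 0))" "bwd (y 1) (sh 0 (y 0))"
      using en_bwd[of n] e(3) by (simp_all add: ptn_def y_def)
    then show ?thesis using perpt(1) by (intro bexI[of _ 0] exI[of _ 0]) (auto simp: idn_def)
  qed
  have triv: "\<exists>j\<in>idn n. \<exists>s. periodic (ptn n j) \<and> fwd (ptn n i) (sh s (ptn n j)) \<and> fwd (y i) (sh s (y j))"
    "\<exists>j\<in>idn n. \<exists>s. periodic (ptn n j) \<and> bwd (ptn n i) (sh s (ptn n j)) \<and> bwd (y i) (sh s (y j))"
    if "i \<in> idn n" "i \<noteq> 1" for i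
  proof -
    have "periodic (ptn n i)" using that perpt by (auto simp: idn_def split: if_splits)
    then show "\<exists>j\<in>idn n. \<exists>s. periodic (ptn n j) \<and> fwd (ptn n i) (sh s (ptn n j)) \<and> fwd (y i) (sh s (y j))"
      "\<exists>j\<in>idn n. \<exists>s. periodic (ptn n j) \<and> bwd (ptn n i) (sh s (ptn n j)) \<and> bwd (y i) (sh s (y j))"
      using that(1) by (auto intro!: bexI[of _ i] exI[of _ 0])
  qed
  have ff: "\<exists>j\<in>idn n. \<exists>s. periodic (ptn n j) \<and> fwd (ptn n i) (sh s (ptn n j)) \<and> fwd (y i) (sh s (y j))"
    if "i \<in> idn n" for i using f0 triv(1)[OF that] by (cases "i = 1") auto
  have bb: "\<exists>j\<in>idn n. \<exists>s. periodic (ptn n j) \<and> bwd (ptn n i) (sh s (ptn n j)) \<and> bwd (y i) (sh s (y j))"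
    if "i \<in> idn n" for i using b0 triv(2)[OF that] by (cases "i = 1") auto
  have Y: "sh k (y i) \<in> X" if "i \<in> idn n" for i k using X f(1) e(1) q(1) by (simp add: y_def)
  have fin: "finite (idn n)" by (simp add: idn_def)
  have "hetsys (ptn n ` idn n) (\<Union>i\<in>idn n. orb (ptn n i))"
    by (rule het_iso(1)[where I = "idn n" and x = "ptn n" and y = y and Y = X]) (fact fin pr ptn_disjoint dy ff bb Y)+
  moreover have "embeds (\<Union>i\<in>idn n. orb (ptn n i)) X"
    by (rule het_iso(2)[where I = "idn n" and x = "ptn n" and y = y and Y = X]) (fact fin pr ptn_disjoint dy ff bb Y)+
  ultimately show ?thesis unfolding nSigma_ptn[OF n] by (rule conjI)
qed

lemma nSigma_pts:
  assumes "even n \<or> n = 1"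
  shows "pw [d 0] \<in> nSigma d n" "en n \<in> nSigma d n" "pw (right_word n) \<in> nSigma d n"
  unfolding nSigma_even[OF assms] by auto

lemma nSigma_even_hetsys:
  assumes "even n \<or> n = 1" shows "hetsys (ptn n ` idn n) (nSigma d n)"
proof -
  have inv: "sh k x \<in> nSigma d n" if "x \<in> nSigma d n" for k x
    using that sh_orb unfolding nSigma_even[OF assms] by blast
  have ne: "n > 0 \<longleftrightarrow> pw (right_word n) \<noteq> pw [d 0]"
  proof -
    have "pw (right_word n) \<noteq> pw [d 0]" if "n > 0"
      using range_pw[of "right_word n"] range_pw[of "[d 0]"] d0_wn[OF that] by auto
    then show ?thesis by (auto simp: right_word_def)
  qed
  show ?thesis
    using nSigma_embeds_aux[OF assms inv nSigma_pts(1)[OF assms] sh_pw_single nSigma_pts(2)[OF assms]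
        en_nonper en_bwd nSigma_pts(3)[OF assms] en_fwd _ ne] sh_pw_iff[of "right_word n"] by simp
qed

lemma nSigma_odd_embeds:
  assumes n: "odd n" "n \<noteq> 1" and X: "\<And>k. sh k x \<in> X" and x: "\<forall>k. sh k x = x \<longleftrightarrow> int n dvd k"
  shows "hetsys {pw (map d [0..<n])} (nSigma d n) \<and> embeds (nSigma d n) X"
proof -
  let ?p = "pw (map d [0..<n])"
  have np: "n > 0" using n(1) by (rule odd_pos)
  have p: "sh k ?p = ?p \<longleftrightarrow> int n dvd k" for k
    by (subst sh_pw_iff) (use np in \<open>auto simp: distinct_map inj_on_def\<close>)
  have pp: "periodic ?p" using np by (intro per_pw) simp
  note iso = het_iso[of "{()}" "\<lambda>_. ?p" "\<lambda>_. x" X]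
  have "hetsys ((\<lambda>_. ?p) ` {()}) (\<Union>i\<in>{()}. orb ?p)" "embeds (\<Union>i\<in>{()}. orb ?p) X"
    by (rule iso; use p x pp X in \<open>auto intro: exI[of _ 0]\<close>)+
  then show ?thesis unfolding nSigma_odd[OF n] by simp
qed

lemma nSigma_odd_hetsys:
  assumes "odd n" "n \<noteq> 1" shows "hetsys {pw (map d [0..<n])} (nSigma d n)"
proof -
  let ?p = "pw (map d [0..<n])"
  have p: "sh k ?p = ?p \<longleftrightarrow> int n dvd k" for k
    by (subst sh_pw_iff) (use odd_pos[OF assms(1)] in \<open>auto simp: distinct_map inj_on_def\<close>)
  show ?thesis using nSigma_odd_embeds[OF assms, of ?p UNIV] p by simp
qed

lemma nSigma_hetsys: "\<exists>E. hetsys E (nSigma d n)"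
  using nSigma_even_hetsys nSigma_odd_hetsys by blast

text \<open>A proper subshift misses the aperiodic orbit, because the closure of that orbit is everything; the
  even cycle that remains is coloured by the parity of its symbols. For odd \<open>n > 1\<close>
  there is only one orbit, an odd cycle.\<close>

lemma nSigma_critical: "critical (nSigma d n)"
proof -
  have S: "subsh (nSigma d n)" using nSigma_hetsys hetsys_subsh by blast
  show ?thesis
  proof (cases "even n \<or> n = 1")
    case True
    have nc: "\<not> colorable (nSigma d n)"
      by (rule noncolorable_fixed_limit[OF S nSigma_pts(1)[OF True] sh_pw_single nSigma_pts(2)[OF True] en_nonper en_bwd])
    have "colorable D" if D: "subsh D" "D \<subset> nSigma d n" for D
    proof -
      have inD: "pw [d 0] \<in> D" "pw (right_word n) \<in> D" if "en n \<in> D"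
        using subsh_bwd_end[OF D(1) that per_pw en_bwd] subsh_fwd_end[OF D(1) that per_pw en_fwd] by auto
      have "en n \<notin> D"
      proof
        assume e: "en n \<in> D"
        then have "nSigma d n \<subseteq> D"
          unfolding nSigma_even[OF True] using subsh_orb[OF D(1)] inD by blast
        then show False using D(2) by blast
      qed
      have no: "x \<notin> orb (en n)" if x: "x \<in> D" for x
      proof
        assume "x \<in> orb (en n)"
        then obtain k where "x = sh k (en n)" unfolding orb_eq by blast
        then have "en n = sh (-k) x" by simp
        then show False using \<open>en n \<notin> D\<close> subsh_sh[OF D(1) x] by metis
      qed
      show ?thesis
      proof (rule colorable_by_symbol[where \<kappa> = "\<lambda>z. \<exists>j. z = d j \<and> odd j"])
        fix x assume x: "x \<in> D" "sh 1 x \<noteq> x"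
        have "x \<in> orb (pw [d 0]) \<union> orb (pw (right_word n))"
          using no[OF x(1)] x(1) D(2) unfolding nSigma_even[OF True] by blast
        moreover have "x \<notin> orb (pw [d 0])"
          using x(2) sh_pw_single[of _ "d 0"] unfolding orb_eq by auto
        ultimately obtain k where k: "x = sh k (pw (right_word n))" unfolding orb_eq by blast
        have "n > 1"
        proof (rule ccontr)
          assume "\<not> n > 1"
          then have "sh j (pw (right_word n)) = pw (right_word n)" for j by (intro sh_pw) simp
          then show False using x(2) unfolding k by simp
        qed
        then have ev: "even n" "n > 0" using True by auto
        have val: "pw (right_word n) i = d (Suc (nat (i mod int n)))" for i
        proof -
          have "nat (i mod int n) < n" using ev(2) by (simp add: nat_less_iff)
          then show ?thesis using ev(2) unfolding pw_def right_word_def by (simp del: upt_Suc)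
        qed
        have par: "odd (Suc (nat (i mod int n))) \<longleftrightarrow> even i" for i
        proof -
          have "even (nat (i mod int n)) \<longleftrightarrow> even (i mod int n)" using ev(2) by (simp add: even_nat_iff)
          also have "\<dots> \<longleftrightarrow> even i" using ev(1) by (simp add: dvd_mod_iff)
          finally show ?thesis by simp
        qed
        have \<kappa>: "(\<exists>j. pw (right_word n) i = d j \<and> odd j) \<longleftrightarrow> even i" for i
          unfolding val using par[of i] by simp
        show "(\<exists>j. x 1 = d j \<and> odd j) \<noteq> (\<exists>j. x 0 = d j \<and> odd j)"
          unfolding k sh_apply \<kappa> by simp
      qed
    qed
    then show ?thesis using S nc unfolding critical_def by blast
  next
    case False
    then have n: "odd n" "n \<noteq> 1" by auto
    let ?p = "pw (map d [0..<n])"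
    have np: "n > 0" using n(1) by (rule odd_pos)
    have p: "sh k ?p = ?p \<longleftrightarrow> int n dvd k" for k
      by (subst sh_pw_iff) (use np in \<open>auto simp: distinct_map inj_on_def\<close>)
    have pin: "?p \<in> nSigma d n" unfolding nSigma_odd[OF n] by simp
    have "\<not> colorable (nSigma d n)"
      by (rule noncolorable_odd_cycle[OF S pin, of "int n"]) (use p n in auto)
    moreover have "colorable D" if D: "subsh D" "D \<subset> nSigma d n" for D
    proof -
      have "D = {}"
      proof (rule ccontr)
        assume "D \<noteq> {}"
        then obtain x where x: "x \<in> D" by blast
        then obtain k where "x = sh k ?p" using D(2) unfolding nSigma_odd[OF n] orb_eq by blast
        then have "?p = sh (-k) x" by simp
        then have "?p \<in> D" using subsh_sh[OF D(1) x] by metis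
        then have "nSigma d n \<subseteq> D" unfolding nSigma_odd[OF n] using subsh_orb[OF D(1)] by blast
        then show False using D(2) by blast
      qed
      then show ?thesis unfolding colorable_def by blast
    qed
    ultimately show ?thesis using S unfolding critical_def by blast
  qed
qed

end

subsection \<open>Odd cycles of heteroclinic orbits\<close>

locale ptuple = symbols d a b
  for d :: "nat \<Rightarrow> 'a" and a :: "nat \<Rightarrow> nat \<Rightarrow> 'a" and b :: "nat \<Rightarrow> 'a" +
  fixes l :: nat and lam :: "nat list" and m :: nat and eps :: "nat list"
  assumes P: "(l, lam, m, eps) \<in> Ptuples"
begin

abbreviation F :: "(int \<Rightarrow> 'a) set" where
  "F \<equiv> pSigma a b (l, lam, m, eps)"

definition wp :: "nat \<Rightarrow> 'a list" where
  "wp i = map (a i) [0..<lam ! i]"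

text \<open>The \<open>i\<close>-th heteroclinic orbit leads from the \<open>st i\<close>-th to the \<open>tg i\<close>-th cycle; the orbit
  number \<open>l\<close> closes the chain and is the only one with a phase shift.\<close>

definition st :: "nat \<Rightarrow> nat" where "st i = (if i < l then i + eps ! i else l)"
definition tg :: "nat \<Rightarrow> nat" where "tg i = (if i < l then i + 1 - eps ! i else 0)"
definition mid :: "nat \<Rightarrow> 'a list" where "mid i = (if i < l then [] else map b [0..<m])"

definition ep :: "nat \<Rightarrow> int \<Rightarrow> 'a" where
  "ep i = brk (wp (st i)) (mid i) (wp (tg i))"

definition pt :: "bool \<times> nat \<Rightarrow> int \<Rightarrow> 'a" where
  "pt p = (if fst p then ep (snd p) else pw (wp (snd p)))"

definition ix :: "(bool \<times> nat) set" where
  "ix = UNIV \<times> {..l}"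

lemma eps01: "i < l \<Longrightarrow> eps ! i = 0 \<or> eps ! i = 1"
proof -
  assume "i < l"
  then have "eps ! i \<in> set eps" using P by (intro nth_mem) (simp add: Ptuples_def)
  then show ?thesis using P by (auto simp: Ptuples_def)
qed

lemma lam_pos: "i \<le> l \<Longrightarrow> 0 < lam ! i" and lam_even: "i \<le> l \<Longrightarrow> even (lam ! i)"
  and m_odd: "odd m" and m_less: "m < lam ! 0"
  using P by (auto simp: Ptuples_def)

lemma st_tg:
  "i < l \<Longrightarrow> (st i = i \<and> tg i = i + 1) \<or> (st i = i + 1 \<and> tg i = i)"
  using eps01[of i] unfolding st_def tg_def by auto

lemma st_le: "i \<le> l \<Longrightarrow> st i \<le> l" and tg_le: "i \<le> l \<Longrightarrow> tg i \<le> l"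
  using st_tg[of i] by (cases "i < l"; force simp: st_def tg_def)+

lemma wp_ne: "i \<le> l \<Longrightarrow> wp i \<noteq> []"
  using lam_pos[of i] by (simp add: wp_def)

lemma wp_simps [simp]: "length (wp i) = lam ! i" "distinct (wp i)" "set (wp i) = a i ` {..<lam ! i}"
  by (auto simp: wp_def distinct_map inj_on_def)

lemma pSigma_pt: "F = (\<Union>p\<in>ix. orb (pt p))"
proof -
  have w: "wp i = map (a i) [0..<lam ! i]" for i by (rule wp_def)
  have 1: "biinf_power (map (a i) [0..<lam ! i]) = pt (False, i)" if "i \<le> l" for i
    using biinf_power_eq[OF wp_ne[OF that]] by (simp add: pt_def w)
  have 2: "glue (left_power (map (a (i + eps ! i)) [0..<lam ! (i + eps ! i)]))
      (right_power (map (a (i + 1 - eps ! i)) [0..<lam ! (i + 1 - eps ! i)])) = pt (True, i)" if "i < l" for i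
    using glue_eq[OF wp_ne[OF st_le[of i]], of "wp (tg i)"] that
    by (simp add: pt_def w ep_def st_def tg_def mid_def)
  have 3: "glue (left_power (map (a l) [0..<lam ! l])) (prepend (map b [0..<m])
      (right_power (map (a 0) [0..<lam ! 0]))) = pt (True, l)"
    using glue_prepend_eq[OF wp_ne[of l], of "map b [0..<m]" "wp 0"]
    by (simp add: pt_def w ep_def st_def tg_def mid_def)
  have "F = (\<Union>i\<le>l. orb (pt (False, i))) \<union> (\<Union>i<l. orb (pt (True, i))) \<union> orb (pt (True, l))"
    unfolding pSigma.simps Let_def using 1 2 3 by simp
  also have "\<dots> = (\<Union>p\<in>ix. orb (pt p))"
  proof -
    have "ix = (\<lambda>i. (False, i)) ` {..l} \<union> (\<lambda>i. (True, i)) ` {..<l} \<union> {(True, l)}"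
      unfolding ix_def by (auto simp: image_iff)
    then show ?thesis by (simp add: UN_Un Un_ac)
  qed
  finally show ?thesis .
qed

lemma ep_bwd: "bwd (ep i) (pw (wp (st i)))"
  unfolding ep_def by (rule bwd_brk)

lemma ep_fwd: "fwd (ep i) (sh (if i < l then 0 else - int m) (pw (wp (tg i))))"
  using fwd_brk[of "wp (st i)" "mid i" "wp (tg i)"] unfolding ep_def
  by (cases "i < l") (simp_all add: mid_def)

lemma a_in_wp: "a j k \<in> set (wp i) \<longleftrightarrow> j = i \<and> k < lam ! i"
  by auto

lemma b_notin_wp: "b k \<notin> set (wp i)"
  by auto

lemma ep_nonper:
  assumes i: "i \<le> l" shows "\<not> periodic (ep i)"
proof (cases "i < l")
  case True
  have "a (tg i) 0 \<in> set (wp (tg i))" unfolding a_in_wp using lam_pos[OF tg_le[OF i]] by simp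
  moreover have "a (tg i) 0 \<notin> set (wp (st i))" unfolding a_in_wp using st_tg[OF True] by auto
  ultimately show ?thesis unfolding ep_def using wp_ne st_le[OF i] tg_le[OF i] by (intro brk_nonper) auto
next
  case False
  have "b 0 \<in> set (mid i)" using m_odd odd_pos False by (auto simp: mid_def)
  then show ?thesis unfolding ep_def
    using wp_ne st_le[OF i] tg_le[OF i] b_notin_wp[of 0 "st i"] brk_nonper[of "wp (st i)" "wp (tg i)" "b 0" "mid i"] by blast
qed

lemma range_pt_False: "i \<le> l \<Longrightarrow> range (pt (False, i)) = set (wp i)"
  using range_pw[OF wp_ne] by (simp add: pt_def)

lemma range_pt_True: "i \<le> l \<Longrightarrow> range (pt (True, i)) = set (wp (st i)) \<union> set (mid i) \<union> set (wp (tg i))"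
  using range_brk[OF wp_ne[OF st_le] wp_ne[OF tg_le]] by (simp add: pt_def ep_def del: wp_simps)

lemma b0_range:
  assumes "p \<in> ix" shows "b 0 \<in> range (pt p) \<longleftrightarrow> p = (True, l)"
proof -
  obtain t i where p: "p = (t, i)" "i \<le> l" using assms by (cases p) (auto simp: ix_def)
  have "b 0 \<in> set (mid i) \<longleftrightarrow> i = l" using p(2) m_odd odd_pos by (auto simp: mid_def)
  then show ?thesis unfolding p(1) using range_pt_False[OF p(2)] range_pt_True[OF p(2)] b_notin_wp by (cases t) auto
qed

lemma a0_range_False: "i \<le> l \<Longrightarrow> a j 0 \<in> range (pt (False, i)) \<longleftrightarrow> j = i"
  unfolding range_pt_False a_in_wp using lam_pos by auto

lemma a0_range_True:
  assumes "i < l" shows "a j 0 \<in> range (pt (True, i)) \<longleftrightarrow> j = i \<or> j = i + 1"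
proof -
  have "mid i = []" using assms by (simp add: mid_def)
  moreover have "lam ! i > 0" "lam ! (i + 1) > 0" using lam_pos assms by auto
  ultimately show ?thesis using range_pt_True[of i] st_tg[OF assms] assms a_in_wp by (auto simp del: wp_simps)
qed

text \<open>The symbols that occur in a point identify its orbit: \<open>b 0\<close> marks the closing orbit,
  and the symbols \<open>a j 0\<close> tell which cycles the other ones touch.\<close>

lemma pt_disjoint:
  assumes "p \<in> ix" "q \<in> ix" "sh k (pt p) = pt q" shows "p = q"
proof -
  have r: "range (pt p) = range (pt q)" by (rule sh_eq_range[OF assms(3)])
  show ?thesis
  proof (cases "p = (True, l) \<or> q = (True, l)")
    case True
    have "b 0 \<in> range (pt p) \<longleftrightarrow> b 0 \<in> range (pt q)" by (simp only: r)
    then show ?thesis using True unfolding b0_range[OF assms(1)] b0_range[OF assms(2)] by metis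
  next
    case False
    obtain t i where p: "p = (t, i)" "i \<le> l" using assms(1) by (cases p) (auto simp: ix_def)
    obtain u j where q: "q = (u, j)" "j \<le> l" using assms(2) by (cases q) (auto simp: ix_def)
    have t: "t \<Longrightarrow> i < l" and u: "u \<Longrightarrow> j < l" using False p q by auto
    have e: "a n 0 \<in> range (pt (t, i)) \<longleftrightarrow> a n 0 \<in> range (pt (u, j))" for n
      by (simp only: r[unfolded p(1) q(1)])
    show ?thesis
    proof (cases t; cases u)
      assume "t" "u"
      then have "n = i \<or> n = i + 1 \<longleftrightarrow> n = j \<or> n = j + 1" for n
        using e[of n] a0_range_True[OF t] a0_range_True[OF u] by simp
      from this[of i] this[of j] have "i = j" by auto
      then show ?thesis using p q \<open>t\<close> \<open>u\<close> by simp
    next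
      assume "t" "\<not> u"
      then have "n = i \<or> n = i + 1 \<longleftrightarrow> n = j" for n
        using e[of n] a0_range_True[OF t] a0_range_False[OF q(2)] by simp
      from this[of i] this[of "i + 1"] show ?thesis by auto
    next
      assume "\<not> t" "u"
      then have "n = i \<longleftrightarrow> n = j \<or> n = j + 1" for n
        using e[of n] a0_range_False[OF p(2)] a0_range_True[OF u] by simp
      from this[of j] this[of "j + 1"] show ?thesis by auto
    next
      assume "\<not> t" "\<not> u"
      then show ?thesis using e[of i] a0_range_False[OF p(2)] a0_range_False[OF q(2)] p q by simp
    qed
  qed
qed

text \<open>Here \<open>v\<close> and \<open>e\<close> play the cycles and the connecting orbits. With the
  points of \<open>F\<close> in these roles the lemma describes \<open>F\<close>, and with those of
  a shortest odd chain it embeds \<open>F\<close> there.\<close>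

lemma pSigma_embeds_aux:
  assumes X: "\<And>x k. x \<in> X \<Longrightarrow> sh k x \<in> X"
    and v: "\<And>i. i \<le> l \<Longrightarrow> v i \<in> X" "\<And>i k. i \<le> l \<Longrightarrow> sh k (v i) = v i \<longleftrightarrow> int (lam ! i) dvd k"
    and e: "\<And>i. i \<le> l \<Longrightarrow> e i \<in> X" "\<And>i. i \<le> l \<Longrightarrow> \<not> periodic (e i)"
    and eb: "\<And>i. i \<le> l \<Longrightarrow> bwd (e i) (v (st i))"
    and ef: "\<And>i. i \<le> l \<Longrightarrow> fwd (e i) (sh (if i < l then 0 else - int m) (v (tg i)))"
    and dv: "\<And>i j k. i \<le> l \<Longrightarrow> j \<le> l \<Longrightarrow> sh k (v i) = v j \<Longrightarrow> i = j"
    and de: "\<And>i j k. i \<le> l \<Longrightarrow> j \<le> l \<Longrightarrow> sh k (e i) = e j \<Longrightarrow> i = j"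
  shows "hetsys (pt ` ix) F \<and> embeds F X"
proof -
  define y where "y p = (if fst p then e (snd p) else v (snd p))" for p :: "bool \<times> nat"
  have pv: "periodic (v i)" if "i \<le> l" for i
    unfolding periodic_def using v(2)[OF that, of "int (lam ! i)"] lam_pos[OF that] by (intro exI[of _ "int (lam ! i)"]) simp
  have ptp: "periodic (pt (False, i))" if "i \<le> l" for i using per_pw[OF wp_ne[OF that]] by (simp add: pt_def)
  have in_ix: "(t, i) \<in> ix \<longleftrightarrow> i \<le> l" for t i by (auto simp: ix_def)
  have fin: "finite ix" unfolding ix_def by simp
  have pr: "sh k (pt p) = pt p \<longleftrightarrow> sh k (y p) = y p" if pi: "p \<in> ix" for p k
  proof -
    obtain t i where p: "p = (t, i)" "i \<le> l" using pi in_ix by (cases p) auto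
    show ?thesis
    proof (cases t)
      case True
      then show ?thesis using nonper_sh[OF ep_nonper[OF p(2)], of k] nonper_sh[OF e(2)[OF p(2)], of k] p(1)
        by (simp add: pt_def y_def)
    next
      case False
      then show ?thesis using sh_pw_iff[OF wp_simps(2) wp_ne[OF p(2)], of k] v(2)[OF p(2), of k] p(1)
        by (simp add: pt_def y_def)
    qed
  qed
  have dy: "p = q" if pq: "p \<in> ix" "q \<in> ix" "sh k (y p) = y q" for p q k
  proof -
    obtain t i where p: "p = (t, i)" "i \<le> l" using pq(1) in_ix by (cases p) auto
    obtain u j where q: "q = (u, j)" "j \<le> l" using pq(2) in_ix by (cases q) auto
    have "periodic (y p) = periodic (y q)" using pq(3) by (metis per_sh_iff)
    then have "t = u" using pv[OF p(2)] pv[OF q(2)] e(2)[OF p(2)] e(2)[OF q(2)] p(1) q(1)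
      by (auto simp: y_def split: if_splits)
    moreover have "i = j" using pq(3) dv[OF p(2) q(2), of k] de[OF p(2) q(2), of k] \<open>t = u\<close> p(1) q(1)
      by (cases t) (auto simp: y_def)
    ultimately show ?thesis using p q by simp
  qed
  have ff: "\<exists>q\<in>ix. \<exists>s. periodic (pt q) \<and> fwd (pt p) (sh s (pt q)) \<and> fwd (y p) (sh s (y q))" if pi: "p \<in> ix" for p
  proof -
    obtain t i where p: "p = (t, i)" "i \<le> l" using pi in_ix by (cases p) auto
    show ?thesis
    proof (cases t)
      case True
      let ?s = "if i < l then 0 else - int m"
      have "fwd (pt p) (sh ?s (pt (False, tg i)))" using ep_fwd[of i] True p(1) by (simp add: pt_def)
      moreover have "fwd (y p) (sh ?s (y (False, tg i)))" using ef[OF p(2)] True p(1) by (simp add: y_def)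
      ultimately show ?thesis using ptp[OF tg_le[OF p(2)]] tg_le[OF p(2)] in_ix by blast
    next
      case False
      then have "periodic (pt p) \<and> fwd (pt p) (sh 0 (pt p)) \<and> fwd (y p) (sh 0 (y p))" using ptp[OF p(2)] p(1) by simp
      then show ?thesis using pi by blast
    qed
  qed
  have bb: "\<exists>q\<in>ix. \<exists>s. periodic (pt q) \<and> bwd (pt p) (sh s (pt q)) \<and> bwd (y p) (sh s (y q))" if pi: "p \<in> ix" for p
  proof -
    obtain t i where p: "p = (t, i)" "i \<le> l" using pi in_ix by (cases p) auto
    show ?thesis
    proof (cases t)
      case True
      have "bwd (pt p) (sh 0 (pt (False, st i)))" using ep_bwd[of i] True p(1) by (simp add: pt_def)
      moreover have "bwd (y p) (sh 0 (y (False, st i)))" using eb[OF p(2)] True p(1) by (simp add: y_def)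
      ultimately show ?thesis using ptp[OF st_le[OF p(2)]] st_le[OF p(2)] in_ix by blast
    next
      case False
      then have "periodic (pt p) \<and> bwd (pt p) (sh 0 (pt p)) \<and> bwd (y p) (sh 0 (y p))" using ptp[OF p(2)] p(1) by simp
      then show ?thesis using pi by blast
    qed
  qed
  have Y: "sh k (y p) \<in> X" if "p \<in> ix" for p k
    using X v(1) e(1) that in_ix unfolding y_def by (cases p) auto
  have "hetsys (pt ` ix) (\<Union>p\<in>ix. orb (pt p))"
    by (rule het_iso(1)[where I = ix and x = pt and y = y and Y = X]) (fact fin pr pt_disjoint dy ff bb Y)+
  moreover have "embeds (\<Union>p\<in>ix. orb (pt p)) X"
    by (rule het_iso(2)[where I = ix and x = pt and y = y and Y = X]) (fact fin pr pt_disjoint dy ff bb Y)+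
  ultimately show ?thesis unfolding pSigma_pt by (rule conjI)
qed

lemma pt_in: "i \<le> l \<Longrightarrow> pw (wp i) \<in> F" "i \<le> l \<Longrightarrow> ep i \<in> F"
proof -
  assume i: "i \<le> l"
  then have "(False, i) \<in> ix" "(True, i) \<in> ix" by (auto simp: ix_def)
  then have "pt (False, i) \<in> F" "pt (True, i) \<in> F" unfolding pSigma_pt using orb_self by blast+
  then show "pw (wp i) \<in> F" "ep i \<in> F" by (simp_all add: pt_def)
qed

lemma pSigma_hetsys: "hetsys (pt ` ix) F"
proof -
  have inv: "sh k x \<in> F" if "x \<in> F" for k x
    using that sh_orb unfolding pSigma_pt by blast
  have dv: "i = j" if "i \<le> l" "j \<le> l" "sh k (pw (wp i)) = pw (wp j)" for i j k
    using pt_disjoint[of "(False, i)" "(False, j)" k] that by (simp add: ix_def pt_def)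
  have de: "i = j" if "i \<le> l" "j \<le> l" "sh k (ep i) = ep j" for i j k
    using pt_disjoint[of "(True, i)" "(True, j)" k] that by (simp add: ix_def pt_def)
  have pv: "sh k (pw (wp i)) = pw (wp i) \<longleftrightarrow> int (lam ! i) dvd k" if "i \<le> l" for i k
    using sh_pw_iff[OF wp_simps(2) wp_ne[OF that], of k] by simp
  have "hetsys (pt ` ix) F \<and> embeds F F"
    by (rule pSigma_embeds_aux[where X = F and v = "\<lambda>i. pw (wp i)" and e = ep])
      (fact inv pt_in(1) pv pt_in(2) ep_nonper dv de | rule ep_bwd | rule ep_fwd)+
  then show ?thesis by (rule conjunct1)
qed

text \<open>The connecting orbits force all the words to begin with the same colour; the closing orbit then
  asks this colour to be its opposite, since \<open>m\<close> is odd.\<close>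

lemma pSigma_noncolorable: "\<not> colorable F"
proof
  have S: "subsh F" using hetsys_subsh[OF pSigma_hetsys] .
  assume "colorable F"
  then obtain c :: "_ \<Rightarrow> bool" and M where M: "\<forall>x\<in>F. \<forall>y\<in>F. agree M x y \<longrightarrow> c x = c y"
    and c: "\<forall>x\<in>F. sh 1 x \<noteq> x \<longrightarrow> c (sh 1 x) \<noteq> c x" by (rule colorableE)
  have nv: "sh 1 (pw (wp i)) \<noteq> pw (wp i)" if i: "i \<le> l" for i
  proof -
    have "\<not> int (lam ! i) dvd 1" using lam_even[OF i] by (metis dvd_trans even_of_nat_iff odd_one)
    then show ?thesis using sh_pw_iff[OF wp_simps(2) wp_ne[OF i], of 1] by simp
  qed
  have ne: "sh 1 (ep i) \<noteq> ep i" if i: "i \<le> l" for i using nonper_sh[OF ep_nonper[OF i], of 1] by simp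
  have bw: "c (ep i) = c (pw (wp (st i)))" if i: "i \<le> l" for i
    by (rule color_bwd[OF S c M pt_in(2)[OF i] ne[OF i] pt_in(1)[OF st_le[OF i]] nv[OF st_le[OF i]] ep_bwd])
  have fw: "c (ep i) = c (pw (wp (tg i)))" if i: "i < l" for i
  proof -
    have i': "i \<le> l" using i by simp
    have "fwd (ep i) (pw (wp (tg i)))" using ep_fwd[of i] i by simp
    then show ?thesis by (rule color_fwd[OF S c M pt_in(2)[OF i'] ne[OF i'] pt_in(1)[OF tg_le[OF i']] nv[OF tg_le[OF i']]])
  qed
  have eq: "c (pw (wp i)) = c (pw (wp 0))" if "i \<le> l" for i
    using that
  proof (induction i)
    case (Suc i)
    then have "c (pw (wp (st i))) = c (pw (wp (tg i)))" using bw[of i] fw[of i] by simp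
    then have "c (pw (wp (Suc i))) = c (pw (wp i))" using st_tg[of i] Suc.prems by auto
    then show ?case using Suc by simp
  qed simp
  let ?q = "sh (- int m) (pw (wp 0))"
  have q: "?q \<in> F" using subsh_sh[OF S pt_in(1)] by simp
  have nq: "sh 1 ?q \<noteq> ?q" using nv[of 0] by (simp add: sh_eq_iff)
  have "fwd (ep l) ?q" using ep_fwd[of l] by (simp add: tg_def)
  then have "c (ep l) = c ?q" by (rule color_fwd[OF S c M pt_in(2)[OF order_refl] ne[OF order_refl] q nq])
  moreover have "c ?q \<noteq> c (pw (wp 0))"
    using color_alternates[OF S c pt_in(1)[of 0] nv[of 0], of "- int m"] m_odd by simp
  moreover have "c (ep l) = c (pw (wp 0))" using bw[of l] eq[of l] by (simp add: st_def)
  ultimately show False by simp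
qed

text \<open>A proper subshift lacks one of the connecting orbits. The parity of the position in the words is a
  colouring along all of them except the closing one. If the closing orbit is present, exchanging
  the colours on the cycles before the gap corrects this.\<close>

lemma pSigma_critical: "critical F"
proof -
  have S: "subsh F" using hetsys_subsh[OF pSigma_hetsys] .
  have "colorable D" if D: "subsh D" "D \<subset> F" for D
  proof -
    have "\<exists>i\<le>l. ep i \<notin> D"
    proof (rule ccontr)
      assume "\<not> ?thesis"
      then have e: "ep i \<in> D" if "i \<le> l" for i using that by blast
      have s: "pw (wp (st i)) \<in> D" if i: "i \<le> l" for i
        by (rule subsh_bwd_end[OF D(1) e[OF i] per_pw[OF wp_ne[OF st_le[OF i]]] ep_bwd])
      have t: "pw (wp (tg i)) \<in> D" if i: "i < l" for i
      proof (rule subsh_fwd_end[OF D(1) e])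
        show "fwd (ep i) (pw (wp (tg i)))" using ep_fwd[of i] i by simp
      qed (use i tg_le[of i] per_pw wp_ne in auto)
      have v: "pw (wp i) \<in> D" if i: "i \<le> l" for i
      proof (cases "i < l")
        case True
        then show ?thesis using s[OF i] t[OF True] st_tg[OF True] by auto
      next
        case False
        then show ?thesis using s[OF i] i by (simp add: st_def)
      qed
      have "pt p \<in> D" if "p \<in> ix" for p
        using that e v unfolding pt_def ix_def by (cases p) auto
      then have "F \<subseteq> D" unfolding pSigma_pt using subsh_orb[OF D(1)] by blast
      then show False using D(2) by blast
    qed
    then obtain i0 where i0: "i0 \<le> l" "ep i0 \<notin> D" by blast
    \<comment> \<open>The cycles on which the two colours are exchanged; none if the closing orbit is the missing one.\<close>
    define s where "s i \<longleftrightarrow> i \<le> i0 \<and> i0 < l" for i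
    define \<kappa> where "\<kappa> z \<longleftrightarrow> (\<exists>i j. z = a i j \<and> (odd j \<noteq> s i)) \<or> (\<exists>j. z = b j \<and> odd j)" for z
    have \<kappa>a: "\<kappa> (a i j) \<longleftrightarrow> (odd j \<noteq> s i)" for i j unfolding \<kappa>_def by auto
    have \<kappa>b: "\<kappa> (b j) \<longleftrightarrow> odd j" for j unfolding \<kappa>_def by auto
    have \<kappa>v: "\<kappa> (pw (wp i) k) \<longleftrightarrow> (odd k \<noteq> s i)" if i: "i \<le> l" for i k
    proof -
      have "nat (k mod int (lam ! i)) < lam ! i" using lam_pos[OF i] by (simp add: nat_less_iff)
      then have "pw (wp i) k = a i (nat (k mod int (lam ! i)))" unfolding pw_def wp_def by simp
      moreover have "even (nat (k mod int (lam ! i))) \<longleftrightarrow> even k"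
      proof -
        have "even (nat (k mod int (lam ! i))) \<longleftrightarrow> even (k mod int (lam ! i))"
          using lam_pos[OF i] by (simp add: even_nat_iff)
        also have "\<dots> \<longleftrightarrow> even k" using lam_even[OF i] by (simp add: dvd_mod_iff)
        finally show ?thesis .
      qed
      ultimately show ?thesis using \<kappa>a by simp
    qed
    have \<kappa>e: "\<exists>t. \<forall>k. \<kappa> (ep i k) \<longleftrightarrow> (odd k \<noteq> t)" if i: "i \<le> l" "i \<noteq> i0" for i
    proof (cases "i < l")
      case True
      have "s (st i) = s i" "s (tg i) = s i" using st_tg[OF True] i(2) unfolding s_def by auto
      then have "\<kappa> (ep i k) \<longleftrightarrow> (odd k \<noteq> s i)" for k
        using \<kappa>v[OF st_le[OF i(1)], of k] \<kappa>v[OF tg_le[OF i(1)], of k] True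
        unfolding ep_def brk_def mid_def by simp
      then show ?thesis by blast
    next
      case False
      then have l: "i = l" "i0 < l" using i i0(1) by auto
      have "s 0" "\<not> s l" using l unfolding s_def by auto
      then have "\<kappa> (ep l k) \<longleftrightarrow> odd k" for k
        using \<kappa>v[of l k] \<kappa>v[of 0 "k - int m"] \<kappa>b[of "nat k"] m_odd
        unfolding ep_def brk_def by (auto simp: mid_def st_def tg_def even_nat_iff nat_less_iff)
      then show ?thesis using l(1) by blast
    qed
    show ?thesis
    proof (rule colorable_by_symbol[where \<kappa> = \<kappa>])
      fix x assume x: "x \<in> D"
      then obtain p k where p: "p \<in> ix" "x = sh k (pt p)" using D(2) unfolding pSigma_pt orb_eq by blast
      have "pt p = sh (-k) x" using p(2) by simp
      then have ptD: "pt p \<in> D" using subsh_sh[OF D(1) x] by metis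
      obtain u i where ui: "p = (u, i)" "i \<le> l" using p(1) by (cases p) (auto simp: ix_def)
      have "\<exists>t. \<forall>k. \<kappa> (pt p k) \<longleftrightarrow> (odd k \<noteq> t)"
      proof (cases u)
        case True
        then have "i \<noteq> i0" using ptD i0(2) ui by (auto simp: pt_def)
        then show ?thesis using \<kappa>e[OF ui(2)] ui(1) True by (simp add: pt_def)
      next
        case False
        then show ?thesis using \<kappa>v[OF ui(2)] ui(1) by (auto simp: pt_def)
      qed
      then obtain t where "\<forall>k. \<kappa> (pt p k) \<longleftrightarrow> (odd k \<noteq> t)" ..
      then have "\<kappa> (pt p (1 + k)) \<longleftrightarrow> (odd (1 + k) \<noteq> t)" "\<kappa> (pt p (0 + k)) \<longleftrightarrow> (odd (0 + k) \<noteq> t)" by blast+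
      then show "\<kappa> (x 1) \<noteq> \<kappa> (x 0)" unfolding p(2) sh_apply by auto
    qed
  qed
  then show ?thesis using S pSigma_noncolorable unfolding critical_def by blast
qed

end

section \<open>Subshifts of Cantor-Bendixson rank two\<close>

lemma infinite_cluster:
  assumes X: "subsh X" and S: "S \<subseteq> X" "infinite S"
  shows "\<exists>y\<in>X. \<forall>N. \<exists>z\<in>S. z \<noteq> y \<and> agree N y z"
proof -
  obtain f :: "nat \<Rightarrow> int \<Rightarrow> 'a" where f: "inj f" "range f \<subseteq> S"
    using infinite_countable_subset[OF S(2)] by blast
  have fX: "f n \<in> X" for n using f(2) S(1) by blast
  obtain y where y: "y \<in> X" "\<forall>N m. \<exists>n\<ge>m. agree N (f n) y"
    using subsh_cluster_point[OF X, of f, OF fX] ..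
  have "\<exists>z\<in>S. z \<noteq> y \<and> agree N y z" for N
  proof -
    obtain m where m: "\<forall>n\<ge>m. f n \<noteq> y"
    proof (cases "y \<in> range f")
      case True
      then obtain n0 where "y = f n0" by blast
      then have "\<forall>n\<ge>Suc n0. f n \<noteq> y" using f(1) by (metis inj_eq Suc_n_not_le_n)
      then show thesis by (rule that)
    next
      case False
      then have "\<forall>n\<ge>0. f n \<noteq> y" by blast
      then show thesis by (rule that)
    qed
    obtain n where "n \<ge> m" "agree N (f n) y" using y(2) by blast
    then show ?thesis using m f(2) agree_sym[of N "f n" y] by (intro bexI[of _ "f n"]) auto
  qed
  then show ?thesis using y(1) by blast
qed

lemma lim_pts_wclosed:
  assumes "wclosed X" shows "wclosed (lim_pts X)"
  unfolding wclosed_def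
proof (intro allI impI)
  fix y assume a: "\<forall>N. \<exists>z\<in>lim_pts X. agree N z y"
  have yX: "y \<in> X" using wclosedD[OF assms] a lim_pts_subset by blast
  show "y \<in> lim_pts X"
  proof (rule ccontr)
    assume ny: "y \<notin> lim_pts X"
    then obtain N where N: "\<forall>z\<in>X. agree N y z \<longrightarrow> z = y" using not_lim_ptsD[OF yX] by auto
    obtain z where z: "z \<in> lim_pts X" "agree N z y" using a by blast
    then have "z = y" using N agree_sym[OF z(2)] lim_pts_subset[of X] by auto
    then show False using z(1) ny by simp
  qed
qed

lemma lim_pts_sh:
  assumes X: "subsh X" and x: "x \<in> lim_pts X" shows "sh k x \<in> lim_pts X"
  unfolding lim_pts_def
proof (intro CollectI conjI allI)
  have xX: "x \<in> X" using x lim_pts_subset by blast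
  then show "sh k x \<in> X" by (rule subsh_sh[OF X])
  fix N
  obtain y where y: "y \<in> X" "y \<noteq> x" "agree (N + \<bar>k\<bar>) x y" using lim_ptsD[OF x] by blast
  have "agree N (sh k x) (sh k y)" by (rule agree_sh[OF y(3)]) simp
  then show "\<exists>y\<in>X. y \<noteq> sh k x \<and> agree N (sh k x) y"
    using y(1,2) subsh_sh[OF X] by (intro bexI[of _ "sh k y"]) auto
qed

lemma finite_separated:
  assumes "finite P" shows "\<exists>N. \<forall>p\<in>P. \<forall>q\<in>P. agree N p q \<longrightarrow> p = q"
proof -
  define f where "f pq = (SOME N. \<not> agree N (fst pq) (snd pq))" for pq :: "(int \<Rightarrow> 'a) \<times> (int \<Rightarrow> 'a)"
  define N0 where "N0 = Max (insert 0 (f ` (P \<times> P)))"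
  have "p = q" if pq: "p \<in> P" "q \<in> P" "agree N0 p q" for p q
  proof (rule ccontr)
    assume "p \<noteq> q"
    then have "\<exists>N. \<not> agree N p q" using agree_all by blast
    then have n: "\<not> agree (f (p, q)) p q" unfolding f_def fst_conv snd_conv by (rule someI_ex)
    have "f (p, q) \<le> N0" unfolding N0_def using assms pq(1,2) by (intro Max_ge) auto
    then show False using n agree_mono[OF pq(3)] by blast
  qed
  then show ?thesis by blast
qed

text \<open>Outside a small neighbourhood of its finitely many limit points the space is finite, so an
  aperiodic orbit stays in that neighbourhood from some time on. There it shadows a limit point, and
  by expansivity it coincides with the latter from then on.\<close>

lemma rank_two_hetsys:
  assumes X: "subsh X" and two: "lim_pts (lim_pts X) = {}"
  shows "\<exists>E. hetsys E X"
proof -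
  define P where "P = lim_pts X"
  have PX: "P \<subseteq> X" unfolding P_def by (rule lim_pts_subset)
  have Psh: "sh k p \<in> P" if "p \<in> P" for p k using lim_pts_sh[OF X] that unfolding P_def by blast
  have wP: "wclosed P" unfolding P_def by (rule lim_pts_wclosed[OF subsh_wclosed[OF X]])
  have sP: "subsh P" by (rule subsh_subset[OF X PX wP]) (rule Psh)
  have finP: "finite P"
  proof (rule ccontr)
    assume "infinite P"
    then obtain y where "y \<in> P" "\<forall>N. \<exists>z\<in>P. z \<noteq> y \<and> agree N y z"
      using infinite_cluster[OF sP order_refl] by auto
    then have "y \<in> lim_pts P" unfolding lim_pts_def by simp
    then show False using two unfolding P_def by simp
  qed
  have Pper: "periodic p" if "p \<in> P" for p
    unfolding per_finite_orb using subsh_orb[OF sP that] finP finite_subset by blast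
  obtain N0 where N0: "\<forall>p\<in>P. \<forall>q\<in>P. agree N0 p q \<longrightarrow> p = q" using finite_separated[OF finP] ..
  define N where "N = max 0 N0"
  have N: "p = q" if pq: "p \<in> P" "q \<in> P" "agree N p q" for p q
  proof -
    have "agree N0 p q" by (rule agree_mono[OF pq(3)]) (simp add: N_def)
    then show ?thesis using N0 pq(1,2) by blast
  qed
  define E where "E = {x\<in>X. \<forall>p\<in>P. \<not> agree (N+1) x p}"
  have EX: "E \<subseteq> X" unfolding E_def by auto
  have finE: "finite E"
  proof (rule ccontr)
    assume "infinite E"
    then obtain y where y: "y \<in> X" "\<forall>N. \<exists>z\<in>E. z \<noteq> y \<and> agree N y z"
      using infinite_cluster[OF X EX] by auto
    then have "y \<in> P" unfolding P_def lim_pts_def using EX by auto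
    moreover obtain z where "z \<in> E" "agree (N+1) y z" using y(2) by blast
    ultimately show False unfolding E_def using agree_sym[of "N+1" y z] by auto
  qed
  have near: "\<exists>p. p \<in> P \<and> agree (N+1) x p" if "x \<in> X" "x \<notin> E" for x using that unfolding E_def by auto
  \<comment> \<open>Limit points differ within the window \<open>N\<close>, so the closest one moves along with the orbit.\<close>
  have shadow: "q = sh j p" if pq: "p \<in> P" "q \<in> P" "agree (N+1) x p" "agree (N+1) (sh j x) q" "\<bar>j\<bar> = 1" for p q x j
  proof -
    have "agree N (sh j x) (sh j p)" by (rule agree_sh[OF pq(3)]) (use pq(5) in simp)
    moreover have "agree N (sh j x) q" by (rule agree_mono[OF pq(4)]) simp
    ultimately have "agree N q (sh j p)" using agree_sym agree_trans by blast
    then show ?thesis using N pq(2) Psh[OF pq(1)] by blast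
  qed
  have up: "\<exists>q\<in>P. \<forall>k\<ge>K. x k = q k" if x: "x \<in> X" "\<forall>k\<ge>K. sh k x \<notin> E" for x K
  proof -
    have "\<forall>k. \<exists>p. k \<ge> K \<longrightarrow> p \<in> P \<and> agree (N+1) (sh k x) p" using near[OF subsh_sh[OF X x(1)]] x(2) by blast
    from choice[OF this] obtain p where p: "\<forall>k. k \<ge> K \<longrightarrow> p k \<in> P \<and> agree (N+1) (sh k x) (p k)" ..
    have q: "p k = sh (k - K) (p K)" if "k \<ge> K" for k
      using that
    proof (induction k rule: int_ge_induct)
      case (step k)
      have "agree (N+1) (sh 1 (sh k x)) (p (k+1))" using p step.hyps by (simp add: add.commute)
      then have "p (k+1) = sh 1 (p k)" using p step.hyps shadow[of "p k" "p (k+1)" "sh k x" 1]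
        by simp
      then show ?case using step.IH by (simp add: algebra_simps)
    qed simp
    have "x k = sh (- K) (p K) k" if k: "k \<ge> K" for k
    proof -
      have "sh k x 0 = p k 0" by (rule agreeD[of "N+1"]) (use p k N_def in auto)
      then show ?thesis using q[OF k] by (simp add: sh_apply)
    qed
    moreover have "sh (- K) (p K) \<in> P" using p Psh by blast
    ultimately show ?thesis by blast
  qed
  have down: "\<exists>q\<in>P. \<forall>k\<le>K. x k = q k" if x: "x \<in> X" "\<forall>k\<le>K. sh k x \<notin> E" for x K
  proof -
    have "\<forall>k. \<exists>p. k \<le> K \<longrightarrow> p \<in> P \<and> agree (N+1) (sh k x) p" using near[OF subsh_sh[OF X x(1)]] x(2) by blast
    from choice[OF this] obtain p where p: "\<forall>k. k \<le> K \<longrightarrow> p k \<in> P \<and> agree (N+1) (sh k x) (p k)" ..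
    have q: "p k = sh (k - K) (p K)" if "k \<le> K" for k
      using that
    proof (induction k rule: int_le_induct)
      case (step k)
      have "agree (N+1) (sh (-1) (sh k x)) (p (k-1))" using p step.hyps by simp
      then have "p (k-1) = sh (-1) (p k)" using p step.hyps shadow[of "p k" "p (k-1)" "sh k x" "-1"]
        by simp
      then show ?case using step.IH by (simp add: algebra_simps)
    qed simp
    have "x k = sh (- K) (p K) k" if k: "k \<le> K" for k
    proof -
      have "sh k x 0 = p k 0" by (rule agreeD[of "N+1"]) (use p k N_def in auto)
      then show ?thesis using q[OF k] by (simp add: sh_apply)
    qed
    moreover have "sh (- K) (p K) \<in> P" using p Psh by blast
    ultimately show ?thesis by blast
  qed
  have visits: "finite {k. sh k x \<in> E}" if "\<not> periodic x" for x
  proof -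
    have "inj_on (\<lambda>k. sh k x) {k. sh k x \<in> E}"
      using nonper_sh[OF that] by (auto simp: inj_on_def sh_eq_iff)
    moreover have "(\<lambda>k. sh k x) ` {k. sh k x \<in> E} \<subseteq> E" by auto
    ultimately show ?thesis using finE inj_on_finite by blast
  qed
  have bounded: "\<exists>K. \<forall>k. sh k x \<in> E \<longrightarrow> \<bar>k\<bar> < K" if "\<not> periodic x" for x
  proof (intro exI allI impI)
    fix k assume "sh k x \<in> E"
    then have "\<bar>k\<bar> \<le> Max (insert 0 (abs ` {k. sh k x \<in> E}))" using visits[OF that] by (intro Max_ge) auto
    then show "\<bar>k\<bar> < Max (insert 0 (abs ` {k. sh k x \<in> E})) + 1" by simp
  qed
  have fw: "\<exists>q\<in>X. periodic q \<and> fwd x q" if x: "x \<in> X" for x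
  proof (cases "periodic x")
    case True
    then show ?thesis using x fwd_refl by blast
  next
    case False
    then obtain K where "\<forall>k. sh k x \<in> E \<longrightarrow> \<bar>k\<bar> < K" using bounded by blast
    then have "\<forall>k\<ge>K. sh k x \<notin> E" by fastforce
    then show ?thesis using up[OF x] Pper PX unfolding fwd_def by blast
  qed
  have bw: "\<exists>q\<in>X. periodic q \<and> bwd x q" if x: "x \<in> X" for x
  proof (cases "periodic x")
    case True
    then show ?thesis using x bwd_refl by blast
  next
    case False
    then obtain K where "\<forall>k. sh k x \<in> E \<longrightarrow> \<bar>k\<bar> < K" using bounded by blast
    then have "\<forall>k\<le>-K. sh k x \<notin> E" by fastforce
    then show ?thesis using down[OF x] Pper PX unfolding bwd_def by blast
  qed
  have cover: "x \<in> P" if x: "x \<in> X" "\<forall>k. sh k x \<notin> E" for x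
  proof -
    obtain q where q: "q \<in> P" "\<forall>k\<ge>0. x k = q k" using up[OF x(1), of 0] x(2) by blast
    have "x k = q k" for k
    proof -
      obtain p where p: "p \<in> P" "\<forall>j\<ge>k. x j = p j" using up[OF x(1), of k] x(2) by blast
      have "fwd p q" unfolding fwd_def
      proof (intro exI[of _ "max k 0"] allI impI)
        fix j assume "j \<ge> max k 0"
        then show "p j = q j" using p(2) q(2) by (metis max.bounded_iff)
      qed
      then have "p = q" using fwd_per_eq Pper p(1) q(1) by blast
      then show ?thesis using p(2) by simp
    qed
    then have "x = q" by (rule ext)
    then show ?thesis using q(1) by simp
  qed
  have "X = (\<Union>e\<in>E \<union> P. orb e)"
  proof
    show "(\<Union>e\<in>E \<union> P. orb e) \<subseteq> X" using subsh_orb[OF X] EX PX by blast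
    show "X \<subseteq> (\<Union>e\<in>E \<union> P. orb e)"
    proof
      fix x assume x: "x \<in> X"
      show "x \<in> (\<Union>e\<in>E \<union> P. orb e)"
      proof (cases "\<forall>k. sh k x \<notin> E")
        case True
        then have "x \<in> P" by (rule cover[OF x])
        then show ?thesis using orb_self by blast
      next
        case False
        then obtain k where k: "sh k x \<in> E" by blast
        have "x = sh (-k) (sh k x)" by simp
        then have "x \<in> orb (sh k x)" using sh_in_orb by metis
        then show ?thesis using k by blast
      qed
    qed
  qed
  then have "hetsys (E \<union> P) X" 
    unfolding hetsys_def
  proof (intro conjI ballI)
    fix e assume "e \<in> E \<union> P"
    then have "e \<in> X" using EX PX by auto
    then show "\<exists>q\<in>X. periodic q \<and> fwd e q" "\<exists>r\<in>X. periodic r \<and> bwd e r" by (fact fw bw)+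
  qed (use finE finP in auto)
  then show ?thesis by blast
qed

lemma hetsys_fwd_end:
  assumes X: "hetsys E X" and x: "x \<in> X" shows "\<exists>q\<in>X. periodic q \<and> fwd x q"
proof -
  obtain e k where e: "e \<in> E" "x = sh k e" using X x unfolding hetsys_def orb_eq by blast
  obtain q where q: "q \<in> X" "periodic q" "fwd e q" using X e(1) unfolding hetsys_def by blast
  then show ?thesis using hetsys_sh[OF X q(1), of k] fwd_sh[OF q(3), of k] e(2) by (intro bexI[of _ "sh k q"]) auto
qed

lemma hetsys_bwd_end:
  assumes X: "hetsys E X" and x: "x \<in> X" shows "\<exists>q\<in>X. periodic q \<and> bwd x q"
proof -
  obtain e k where e: "e \<in> E" "x = sh k e" using X x unfolding hetsys_def orb_eq by blast
  obtain q where q: "q \<in> X" "periodic q" "bwd e q" using X e(1) unfolding hetsys_def by blast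
  then show ?thesis using hetsys_sh[OF X q(1), of k] bwd_sh[OF q(3), of k] e(2) by (intro bexI[of _ "sh k q"]) auto
qed

subsection \<open>Reversal of time\<close>

text \<open>Reversal respects the undirected edges, so it identifies the graphs of a subshift and of its
  mirror image. This reduces a fixed point at the forward end of an orbit to one at the backward
  end.\<close>

definition reversed :: "(int \<Rightarrow> 'a) \<Rightarrow> (int \<Rightarrow> 'a)" where
  "reversed x = (\<lambda>k. x (- k))"

lemma rv_rv [simp]: "reversed (reversed x) = x"
  by (simp add: reversed_def)

lemma sh_rv: "sh k (reversed x) = reversed (sh (- k) x)"
  by (simp add: reversed_def sh_def algebra_simps)

lemma rv_eq [simp]: "reversed x = reversed y \<longleftrightarrow> x = y"
  by (metis rv_rv)

lemma embeds_rv: "embeds (reversed ` X) X"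
  unfolding embeds_def emb_def
proof (intro exI[of _ reversed] conjI ballI allI impI)
  show "reversed ` reversed ` X \<subseteq> X" by (auto simp: image_image)
  show "inj_on reversed (reversed ` X)" by (auto simp: inj_on_def)
  show "\<exists>M. \<forall>x\<in>reversed ` X. \<forall>y\<in>reversed ` X. agree M x y \<longrightarrow> agree N (reversed x) (reversed y)" for N
    by (intro exI[of _ N]) (simp add: agree_def reversed_def)
  show "reversed (sh 1 x) = sh 1 (reversed x) \<or> reversed (sh 1 x) = sh (-1) (reversed x)" for x :: "int \<Rightarrow> 'a"
    by (simp add: sh_rv)
qed

lemma rv_subsh:
  assumes X: "subsh X" shows "subsh (reversed ` X)"
  unfolding subsh_def
proof (intro conjI ballI allI)
  obtain A where "finite A" "\<forall>x\<in>X. \<forall>k. x k \<in> A" using X unfolding subsh_def by blast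
  then show "\<exists>A. finite A \<and> (\<forall>x\<in>reversed ` X. \<forall>k. x k \<in> A)" by (intro exI[of _ A]) (auto simp: reversed_def)
  show "wclosed (reversed ` X)"
    unfolding wclosed_def
  proof (intro allI impI)
    fix y assume a: "\<forall>N. \<exists>z\<in>reversed ` X. agree N z y"
    have "reversed y \<in> X"
    proof (rule wclosedD[OF subsh_wclosed[OF X]])
      fix N
      obtain z where "z \<in> X" "agree N (reversed z) y" using a by blast
      then show "\<exists>z\<in>X. agree N z (reversed y)"
        by (intro bexI[of _ z]) (simp_all add: agree_def reversed_def, metis abs_minus_cancel minus_minus)
    qed
    then show "y \<in> reversed ` X" by (metis imageI rv_rv)
  qed
  show "sh k x \<in> reversed ` X" if "x \<in> reversed ` X" for x k
  proof -
    obtain z where z: "z \<in> X" "x = reversed z" using \<open>x \<in> reversed ` X\<close> by blast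
    then have "sh k x = reversed (sh (-k) z)" by (simp add: sh_rv)
    then show ?thesis using subsh_sh[OF X z(1)] by blast
  qed
qed

lemma bwd_rv: "fwd x q \<Longrightarrow> bwd (reversed x) (reversed q)"
  unfolding fwd_def bwd_def reversed_def
proof (elim exE)
  fix K assume "\<forall>k\<ge>K. x k = q k"
  then show "\<exists>K. \<forall>k\<le>K. x (- k) = q (- k)" by (intro exI[of _ "- K"]) auto
qed

lemma fwd_rv: "bwd x q \<Longrightarrow> fwd (reversed x) (reversed q)"
  unfolding fwd_def bwd_def reversed_def
proof (elim exE)
  fix K assume "\<forall>k\<le>K. x k = q k"
  then show "\<exists>K. \<forall>k\<ge>K. x (- k) = q (- k)" by (intro exI[of _ "- K"]) auto
qed

section \<open>Below every critical subshift of rank two\<close>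

context symbols
begin

lemma fixed_point_case:
  assumes X: "subsh X" and f: "f \<in> X" "sh 1 f = f" and e: "e \<in> X" "\<not> periodic e" "bwd e f"
    and q: "q \<in> X" "periodic q" "fwd e q"
    and no: "\<And>n. odd n \<Longrightarrow> n \<noteq> 1 \<Longrightarrow> \<not> (\<forall>k. sh k q = q \<longleftrightarrow> int n dvd k)"
  shows "\<exists>n. embeds (nSigma d n) X"
proof -
  obtain n0 where n0: "n0 > 0" "\<forall>k. sh k q = q \<longleftrightarrow> n0 dvd k" using minimal_period[OF q(2)] by blast
  define n where "n = nat n0"
  have n: "n > 0" "\<forall>k. sh k q = q \<longleftrightarrow> int n dvd k" using n0 by (simp_all add: n_def)
  have inv: "sh k x \<in> X" if "x \<in> X" for x k using subsh_sh[OF X that] .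
  show ?thesis
  proof (cases "q = f")
    case True
    have "\<forall>k. sh k q = q \<longleftrightarrow> int (max 1 0) dvd k" using fixed_sh[OF f(2)] True by simp
    then have "embeds (nSigma d 0) X"
      using nSigma_embeds_aux[of 0 X f e q, OF _ inv f e q(1,3)] True by simp
    then show ?thesis by blast
  next
    case False
    have ev: "even n \<or> n = 1" using no[of n] n(2) by blast
    have "max 1 n = n" using n(1) by simp
    then have "\<forall>k. sh k q = q \<longleftrightarrow> int (max 1 n) dvd k" using n(2) by simp
    then have "embeds (nSigma d n) X"
      using nSigma_embeds_aux[of n X f e q, OF ev inv f e q(1,3)] False n(1) by simp
    then show ?thesis by blast
  qed
qed

text \<open>Without an aperiodic orbit asymptotic to it the fixed point would be isolated, which criticality
  excludes.\<close>

lemma critical_fixed_point: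
  fixes X :: "(int \<Rightarrow> 'b) set"
  assumes het: "hetsys E X" and crit: "critical X" and f: "f \<in> X" "sh 1 f = f"
    and no: "\<And>n x. x \<in> X \<Longrightarrow> odd n \<Longrightarrow> n \<noteq> 1 \<Longrightarrow> \<not> (\<forall>k. sh k x = x \<longleftrightarrow> int n dvd k)"
  shows "\<exists>n. embeds (nSigma d n) X"
proof -
  have X: "subsh X" using crit by (simp add: critical_def)
  have "\<exists>e\<in>X. \<not> periodic e \<and> (fwd e f \<or> bwd e f)"
  proof (rule ccontr)
    assume "\<not> ?thesis"
    then have none: "periodic e" if "e \<in> X" "fwd e f \<or> bwd e f" for e using that by blast
    have pf: "periodic f" unfolding periodic_def using f(2) by (intro exI[of _ 1]) simp
    have fs: "sh k f = f" for k using fixed_sh[OF f(2)] .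
    have EX: "e \<in> X" if "e \<in> E" for e using het that orb_self unfolding hetsys_def by blast
    have "wclosed (X - {f})"
    proof (rule hetsys_wclosed[OF het])
      fix e q assume e: "e \<in> E" and q: "q \<in> X" "periodic q" "fwd e q"
      show "\<exists>K. \<forall>k\<ge>K. sh k e \<in> X - {f} \<longrightarrow> sh k q \<in> X - {f}"
      proof (cases "q = f")
        case True
        then have "e = f" using none[OF EX[OF e]] q(3) fwd_per_eq[OF _ pf, of e] by blast
        then show ?thesis using fs by simp
      next
        case False
        then have "sh k q \<noteq> f" for k using fs sh_inject[of k q f] by simp
        then show ?thesis using subsh_sh[OF X q(1)] by blast
      qed
    next
      fix e q assume e: "e \<in> E" and q: "q \<in> X" "periodic q" "bwd e q"
      show "\<exists>K. \<forall>k\<le>K. sh k e \<in> X - {f} \<longrightarrow> sh k q \<in> X - {f}"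
      proof (cases "q = f")
        case True
        then have "e = f" using none[OF EX[OF e]] q(3) bwd_per_eq[OF _ pf, of e] by blast
        then show ?thesis using fs by simp
      next
        case False
        then have "sh k q \<noteq> f" for k using fs sh_inject[of k q f] by simp
        then show ?thesis using subsh_sh[OF X q(1)] by blast
      qed
    qed auto
    moreover have "f \<in> lim_pts X" using critical_nonisolated[OF crit f(1) fs] .
    ultimately show False using wclosed_remove_lim by blast
  qed
  then obtain e where e: "e \<in> X" "\<not> periodic e" "fwd e f \<or> bwd e f" by blast
  show ?thesis
  proof (cases "bwd e f")
    case True
    obtain q where q: "q \<in> X" "periodic q" "fwd e q" using hetsys_fwd_end[OF het e(1)] by blast
    show ?thesis by (rule fixed_point_case[OF X f e(1,2) True q no[OF q(1)]])
  next
    case False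
    then have fw: "fwd e f" using e(3) by blast
    obtain q where q: "q \<in> X" "periodic q" "bwd e q" using hetsys_bwd_end[OF het e(1)] by blast
    have sr: "sh k (reversed x) = reversed x \<longleftrightarrow> sh k x = x" for k and x :: "int \<Rightarrow> 'b"
    proof -
      have "sh k (reversed x) = reversed x \<longleftrightarrow> sh (-k) x = x" by (simp add: sh_rv)
      also have "\<dots> \<longleftrightarrow> sh k x = x" using sh_eq_iff[of "-k" x 0 x] sh_mult[of k x "-1"] sh_mult[of "-k" x "-1"] by auto
      finally show ?thesis .
    qed
    have pr: "periodic (reversed x) \<longleftrightarrow> periodic x" for x :: "int \<Rightarrow> 'b" unfolding periodic_def sr ..
    have "\<exists>n. embeds (nSigma d n) (reversed ` X)"
    proof (rule fixed_point_case[OF rv_subsh[OF X]])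
      show "reversed f \<in> reversed ` X" "reversed e \<in> reversed ` X" "reversed q \<in> reversed ` X" using f(1) e(1) q(1) by auto
      show "sh 1 (reversed f) = reversed f" using f(2) by (simp add: sr)
      show "\<not> periodic (reversed e)" "periodic (reversed q)" using e(2) q(2) by (simp_all add: pr)
      show "bwd (reversed e) (reversed f)" using bwd_rv[OF fw] .
      show "fwd (reversed e) (reversed q)" using fwd_rv[OF q(3)] .
      show "\<not> (\<forall>k. sh k (reversed q) = reversed q \<longleftrightarrow> int n dvd k)" if "odd n" "n \<noteq> 1" for n
        using no[OF q(1) that] by (simp add: sr)
    qed
    then obtain n where "embeds (nSigma d n) (reversed ` X)" ..
    moreover have "subsh (nSigma d n)" for n using nSigma_critical unfolding critical_def by blast
    ultimately show ?thesis using embeds_trans embeds_rv by blast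
  qed
qed

end

subsection \<open>Chains of heteroclinic orbits\<close>

definition linked :: "(int \<Rightarrow> 'a) set \<Rightarrow> (int \<Rightarrow> 'a) \<Rightarrow> (int \<Rightarrow> 'a) \<Rightarrow> bool" where
  "linked X p q \<longleftrightarrow> (\<exists>e\<in>X. bwd e p \<and> fwd e q \<or> bwd e q \<and> fwd e p)"

text \<open>Without fixed points a colouring is constant along a chain, so a chain that ends at an odd shift
  of its beginning is an obstruction. A fixed point is itself such a chain, of length zero.\<close>

definition odd_chain :: "(int \<Rightarrow> 'a) set \<Rightarrow> nat \<Rightarrow> (nat \<Rightarrow> int \<Rightarrow> 'a) \<Rightarrow> int \<Rightarrow> bool" where
  "odd_chain X n v k \<longleftrightarrow> odd k \<and> v n = sh k (v 0) \<and> (\<forall>i\<le>n. v i \<in> X \<and> periodic (v i)) \<and>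
     (\<forall>i<n. linked X (v i) (v (Suc i)))"

lemma linked_sym: "linked X p q \<Longrightarrow> linked X q p"
  unfolding linked_def by blast

lemma linked_sh:
  assumes X: "subsh X" and "linked X p q" shows "linked X (sh k p) (sh k q)"
proof -
  obtain e where "e \<in> X" "bwd e p \<and> fwd e q \<or> bwd e q \<and> fwd e p" using assms(2) unfolding linked_def by blast
  then show ?thesis unfolding linked_def using subsh_sh[OF X] bwd_sh fwd_sh by blast
qed

text \<open>Neither a link nor a shift by two changes the colour in a colouring.\<close>

definition move :: "(int \<Rightarrow> 'a) set \<Rightarrow> ((int \<Rightarrow> 'a) \<times> (int \<Rightarrow> 'a)) set" where
  "move X = {(p, q). p \<in> X \<and> periodic p \<and> q \<in> X \<and> periodic q \<and> (linked X p q \<or> q = sh 2 p \<or> p = sh 2 q)}"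

text \<open>Links are invariant under the shift, so the shifts by two can be collected at the end.\<close>

lemma move_chain:
  assumes X: "subsh X" and p: "p \<in> X" "periodic p" and "(p, q) \<in> (move X)\<^sup>*"
  shows "\<exists>n v s. even s \<and> v 0 = p \<and> v n = sh s q \<and> (\<forall>i\<le>n. v i \<in> X \<and> periodic (v i)) \<and>
     (\<forall>i<n. linked X (v i) (v (Suc i)))"
  using assms(4)
proof (induction rule: rtrancl_induct)
  case base
  show ?case using p by (intro exI[of _ 0] exI[of _ "\<lambda>_. p"] exI[of _ "0::int"]) simp
next
  case (step q r)
  then obtain n :: nat and v and s :: int where v: "even s" "v 0 = p" "v n = sh s q" "\<forall>i\<le>n. v i \<in> X \<and> periodic (v i)"
      "\<forall>i<n. linked X (v i) (v (Suc i))" by blast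
  have r: "r \<in> X" "periodic r" "linked X q r \<or> r = sh 2 q \<or> q = sh 2 r" using step.hyps(2) unfolding move_def by auto
  from r(3) consider "linked X q r" | "r = sh 2 q" | "q = sh 2 r" by blast
  then show ?case
  proof cases
    case 1
    let ?v = "v(Suc n := sh s r)"
    have "linked X (v n) (sh s r)" using linked_sh[OF X 1, of s] v(3) by simp
    then have "\<forall>i<Suc n. linked X (?v i) (?v (Suc i))" using v(5) by (auto simp: less_Suc_eq)
    moreover have "\<forall>i\<le>Suc n. ?v i \<in> X \<and> periodic (?v i)" using v(4) r(1,2) subsh_sh[OF X] by (auto simp: le_Suc_eq)
    ultimately show ?thesis using v(1,2) by (intro exI[of _ "Suc n"] exI[of _ ?v] exI[of _ s]) simp
  next
    case 2
    then have "v n = sh (s - 2) r" using v(3) by simp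
    then show ?thesis using v by (intro exI[of _ n] exI[of _ v] exI[of _ "s - 2"]) simp
  next
    case 3
    then have "v n = sh (s + 2) r" using v(3) by simp
    then show ?thesis using v by (intro exI[of _ n] exI[of _ v] exI[of _ "s + 2"]) simp
  qed
qed

lemma move_sym: "(p, q) \<in> (move X)\<^sup>* \<Longrightarrow> (q, p) \<in> (move X)\<^sup>*"
proof -
  have "sym (move X)" unfolding move_def using linked_sym by (auto simp: sym_def)
  then show "(p, q) \<in> (move X)\<^sup>* \<Longrightarrow> (q, p) \<in> (move X)\<^sup>*" using sym_rtrancl by (metis symD)
qed

lemma move_sh:
  assumes X: "subsh X" and "(p, q) \<in> (move X)\<^sup>*" shows "(sh k p, sh k q) \<in> (move X)\<^sup>*"
  using assms(2)
proof (induction rule: rtrancl_induct)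
  case (step q r)
  have "(sh k q, sh k r) \<in> move X"
    using step.hyps(2) linked_sh[OF X] subsh_sh[OF X] unfolding move_def by (auto simp: add.commute)
  then show ?case using step.IH by simp
qed simp

text \<open>If no odd chain exists, the equivalence generated by links and double shifts never
  identifies a periodic point with its shift, so one of the two classes can be chosen for each
  such pair, and the colours of the periodic points determine the remaining ones.\<close>

lemma no_odd_chain_colorable:
  assumes het: "hetsys E X" and no: "\<And>n v k. \<not> odd_chain X n v k"
  shows "colorable X"
proof -
  have X: "subsh X" by (rule hetsys_subsh[OF het])
  define cl where "cl p = {q. (p, q) \<in> (move X)\<^sup>*}" for p
  have cl_eq: "cl p = cl q" if "(p, q) \<in> (move X)\<^sup>*" for p q
    using that move_sym[OF that] unfolding cl_def by (auto intro: rtrancl_trans)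
  have cl_ne: "cl (sh 1 p) \<noteq> cl p" if p: "p \<in> X" "periodic p" for p
  proof
    assume eq: "cl (sh 1 p) = cl p"
    have "sh 1 p \<in> cl (sh 1 p)" unfolding cl_def by simp
    then have "sh 1 p \<in> cl p" unfolding eq .
    then have "(p, sh 1 p) \<in> (move X)\<^sup>*" unfolding cl_def by simp
    from move_chain[OF X p this] obtain n v s where "even s \<and> v 0 = p \<and> v n = sh s (sh 1 p) \<and>
        (\<forall>i\<le>n. v i \<in> X \<and> periodic (v i)) \<and> (\<forall>i<n. linked X (v i) (v (Suc i)))"
      by (elim exE) (rule that)
    then have "odd_chain X n v (s + 1)" unfolding odd_chain_def by simp
    then show False using no by blast
  qed
  define c0 where "c0 p \<longleftrightarrow> cl p = (SOME C. C \<in> {cl p, cl (sh 1 p)})" for p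
  have c0_sh: "c0 (sh 1 p) \<noteq> c0 p" if p: "p \<in> X" "periodic p" for p
  proof -
    have "(p, sh 2 p) \<in> move X" using p subsh_sh[OF X] unfolding move_def by auto
    then have 2: "cl (sh 1 (sh 1 p)) = cl p" using cl_eq[of p "sh 2 p"] by auto
    have set: "{cl (sh 1 p), cl (sh 1 (sh 1 p))} = {cl p, cl (sh 1 p)}" unfolding 2 by auto
    have "(SOME C. C \<in> {cl p, cl (sh 1 p)}) \<in> {cl p, cl (sh 1 p)}" by (rule someI[of _ "cl p"]) simp
    then show ?thesis unfolding c0_def set using cl_ne[OF p] by auto
  qed
  have c0_move: "c0 p = c0 q" if "(p, q) \<in> (move X)\<^sup>*" for p q
    unfolding c0_def using cl_eq[OF that] cl_eq[OF move_sh[OF X that, of 1]] by simp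
  define fe where "fe x = (SOME q. q \<in> X \<and> periodic q \<and> fwd x q)" for x
  have fe: "fe x \<in> X \<and> periodic (fe x) \<and> fwd x (fe x)" if "x \<in> X" for x
    using someI_ex[of "\<lambda>q. q \<in> X \<and> periodic q \<and> fwd x q"] hetsys_fwd_end[OF het that] unfolding fe_def by blast
  have fe_eq: "fe x = q" if "x \<in> X" "periodic q" "fwd x q" for x q
    using fwd_unique[of x "fe x" q] fe[OF that(1)] that(2,3) by blast
  have fe_sh: "fe (sh k x) = sh k (fe x)" if "x \<in> X" for x k
    using fe_eq[OF subsh_sh[OF X that], of "sh k (fe x)" k] fe[OF that] fwd_sh[of x "fe x" k] by simp
  have fe_per: "fe q = q" if "q \<in> X" "periodic q" for q using fe_eq[OF that] by simp
  define c where "c x = c0 (fe x)" for x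
  have EX: "e \<in> X" if "e \<in> E" for e using het that orb_self unfolding hetsys_def by blast
  have closed: "wclosed {x\<in>X. c x = t}" for t
  proof (rule hetsys_wclosed[OF het])
    fix e q assume e: "e \<in> E" and q: "q \<in> X" "periodic q" "fwd e q"
    have "c (sh k q) = c (sh k e)" for k
      unfolding c_def fe_sh[OF EX[OF e]] fe_sh[OF q(1)] fe_per[OF q(1,2)] fe_eq[OF EX[OF e] q(2,3)] ..
    then show "\<exists>K. \<forall>k\<ge>K. sh k e \<in> {x\<in>X. c x = t} \<longrightarrow> sh k q \<in> {x\<in>X. c x = t}"
      using subsh_sh[OF X q(1)] by auto
  next
    fix e q assume e: "e \<in> E" and q: "q \<in> X" "periodic q" "bwd e q"
    note f = fe[OF EX[OF e]]
    have "linked X q (fe e)" unfolding linked_def using EX[OF e] q(3) f by blast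
    then have "(q, fe e) \<in> (move X)\<^sup>*" using q f unfolding move_def by auto
    then have "(sh k q, sh k (fe e)) \<in> (move X)\<^sup>*" for k by (rule move_sh[OF X])
    then have "c (sh k q) = c (sh k e)" for k
      unfolding c_def fe_sh[OF EX[OF e]] fe_sh[OF q(1)] fe_per[OF q(1,2)] by (rule c0_move)
    then show "\<exists>K. \<forall>k\<le>K. sh k e \<in> {x\<in>X. c x = t} \<longrightarrow> sh k q \<in> {x\<in>X. c x = t}"
      using subsh_sh[OF X q(1)] by auto
  qed auto
  have "\<exists>M. \<forall>y\<in>X. agree M x y \<longrightarrow> c x = c y" if x: "x \<in> X" for x
  proof (rule ccontr)
    assume a: "\<not> ?thesis"
    have "\<exists>y\<in>{y\<in>X. c y = (\<not> c x)}. agree N y x" for N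
    proof -
      obtain y where "y \<in> X" "agree N x y" "c x \<noteq> c y" using a by blast
      then show ?thesis using agree_sym[of N x y] by auto
    qed
    then have "x \<in> {y\<in>X. c y = (\<not> c x)}" by (rule wclosedD[OF closed])
    then show False by simp
  qed
  then obtain M where M: "\<forall>x\<in>X. \<forall>y\<in>X. agree M x y \<longrightarrow> c x = c y"
    using subsh_uniform[OF X, of c] by blast
  have "c (sh 1 x) \<noteq> c x" if "x \<in> X" for x
    unfolding c_def fe_sh[OF that] using c0_sh fe[OF that] by blast
  then show ?thesis unfolding colorable_def using M by blast
qed

text \<open>In the tuples the closing orbit always points forward. If the last link of the chain points
  backward, the chain is run through in reverse, starting at the other end of that link.\<close>

lemma odd_chain_forward_end:
  assumes X: "subsh X" and ch: "odd_chain X n v k" and n: "n > 0"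
  shows "\<exists>v k. odd_chain X n v k \<and> (\<exists>e\<in>X. bwd e (v (n - 1)) \<and> fwd e (v n))"
proof -
  have v: "odd k" "v n = sh k (v 0)" "\<forall>i\<le>n. v i \<in> X \<and> periodic (v i)" "\<forall>i<n. linked X (v i) (v (Suc i))"
    using ch unfolding odd_chain_def by auto
  have "linked X (v (n - 1)) (v n)" using v(4)[rule_format, of "n - 1"] n by simp
  then obtain e where e: "e \<in> X" "bwd e (v (n - 1)) \<and> fwd e (v n) \<or> bwd e (v n) \<and> fwd e (v (n - 1))"
    unfolding linked_def by blast
  show ?thesis
  proof (cases "bwd e (v (n - 1)) \<and> fwd e (v n)")
    case True
    then show ?thesis using ch e(1) by blast
  next
    case False
    then have b: "bwd e (v n)" "fwd e (v (n - 1))" using e(2) by auto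
    define u where "u i = (if i < n then v (n - 1 - i) else sh (- k) (v (n - 1)))" for i
    have u0: "u 0 = v (n - 1)" "u (n - 1) = v 0" "u n = sh (- k) (v (n - 1))" using n by (simp_all add: u_def)
    have "bwd (sh (- k) e) (u (n - 1))" using bwd_sh[OF b(1), of "- k"] unfolding u0 v(2) by simp
    moreover have "fwd (sh (- k) e) (u n)" using fwd_sh[OF b(2), of "- k"] unfolding u0 .
    moreover have "sh (- k) e \<in> X" using subsh_sh[OF X e(1)] .
    ultimately have last: "\<exists>e\<in>X. bwd e (u (n - 1)) \<and> fwd e (u n)" by blast
    have "linked X (u i) (u (Suc i))" if i: "i < n" for i
    proof (cases "Suc i < n")
      case True
      have "linked X (v (n - 1 - Suc i)) (v (Suc (n - 1 - Suc i)))" using v(4) True by auto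
      moreover have "Suc (n - 1 - Suc i) = n - 1 - i" using True by simp
      ultimately show ?thesis using linked_sym True by (simp add: u_def)
    next
      case False
      then have "Suc i = n" "i = n - 1" using i by auto
      then show ?thesis using last unfolding linked_def by auto
    qed
    moreover have "u i \<in> X \<and> periodic (u i)" for i using v(3) subsh_sh[OF X] by (simp add: u_def)
    ultimately have "odd_chain X n u (- k)" unfolding odd_chain_def using v(1) u0 by simp
    then show ?thesis using last by blast
  qed
qed

text \<open>In a shortest odd chain the orbits are pairwise distinct: a repetition up to an odd shift
  would be a shorter odd chain, and one up to an even shift could be cut out.\<close>

lemma shortest_odd_chain_distinct:
  assumes X: "subsh X" and ch: "odd_chain X n v k" and min: "\<And>n' v k. n' < n \<Longrightarrow> \<not> odd_chain X n' v k"
    and ij: "i < j" "j \<le> n" "i \<noteq> 0 \<or> j \<noteq> n"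
  shows "v j \<noteq> sh s (v i)"
proof
  assume eq: "v j = sh s (v i)"
  have v: "odd k" "v n = sh k (v 0)" "\<forall>i\<le>n. v i \<in> X \<and> periodic (v i)" "\<forall>i<n. linked X (v i) (v (Suc i))"
    using ch unfolding odd_chain_def by auto
  show False
  proof (cases "odd s")
    case True
    have "odd_chain X (j - i) (\<lambda>t. v (i + t)) s"
      unfolding odd_chain_def using True eq v(3,4) ij by auto
    moreover have "j - i < n" using ij by auto
    ultimately show False using min by blast
  next
    case False
    define u where "u t = (if t \<le> i then v t else sh (- s) (v (t + (j - i))))" for t
    have ui: "u i = sh (- s) (v j)" using eq by (simp add: u_def)
    have "odd_chain X (n - (j - i)) u (k - s)"
      unfolding odd_chain_def
    proof (intro conjI allI impI)
      show "odd (k - s)" using v(1) False by simp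
      show "u (n - (j - i)) = sh (k - s) (u 0)"
      proof (cases "j = n")
        case True
        then have "n - (j - i) = i" using ij by simp
        then show ?thesis using ui v(2) True by (simp add: u_def)
      next
        case False
        then have "n - (j - i) > i" "n - (j - i) + (j - i) = n" using ij by auto
        then show ?thesis using v(2) by (simp add: u_def)
      qed
      fix t
      show "u t \<in> X" "periodic (u t)" if "t \<le> n - (j - i)"
        using v(3) subsh_sh[OF X] that ij by (auto simp: u_def)
      show "linked X (u t) (u (Suc t))" if t: "t < n - (j - i)"
      proof (cases "t < i")
        case True
        then show ?thesis using v(4) ij by (simp add: u_def)
      next
        case False
        have ut: "u t = sh (- s) (v (t + (j - i)))"
        proof (cases "t = i")
          case True
          then show ?thesis using ui ij by simp
        qed (use False in \<open>simp add: u_def\<close>)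
        have "u (Suc t) = sh (- s) (v (Suc (t + (j - i))))" using False by (simp add: u_def)
        moreover have "linked X (v (t + (j - i))) (v (Suc (t + (j - i))))" using v(4) t by auto
        ultimately show ?thesis using linked_sh[OF X] ut by simp
      qed
    qed
    moreover have "n - (j - i) < n" using ij by auto
    ultimately show False using min by blast
  qed
qed

context symbols
begin

text \<open>The periods along a shortest odd chain, the phase at its end and the directions of its links are
  the tuple. That the chain is shortest makes its cycles distinct; distinctness of the connecting
  orbits follows.\<close>

lemma odd_chain_embeds:
  assumes X: "subsh X" and ev: "\<And>x k. x \<in> X \<Longrightarrow> periodic x \<Longrightarrow> sh k x = x \<Longrightarrow> even k"
    and ex: "\<exists>n v k. odd_chain X n v k"
  shows "\<exists>p\<in>Ptuples. embeds (pSigma a b p) X"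
proof -
  define n where "n = (LEAST n. \<exists>v k. odd_chain X n v k)"
  have exn: "\<exists>v k. odd_chain X n v k" unfolding n_def by (rule LeastI_ex) (rule ex)
  have min: "\<not> odd_chain X n' v k" if "n' < n" for n' v k
    using not_less_Least[of n' "\<lambda>n. \<exists>v k. odd_chain X n v k"] that unfolding n_def by blast
  \<comment> \<open>A chain of length zero is a point with an odd period.\<close>
  have n0: "n > 0"
  proof (rule ccontr)
    assume "\<not> n > 0"
    then obtain v k where "odd_chain X 0 v k" using exn by auto
    then have "odd k" "v 0 = sh k (v 0)" "v 0 \<in> X" "periodic (v 0)" unfolding odd_chain_def by auto
    then show False using ev[of "v 0" k] by simp
  qed
  obtain v k where ch: "odd_chain X n v k" and last: "\<exists>e\<in>X. bwd e (v (n - 1)) \<and> fwd e (v n)"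
    using odd_chain_forward_end[OF X _ n0] exn by blast
  have v: "odd k" "v n = sh k (v 0)" "\<forall>i\<le>n. v i \<in> X \<and> periodic (v i)" "\<forall>i<n. linked X (v i) (v (Suc i))"
    using ch unfolding odd_chain_def by auto
  have dist: "v j \<noteq> sh s (v i)" if "i < j" "j \<le> n" "i \<noteq> 0 \<or> j \<noteq> n" for i j s
    by (rule shortest_odd_chain_distinct[OF X ch min that])
  have "\<forall>i. \<exists>p::nat. i \<le> n \<longrightarrow> p > 0 \<and> (\<forall>k. sh k (v i) = v i \<longleftrightarrow> int p dvd k)"
  proof
    fix i
    show "\<exists>p::nat. i \<le> n \<longrightarrow> p > 0 \<and> (\<forall>k. sh k (v i) = v i \<longleftrightarrow> int p dvd k)"
    proof (cases "i \<le> n")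
      case True
      then have "periodic (v i)" using v(3) by blast
      then obtain p where "p > 0" "\<forall>k. sh k (v i) = v i \<longleftrightarrow> p dvd k" by (rule minimal_period)
      then show ?thesis by (intro exI[of _ "nat p"]) simp
    qed simp
  qed
  from choice[OF this] obtain \<pi> :: "nat \<Rightarrow> nat" where
    \<pi>: "\<forall>i. i \<le> n \<longrightarrow> \<pi> i > 0 \<and> (\<forall>k. sh k (v i) = v i \<longleftrightarrow> int (\<pi> i) dvd k)" ..
  have \<pi>_even: "even (\<pi> i)" if i: "i \<le> n" for i
  proof -
    have "sh (int (\<pi> i)) (v i) = v i" using \<pi> i by simp
    then have "even (int (\<pi> i))" using ev v(3) i by blast
    then show ?thesis by simp
  qed
  define l where "l = n - 1"
  define lam where "lam = map \<pi> [0..<n]"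
  \<comment> \<open>Reduction modulo the even period \<open>\<pi> 0\<close> keeps the phase odd.\<close>
  define m where "m = nat ((- k) mod int (\<pi> 0))"
  define ori where "ori i \<longleftrightarrow> (\<exists>e\<in>X. bwd e (v i) \<and> fwd e (v (Suc i)))" for i
  define eps where "eps = map (\<lambda>i. if ori i then 0 else 1 :: nat) [0..<l]"
  have nl: "n = Suc l" using n0 by (simp add: l_def)
  have lam: "lam ! i = \<pi> i" if "i \<le> l" for i using that nl unfolding lam_def by (simp del: upt_Suc)
  have \<pi>0: "\<pi> 0 > 0" "even (\<pi> 0)" using \<pi> \<pi>_even by auto
  have m_int: "int m = (- k) mod int (\<pi> 0)" unfolding m_def using \<pi>0(1) by simp
  have m_odd: "odd m"
  proof -
    have "even (int m) \<longleftrightarrow> even (- k)" unfolding m_int using \<pi>0(2) by (simp add: dvd_mod_iff)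
    then show ?thesis using v(1) by simp
  qed
  have m_less: "m < \<pi> 0"
  proof -
    have "int m < int (\<pi> 0)" unfolding m_int using \<pi>0(1) by simp
    then show ?thesis by simp
  qed
  have P: "(l, lam, m, eps) \<in> Ptuples"
    unfolding Ptuples_def mem_Collect_eq prod.case
  proof (intro conjI allI impI)
    show "length lam = l + 1" "length eps = l" by (simp_all add: lam_def eps_def nl)
    show "set eps \<subseteq> {0, 1}" by (auto simp: eps_def)
    show "0 < lam ! i" "even (lam ! i)" if "i \<le> l" for i using lam[OF that] \<pi> \<pi>_even that nl by auto
    show "m < lam ! 0" using lam[of 0] m_less by simp
  qed (rule m_odd)
  interpret pt: ptuple d a b l lam m eps by unfold_locales (rule P)
  have eps_i: "eps ! i = (if ori i then 0 else 1)" if "i < l" for i using that by (simp add: eps_def)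
  have vl: "v l \<in> X" "n - 1 = l" using v(3) nl by auto
  have gap_word: "v n = sh (- int m) (v 0)"
  proof -
    have "int (\<pi> 0) dvd k + int m" unfolding m_int by (metis add.commute diff_minus_eq_add dvd_minus_mod dvd_diff_commute)
    then have "sh (k + int m) (v 0) = v 0" using \<pi> by simp
    then show ?thesis unfolding v(2) by (simp add: sh_eq_iff)
  qed
  have "\<forall>i. \<exists>e. i \<le> l \<longrightarrow> e \<in> X \<and> bwd e (v (pt.st i)) \<and> fwd e (sh (if i < l then 0 else - int m) (v (pt.tg i)))"
  proof
    fix i
    show "\<exists>e. i \<le> l \<longrightarrow> e \<in> X \<and> bwd e (v (pt.st i)) \<and> fwd e (sh (if i < l then 0 else - int m) (v (pt.tg i)))"
    proof (cases "i < l")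
      case True
      show ?thesis
      proof (cases "ori i")
        case o: True
        then have "pt.st i = i" "pt.tg i = Suc i" using True by (simp_all add: pt.st_def pt.tg_def eps_i)
        then show ?thesis using o True unfolding ori_def by auto
      next
        case o: False
        then have s: "pt.st i = Suc i" "pt.tg i = i" using True by (simp_all add: pt.st_def pt.tg_def eps_i)
        have "linked X (v i) (v (Suc i))" using v(4) True nl by simp
        then obtain e where "e \<in> X" "bwd e (v (Suc i)) \<and> fwd e (v i)"
          using o unfolding linked_def ori_def by blast
        then show ?thesis using s True by auto
      qed
    next
      case False
      then have s: "i \<le> l \<longrightarrow> i = l" "pt.st l = l" "pt.tg l = 0" by (simp_all add: pt.st_def pt.tg_def)
      obtain e where "e \<in> X" "bwd e (v l)" "fwd e (sh (- int m) (v 0))" using last vl(2) gap_word by auto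
      then show ?thesis using s False by (intro exI[of _ e]) auto
    qed
  qed
  from choice[OF this] obtain e where
    e: "\<forall>i. i \<le> l \<longrightarrow> e i \<in> X \<and> bwd (e i) (v (pt.st i)) \<and> fwd (e i) (sh (if i < l then 0 else - int m) (v (pt.tg i)))" ..
  have pv: "periodic (v i)" if "i \<le> l" for i using v(3) that nl by simp
  have dv: "i = j" if ij: "i \<le> l" "j \<le> l" "sh s (v i) = v j" for i j s
  proof (rule ccontr)
    assume "i \<noteq> j"
    then consider "i < j" | "j < i" by linarith
    then show False
    proof cases
      case 1
      then show False using dist[of i j s] ij nl by auto
    next
      case 2
      have "v i = sh (- s) (v j)" using ij(3) by (metis add.left_inverse sh_0 sh_sh)
      then show False using dist[of j i "- s"] 2 ij nl by auto
    qed
  qed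
  have np: "\<not> periodic (e i)" if i: "i \<le> l" for i
  proof
    assume p: "periodic (e i)"
    have 1: "e i = v (pt.st i)" using bwd_per_eq[OF p pv[OF pt.st_le[OF i]]] e i by blast
    have 2: "e i = sh (if i < l then 0 else - int m) (v (pt.tg i))"
      using fwd_per_eq[OF p, of "sh (if i < l then 0 else - int m) (v (pt.tg i))"] pv[OF pt.tg_le[OF i]] e i by simp
    show False
    proof (cases "i < l")
      case True
      then have "v (pt.st i) = v (pt.tg i)" using 1 2 by simp
      then have "pt.st i = pt.tg i" using dv[OF pt.st_le[OF i] pt.tg_le[OF i], of 0] by simp
      then show False using pt.st_tg[OF True] by auto
    next
      case False
      then have il: "i = l" using i by simp
      then have "sh (- int m) (v 0) = v l" using 1 2 by (simp add: pt.st_def pt.tg_def)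
      then have "0 = l" "sh (- int m) (v 0) = v l" using dv[of 0 l "- int m"] by auto
      then have "even (- int m)" using ev[of "v 0" "- int m"] v(3) by auto
      then show False using m_odd by simp
    qed
  qed
  \<comment> \<open>Connecting orbits that coincide share both cycles. Two different links do so only if they are
    the only ones and the second closes the chain; then \<open>s\<close> and \<open>s + m\<close> are periods, one of them odd.\<close>
  have de_less: False if ij: "i < j" "j \<le> l" "sh s (e i) = e j" for i j s
  proof -
    have i: "i < l" "i \<le> l" using ij by auto
    have "bwd (e j) (sh s (v (pt.st i)))" using bwd_sh[of "e i" "v (pt.st i)" s] e i(2) ij(3) by simp
    then have "sh s (v (pt.st i)) = v (pt.st j)"
      using bwd_unique[of "e j" "sh s (v (pt.st i))" "v (pt.st j)"] e ij(2) pv[OF pt.st_le[OF i(2)]] pv[OF pt.st_le[OF ij(2)]] by simp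
    then have s0: "sh s (v (pt.st i)) = v (pt.st j)" .
    have st: "pt.st i = pt.st j" by (rule dv[OF pt.st_le[OF i(2)] pt.st_le[OF ij(2)] s0])
    then have s1: "pt.st i = pt.st j" "sh s (v (pt.st i)) = v (pt.st i)" using s0 by simp_all
    have "fwd (e i) (v (pt.tg i))" using e[rule_format, OF i(2)] i(1) by simp
    from fwd_sh[OF this, of s] have "fwd (e j) (sh s (v (pt.tg i)))" unfolding ij(3) .
    then have s2: "sh s (v (pt.tg i)) = sh (if j < l then 0 else - int m) (v (pt.tg j))"
      using fwd_unique[of "e j" "sh s (v (pt.tg i))" "sh (if j < l then 0 else - int m) (v (pt.tg j))"]
        e ij(2) pv[OF pt.tg_le[OF i(2)]] pv[OF pt.tg_le[OF ij(2)]] by simp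
    then have s3: "sh (s - (if j < l then 0 else - int m)) (v (pt.tg i)) = v (pt.tg j)" by (simp only: sh_eq_iff)
    then have s4: "pt.tg i = pt.tg j" using dv[OF pt.tg_le[OF i(2)] pt.tg_le[OF ij(2)]] by blast
    show False
    proof (cases "j < l")
      case True
      then show False using s1(1) s4 pt.st_tg[OF i(1)] pt.st_tg[OF True] ij(1) by auto
    next
      case False
      then have "j = l" using ij(2) by simp
      then have "pt.st i = l" "pt.tg i = 0" using s1(1) s4 by (simp_all add: pt.st_def pt.tg_def)
      have "even s" using ev[of "v (pt.st i)" s] s1(2) v(3) pt.st_le[OF i(2)] nl by auto
      moreover have "even (s + int m)"
        using ev[of "v (pt.tg i)" "s + int m"] s3 s4 False v(3) pt.tg_le[OF i(2)] nl by auto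
      ultimately show False using m_odd by simp
    qed
  qed
  have de: "i = j" if ij: "i \<le> l" "j \<le> l" "sh s (e i) = e j" for i j s
  proof (rule ccontr)
    assume "i \<noteq> j"
    then consider "i < j" | "j < i" by linarith
    then show False
    proof cases
      case 1
      then show False using de_less ij by blast
    next
      case 2
      have "sh (- s) (e j) = e i" using ij(3) by (metis add.left_inverse sh_0 sh_sh)
      then show False using de_less[OF 2 ij(1)] by blast
    qed
  qed
  have "hetsys (pt.pt ` pt.ix) (pSigma a b (l, lam, m, eps)) \<and> embeds (pSigma a b (l, lam, m, eps)) X"
  proof (rule pt.pSigma_embeds_aux[where v = v and e = e])
    show "sh k x \<in> X" if "x \<in> X" for x k using subsh_sh[OF X that] .
    show "v i \<in> X" if "i \<le> l" for i using v(3) that nl by simp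
    show "sh k (v i) = v i \<longleftrightarrow> int (lam ! i) dvd k" if "i \<le> l" for i k using \<pi> lam[OF that] that nl by simp
    show "e i \<in> X" "bwd (e i) (v (pt.st i))" "fwd (e i) (sh (if i < l then 0 else - int m) (v (pt.tg i)))"
      if "i \<le> l" for i using e that by blast+
    show "\<not> periodic (e i)" if "i \<le> l" for i by (rule np[OF that])
    show "i = j" if "i \<le> l" "j \<le> l" "sh s (v i) = v j" for i j s by (rule dv[OF that])
    show "i = j" if "i \<le> l" "j \<le> l" "sh s (e i) = e j" for i j s by (rule de[OF that])
  qed
  then show ?thesis using P by blast
qed

text \<open>An orbit of odd length greater than one already contains one of the odd cycles. Without such
  orbits a fixed point leads to one of the other \<open>nSigma\<close>; without fixed points all
  periods are even, and only odd chains are left as obstructions.\<close>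

lemma critical_rank_two:
  assumes het: "hetsys E X" and crit: "critical X"
  shows "(\<exists>n. embeds (nSigma d n) X) \<or> (\<exists>p\<in>Ptuples. embeds (pSigma a b p) X)"
proof -
  have X: "subsh X" and nc: "\<not> colorable X" using crit by (simp_all add: critical_def)
  show ?thesis
  proof (cases "\<exists>x\<in>X. \<exists>n. odd n \<and> n \<noteq> 1 \<and> (\<forall>k. sh k x = x \<longleftrightarrow> int n dvd k)")
    case True
    then obtain x n where x: "x \<in> X" "odd n" "n \<noteq> 1" "\<forall>k. sh k x = x \<longleftrightarrow> int n dvd k" by blast
    then show ?thesis using nSigma_odd_embeds[OF x(2,3) subsh_sh[OF X x(1)] x(4)] by blast
  next
    case noodd: False
    then have no: "\<not> (\<forall>k. sh k x = x \<longleftrightarrow> int n dvd k)" if "x \<in> X" "odd n" "n \<noteq> 1" for n x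
      using that by blast
    show ?thesis
    proof (cases "\<exists>f\<in>X. sh 1 f = f")
      case True
      then obtain f where "f \<in> X" "sh 1 f = f" by blast
      then show ?thesis using critical_fixed_point[OF het crit _ _ no] by blast
    next
      case False
      have ev: "even k" if x: "x \<in> X" "periodic x" "sh k x = x" for x k
      proof -
        obtain n0 where n0: "n0 > 0" "\<forall>k. sh k x = x \<longleftrightarrow> n0 dvd k" using x(2) by (rule minimal_period)
        have 1: "\<forall>k. sh k x = x \<longleftrightarrow> int (nat n0) dvd k" using n0 by simp
        have "nat n0 \<noteq> 1"
        proof
          assume "nat n0 = 1"
          then have "sh 1 x = x" using 1 by simp
          then show False using False x(1) by blast
        qed
        then have "even (nat n0)" using no[OF x(1)] 1 by blast
        then have "even n0" using n0(1) by (simp add: even_nat_iff)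
        moreover have "n0 dvd k" using n0(2) x(3) by blast
        ultimately show ?thesis by (rule dvd_trans)
      qed
      have ex: "\<exists>n v k. odd_chain X n v k" using no_odd_chain_colorable[OF het] nc by blast
      have "\<exists>p\<in>Ptuples. embeds (pSigma a b p) X"
        by (rule odd_chain_embeds[OF X _ ex]) (fact ev)
      then show ?thesis ..
    qed
  qed
qed

end

section \<open>Cantor-Bendixson rank\<close>

lemma derived_set_subshift: "subshift_topology S derived_set_of S = lim_pts S"
proof
  show "subshift_topology S derived_set_of S \<subseteq> lim_pts S"
  proof
    fix x assume "x \<in> subshift_topology S derived_set_of S"
    then have x: "x \<in> S" and d: "\<And>T. x \<in> T \<Longrightarrow> openin (subshift_topology S) T \<Longrightarrow> \<exists>y\<noteq>x. y \<in> S \<and> y \<in> T"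
      unfolding in_derived_set_of by auto
    have "\<exists>y\<in>S. y \<noteq> x \<and> agree N x y" for N
    proof -
      have "openin (subshift_topology S) {y\<in>S. agree N x y}"
        unfolding openin_subshift_iff by (auto intro: agree_trans)
      then show ?thesis using d[of "{y\<in>S. agree N x y}"] x by auto
    qed
    then show "x \<in> lim_pts S" using x unfolding lim_pts_def by blast
  qed
  show "lim_pts S \<subseteq> subshift_topology S derived_set_of S"
  proof
    fix x assume x: "x \<in> lim_pts S"
    then have xS: "x \<in> S" using lim_pts_subset by blast
    show "x \<in> subshift_topology S derived_set_of S"
      unfolding in_derived_set_of
    proof (intro conjI allI impI)
      show "x \<in> topspace (subshift_topology S)" using xS by simp
      fix T assume T: "x \<in> T \<and> openin (subshift_topology S) T"
      then obtain N where N: "\<forall>y\<in>S. agree N x y \<longrightarrow> y \<in> T" unfolding openin_subshift_iff by auto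
      obtain y where "y \<in> S" "y \<noteq> x" "agree N x y" using lim_ptsD[OF x] by blast
      then show "\<exists>y\<noteq>x. y \<in> S \<and> y \<in> T" using N by auto
    qed
  qed
qed

lemma omega1_cases:
  obtains "(\<alpha> :: omega1) = 0" | \<beta> where "\<alpha> = osuc \<beta>" | "\<alpha> \<noteq> 0" "\<nexists>\<beta>. \<alpha> = osuc \<beta>"
  by blast

lemma le_osuc_iff: "\<alpha> \<le> osuc \<beta> \<longleftrightarrow> \<alpha> = osuc \<beta> \<or> \<alpha> \<le> \<beta>"
  by (metis leD leI less_osuc less_imp_le order.trans osuc_le order_refl order.not_eq_order_implies_strict)

lemma cb_deriv_antimono: "\<alpha> \<le> \<beta> \<Longrightarrow> cb_deriv T \<beta> \<subseteq> cb_deriv T \<alpha>"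
proof (induction \<beta> rule: less_induct)
  case (less \<beta>)
  show ?case
  proof (cases \<beta> rule: omega1_cases)
    case 1
    then show ?thesis using less.prems zero_le_omega1[of \<alpha>] by (metis order_refl order.antisym)
  next
    case (2 \<gamma>)
    have "cb_deriv T \<beta> \<subseteq> cb_deriv T \<gamma>"
      unfolding 2 cb_deriv_osuc using derived_set_of_subset_topspace[of "subtopology T (cb_deriv T \<gamma>)"] by force
    moreover have "\<gamma> < \<beta>" unfolding 2 by (rule less_osuc)
    ultimately show ?thesis using less.IH[of \<gamma>] less.prems unfolding 2 le_osuc_iff by blast
  next
    case 3
    show ?thesis
    proof (cases "\<alpha> = \<beta>")
      case False
      then have "\<alpha> < \<beta>" using less.prems by simp
      then show ?thesis unfolding cb_deriv_limit[OF 3] by blast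
    qed simp
  qed
qed

lemma cb_deriv_subset_topspace: "cb_deriv T \<alpha> \<subseteq> topspace T"
  using cb_deriv_antimono[OF zero_le_omega1] cb_deriv_0 by metis

lemma cb_deriv_stable:
  assumes s: "cb_deriv T (osuc \<alpha>) = cb_deriv T \<alpha>"
  shows "\<alpha> \<le> \<beta> \<Longrightarrow> cb_deriv T \<beta> = cb_deriv T \<alpha>"
proof (induction \<beta> rule: less_induct)
  case (less \<beta>)
  show ?case
  proof (cases "\<alpha> = \<beta>")
    case False
    then have lt: "\<alpha> < \<beta>" using less.prems by simp
    show ?thesis
    proof (cases \<beta> rule: omega1_cases)
      case 1
      then show ?thesis using lt zero_le_omega1[of \<alpha>] by (simp add: leD)
    next
      case (2 \<gamma>)
      have "\<alpha> \<le> \<gamma>" using lt unfolding 2 by (metis leI leD osuc_le)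
      then have "cb_deriv T \<gamma> = cb_deriv T \<alpha>" using less.IH[of \<gamma>] less_osuc 2 by simp
      then show ?thesis using s unfolding 2 cb_deriv_osuc by simp
    next
      case 3
      have "cb_deriv T \<alpha> \<subseteq> cb_deriv T \<gamma>" if "\<gamma> < \<beta>" for \<gamma>
      proof (cases "\<alpha> \<le> \<gamma>")
        case True
        then show ?thesis using less.IH[OF that] by simp
      next
        case False
        then show ?thesis using cb_deriv_antimono[of \<gamma> \<alpha> T] by simp
      qed
      then have "cb_deriv T \<alpha> \<subseteq> cb_deriv T \<beta>" unfolding cb_deriv_limit[OF 3] by blast
      then show ?thesis using cb_deriv_antimono[OF less.prems, of T] by blast
    qed
  qed simp
qed

lemma cb_rank_le: "cb_deriv T (osuc \<alpha>) = cb_deriv T \<alpha> \<Longrightarrow> cb_rank T \<le> \<alpha>"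
  unfolding cb_rank_def using cb_deriv_stable by (intro Least_le) blast

lemma cb_rank_le_empty: "cb_deriv T \<alpha> = {} \<Longrightarrow> cb_rank T \<le> \<alpha>"
  by (rule cb_rank_le) (simp add: cb_deriv_osuc)

text \<open>Derivatives that shrink at every countable ordinal would lose uncountably many points.\<close>

lemma cb_deriv_cb_rank:
  assumes "countable (topspace T)"
  shows "cb_deriv T (osuc (cb_rank T)) = cb_deriv T (cb_rank T)"
proof -
  have "\<exists>\<alpha>. cb_deriv T (osuc \<alpha>) = cb_deriv T \<alpha>"
  proof (rule ccontr)
    assume "\<not> ?thesis"
    then have ne: "cb_deriv T (osuc \<alpha>) \<noteq> cb_deriv T \<alpha>" for \<alpha> by blast
    have "\<exists>x. x \<in> cb_deriv T \<alpha> - cb_deriv T (osuc \<alpha>)" for \<alpha>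
      using ne[of \<alpha>] cb_deriv_antimono[OF less_imp_le[OF less_osuc], of T \<alpha>] by auto
    then have "\<forall>\<alpha>. \<exists>x. x \<in> cb_deriv T \<alpha> - cb_deriv T (osuc \<alpha>)" by blast
    from choice[OF this] obtain f where f: "\<forall>\<alpha>. f \<alpha> \<in> cb_deriv T \<alpha> - cb_deriv T (osuc \<alpha>)" ..
    have "f \<alpha> \<noteq> f \<beta>" if "\<alpha> < \<beta>" for \<alpha> \<beta>
    proof -
      have "f \<beta> \<in> cb_deriv T (osuc \<alpha>)" using f cb_deriv_antimono[OF osuc_le[OF that], of T] by blast
      moreover have "f \<alpha> \<notin> cb_deriv T (osuc \<alpha>)" using f by blast
      ultimately show ?thesis by metis
    qed
    then have "inj f" by (metis injI linorder_neqE)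
    moreover have "range f \<subseteq> topspace T" using f cb_deriv_subset_topspace[of T] by blast
    ultimately have "countable (UNIV :: omega1 set)"
      using assms countable_subset countable_image_inj_on by metis
    then show False using uncountable_omega1 by blast
  qed
  then have "\<exists>\<alpha>. \<forall>\<beta>\<ge>\<alpha>. cb_deriv T \<beta> = cb_deriv T \<alpha>" using cb_deriv_stable by blast
  then have "\<forall>\<beta>\<ge>cb_rank T. cb_deriv T \<beta> = cb_deriv T (cb_rank T)"
    unfolding cb_rank_def by (rule LeastI_ex[of "\<lambda>\<alpha>. \<forall>\<beta>\<ge>\<alpha>. cb_deriv T \<beta> = cb_deriv T \<alpha>"])
  then show ?thesis using less_imp_le[OF less_osuc[of "cb_rank T"]] by blast
qed

lemma cb_deriv_subshift_osuc:
  "cb_deriv (subshift_topology C) (osuc \<alpha>) = lim_pts (cb_deriv (subshift_topology C) \<alpha>)"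
proof -
  let ?S = "cb_deriv (subshift_topology C) \<alpha>"
  have "?S \<subseteq> C" using cb_deriv_subset_topspace[of "subshift_topology C" \<alpha>] by simp
  then have "subtopology (subshift_topology C) ?S = subshift_topology ?S"
    unfolding subshift_topology_def subtopology_subtopology by (simp add: Int_absorb1)
  then show ?thesis unfolding cb_deriv_osuc by (simp add: derived_set_subshift)
qed

lemma cb_deriv_subshift_wclosed:
  assumes "wclosed C" shows "wclosed (cb_deriv (subshift_topology C) \<alpha>)"
proof (induction \<alpha> rule: less_induct)
  case (less \<alpha>)
  show ?case
  proof (cases \<alpha> rule: omega1_cases)
    case 1
    then show ?thesis using assms by (simp add: cb_deriv_0)
  next
    case (2 \<beta>)
    then show ?thesis using less.IH[of \<beta>] less_osuc lim_pts_wclosed by (simp add: cb_deriv_subshift_osuc)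
  next
    case 3
    then show ?thesis using less.IH unfolding cb_deriv_limit[OF 3] by (intro wclosed_Inter) auto
  qed
qed

text \<open>A nonempty perfect compact set has the size of the continuum.\<close>

lemma countable_perfect_empty:
  assumes C: "subsh C" "countable C" and K: "wclosed K" "K \<subseteq> C" "lim_pts K = K"
  shows "K = {}"
proof (rule ccontr)
  assume "K \<noteq> {}"
  have "closedin (subshift_topology C) K" using K closedin_subshift_iff[OF subsh_wclosed[OF C(1)]] by simp
  then have "compact_space (subtopology (subshift_topology C) K)"
    using closedin_compact_space[OF subsh_compact[OF C(1)]] compact_space_subtopology by blast
  moreover have "subtopology (subshift_topology C) K = subshift_topology K"
    unfolding subshift_topology_def subtopology_subtopology using K(2) by (simp add: Int_absorb1)
  ultimately have comp: "compact_space (subshift_topology K)" by simp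
  have "Hausdorff_space (subshift_topology K)"
    unfolding subshift_topology_def
    by (intro Hausdorff_space_subtopology) (simp add: Hausdorff_space_product_topology)
  then have "(UNIV :: real set) \<lesssim> K"
    using lepoll_perfect_set[of "subshift_topology K" K] compact_imp_locally_compact_space[OF comp]
      derived_set_subshift[of K] K(3) \<open>K \<noteq> {}\<close> by simp
  then have "countable (UNIV :: real set)"
    using C(2) K(2) countable_subset countable_lepoll by metis
  then show False using uncountable_UNIV_real by blast
qed

lemma cb_deriv_rank_empty:
  assumes C: "subsh C" "countable C"
  shows "cb_deriv (subshift_topology C) (cb_rank (subshift_topology C)) = {}"
proof (rule countable_perfect_empty[OF C])
  let ?T = "subshift_topology C"
  show "wclosed (cb_deriv ?T (cb_rank ?T))" by (rule cb_deriv_subshift_wclosed[OF subsh_wclosed[OF C(1)]])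
  show "cb_deriv ?T (cb_rank ?T) \<subseteq> C" using cb_deriv_subset_topspace[of ?T] by simp
  show "lim_pts (cb_deriv ?T (cb_rank ?T)) = cb_deriv ?T (cb_rank ?T)"
    using cb_deriv_cb_rank[of ?T] C(2) by (simp add: cb_deriv_subshift_osuc)
qed

lemma ord_of_nat_2: "ord_of_nat 2 = osuc (osuc 0)" and ord_of_nat_3: "ord_of_nat 3 = osuc (osuc (osuc 0))"
  by (simp_all add: ord_of_nat_def numeral_2_eq_2 numeral_3_eq_3)

lemma cb_rank_le_2_iff:
  assumes C: "subsh C" "countable C"
  shows "cb_rank (subshift_topology C) \<le> ord_of_nat 2 \<longleftrightarrow> lim_pts (lim_pts C) = {}"
proof -
  have e: "cb_deriv (subshift_topology C) (ord_of_nat 2) = lim_pts (lim_pts C)"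
    unfolding ord_of_nat_2 by (simp add: cb_deriv_subshift_osuc cb_deriv_0)
  show ?thesis
  proof
    assume "cb_rank (subshift_topology C) \<le> ord_of_nat 2"
    from cb_deriv_antimono[OF this, of "subshift_topology C"] cb_deriv_rank_empty[OF C] e
    show "lim_pts (lim_pts C) = {}" by simp
  next
    assume "lim_pts (lim_pts C) = {}"
    then show "cb_rank (subshift_topology C) \<le> ord_of_nat 2" using cb_rank_le_empty e by metis
  qed
qed

lemma cb_rank_le_3:
  assumes "lim_pts (lim_pts (lim_pts C)) = {}"
  shows "cb_rank (subshift_topology C) \<le> ord_of_nat 3"
  by (rule cb_rank_le_empty) (simp add: ord_of_nat_3 cb_deriv_subshift_osuc cb_deriv_0 assms)

text \<open>A perfect space equals its derivative, hence has rank zero.\<close>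

lemma cb_rank_perfect:
  assumes "lim_pts C = C" shows "cb_rank (subshift_topology C) \<le> \<xi>"
proof -
  have "cb_rank (subshift_topology C) \<le> 0"
    by (rule cb_rank_le) (simp add: cb_deriv_subshift_osuc cb_deriv_0 assms)
  then show ?thesis using zero_le_omega1 order.trans by blast
qed

lemma cb_deriv_mono_space:
  assumes "D \<subseteq> C"
  shows "cb_deriv (subshift_topology D) \<alpha> \<subseteq> cb_deriv (subshift_topology C) \<alpha>"
proof (induction \<alpha> rule: less_induct)
  case (less \<alpha>)
  show ?case
  proof (cases \<alpha> rule: omega1_cases)
    case 1
    then show ?thesis using assms by (simp add: cb_deriv_0)
  next
    case (2 \<beta>)
    then show ?thesis using less.IH[of \<beta>] less_osuc lim_pts_mono by (simp add: cb_deriv_subshift_osuc)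
  next
    case 3
    then show ?thesis using less.IH unfolding cb_deriv_limit[OF 3] by (intro INF_mono) auto
  qed
qed

text \<open>In a countable subshift the derivative of order the rank is empty, so this is inherited.
  Uncountable subshifts behave differently: a perfect one has rank zero and may have subshifts of
  positive rank.\<close>

lemma cb_rank_mono:
  assumes C: "subsh C" "countable C" and D: "D \<subseteq> C"
  shows "cb_rank (subshift_topology D) \<le> cb_rank (subshift_topology C)"
  by (rule cb_rank_le_empty)
    (use cb_deriv_mono_space[OF D, of "cb_rank (subshift_topology C)"] cb_deriv_rank_empty[OF C] in simp)

section \<open>The antichain basis in rank two\<close>

text \<open>The formula characterizes least periods. They are an isomorphism invariant of critical subshifts.\<close>

definition periods :: "(int \<Rightarrow> 'a) set \<Rightarrow> nat set" where
  "periods X = {n. n > 0 \<and> (\<exists>x\<in>X. \<forall>k. sh k x = x \<longleftrightarrow> int n dvd k)}"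

lemma period_unique:
  assumes "\<forall>k. sh k x = x \<longleftrightarrow> int n dvd k" "\<forall>k. sh k x = x \<longleftrightarrow> int m dvd k" shows "n = m"
proof -
  have "int n dvd int m" "int m dvd int n" using assms by (metis dvd_refl)+
  then show ?thesis by (simp add: dvd_antisym)
qed

lemma sh_neg_fix: "sh (- k) x = x \<longleftrightarrow> sh k x = x"
  using sh_mult[of k x "-1"] sh_mult[of "-k" x "-1"] by auto

lemma period_sh: "sh k (sh j x) = sh j x \<longleftrightarrow> sh k x = x"
  by (metis add.commute sh_inject sh_sh)

lemma embedding_periods:
  assumes T: "critical T" and S: "critical S" and h: "emb h T S"
  shows "x \<in> T \<Longrightarrow> sh k (h x) = h x \<longleftrightarrow> sh k x = x" and "periods T = periods S"
proof -
  have sT: "subsh T" using T by (simp add: critical_def)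
  have inj: "inj_on h T" using h unfolding emb_def by blast
  show eq: "sh k (h x) = h x \<longleftrightarrow> sh k x = x" if x: "x \<in> T" for x k
  proof -
    have *: "h (sh k x) = h x \<longleftrightarrow> sh k x = x" using inj subsh_sh[OF sT x] x by (auto simp: inj_on_def)
    from emb_orbit[OF T h x] have "h (sh k x) = sh k (h x) \<or> h (sh k x) = sh (-k) (h x)" by blast
    then show ?thesis using * sh_neg_fix[of k "h x"] by auto
  qed
  have im: "h ` T = S" by (rule critical_embedding(1)[OF T S h])
  show "periods T = periods S"
    unfolding periods_def im[symmetric] using eq by auto
qed

lemma ic_le_trans:
  assumes "G \<preceq>ic H" "H \<preceq>ic K" shows "G \<preceq>ic K"
proof -
  obtain g where g: "continuous_map (fst G) (fst H) g" "inj_on g (topspace (fst G))"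
      "\<forall>(x, y)\<in>snd G. (g x, g y) \<in> snd H" using assms(1) unfolding ic_le_def by blast
  obtain h where h: "continuous_map (fst H) (fst K) h" "inj_on h (topspace (fst H))"
      "\<forall>(x, y)\<in>snd H. (h x, h y) \<in> snd K" using assms(2) unfolding ic_le_def by blast
  have "g ` topspace (fst G) \<subseteq> topspace (fst H)" by (rule continuous_map_image_subset_topspace[OF g(1)])
  then have "inj_on (h \<circ> g) (topspace (fst G))" using g(2) h(2) by (meson comp_inj_on inj_on_subset)
  moreover have "continuous_map (fst G) (fst K) (h \<circ> g)" by (rule continuous_map_compose[OF g(1) h(1)])
  moreover have "\<forall>(x, y)\<in>snd G. ((h \<circ> g) x, (h \<circ> g) y) \<in> snd K" using g(3) h(3) by fastforce
  ultimately show ?thesis unfolding ic_le_def by blast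
qed

lemma ic_le_refl: "G \<preceq>ic G"
  unfolding ic_le_def by (intro exI[of _ id]) auto

lemma ic_equiv_refl: "G \<equiv>ic G"
  by (simp add: ic_equiv_def ic_le_refl)

lemma ic_equiv_sym: "G \<equiv>ic H \<Longrightarrow> H \<equiv>ic G"
  by (simp add: ic_equiv_def)

lemma ic_equiv_trans: "G \<equiv>ic H \<Longrightarrow> H \<equiv>ic K \<Longrightarrow> G \<equiv>ic K"
  unfolding ic_equiv_def by (intro conjI; elim conjE; rule ic_le_trans)

lemma shift_graph_eq_iff: "shift_graph C = shift_graph D \<longleftrightarrow> C = D"
proof
  assume "shift_graph C = shift_graph D"
  then have "topspace (fst (shift_graph C)) = topspace (fst (shift_graph D))" by simp
  then show "C = D" by (simp add: shift_graph_def)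
qed simp

lemma countable_infinite_eqpoll:
  assumes "countable A" "infinite A" shows "A \<approx> (UNIV :: nat set)"
  using countableE_infinite[OF assms] unfolding eqpoll_def by blast

subsection \<open>Lexicographically minimal tuples\<close>

lemma pseq_inj: "p \<in> Ptuples \<Longrightarrow> q \<in> Ptuples \<Longrightarrow> pseq p = pseq q \<Longrightarrow> p = q"
  by (cases p; cases q) (auto simp: Ptuples_def)

text \<open>The first entry of a sequence determines its length, so among the members with the least first
  entry the lexicographic order is well-founded; and these members precede all others.\<close>

lemma lex_min_in:
  assumes F: "F \<subseteq> Ptuples" "F \<noteq> {}" shows "lex_min F \<in> F"
proof -
  let ?r = "{(i, j). i < j} :: (nat \<times> nat) set"
  have rlt: "?r = less_than" by auto
  define l0 where "l0 = (LEAST l. l \<in> fst ` F)"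
  have l0: "l0 \<in> fst ` F" unfolding l0_def by (rule LeastI_ex) (use F(2) in auto)
  have l0_le: "l0 \<le> fst p" if "p \<in> F" for p unfolding l0_def by (rule Least_le) (use that in simp)
  let ?F0 = "{p\<in>F. fst p = l0}"
  have len: "length (pseq p) = 2 * l0 + 3" if "p \<in> ?F0" for p
    using that F(1) by (cases p) (auto simp: Ptuples_def)
  have wf: "wf (inv_image (lex ?r) pseq)" unfolding rlt by (intro wf_inv_image wf_lex wf_less_than)
  have "?F0 \<noteq> {}"
  proof -
    obtain p where "p \<in> F" "l0 = fst p" using l0 by (rule imageE)
    then have "p \<in> ?F0" by simp
    then show ?thesis by blast
  qed
  then obtain p0 where "p0 \<in> ?F0" by blast
  from wf[unfolded wf_eq_minimal, rule_format, OF this] obtain m where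
    m: "m \<in> ?F0" "\<forall>p. (p, m) \<in> inv_image (lex ?r) pseq \<longrightarrow> p \<notin> ?F0" ..
  have tot: "(x, y) \<in> lexord ?r \<or> x = y \<or> (y, x) \<in> lexord ?r" for x y
    by (rule lexord_linear) auto
  have least: "p = m \<or> (pseq m, pseq p) \<in> lexord ?r" if p: "p \<in> F" for p
  proof (cases "fst p = l0")
    case True
    then have p0: "p \<in> ?F0" using p by simp
    have "(pseq p, pseq m) \<notin> lexord ?r"
    proof
      assume "(pseq p, pseq m) \<in> lexord ?r"
      then have "(pseq p, pseq m) \<in> lex ?r" using len[OF p0] len[OF m(1)] by (subst lexord_lex) simp
      then have "(p, m) \<in> inv_image (lex ?r) pseq" by simp
      then show False using m(2) p0 by blast
    qed
    then have "pseq p = pseq m \<or> (pseq m, pseq p) \<in> lexord ?r" using tot by blast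
    then show ?thesis using pseq_inj[of p m] p m(1) F(1) by auto
  next
    case False
    then have "l0 < fst p" using l0_le[OF p] by simp
    then show ?thesis using m(1) by (cases p; cases m) auto
  qed
  have "lex_min F = m"
    unfolding lex_min_def
  proof (rule the_equality)
    show "m \<in> F \<and> (\<forall>p'\<in>F. p' = m \<or> (pseq m, pseq p') \<in> lexord ?r)" using least m(1) by blast
    fix p assume p: "p \<in> F \<and> (\<forall>p'\<in>F. p' = p \<or> (pseq p, pseq p') \<in> lexord ?r)"
    show "p = m"
    proof (rule ccontr)
      assume "p \<noteq> m"
      have "m \<in> F" using m(1) by simp
      then have "(pseq p, pseq m) \<in> lexord ?r" using p \<open>p \<noteq> m\<close> by metis
      moreover have "(pseq m, pseq p) \<in> lexord ?r" using p least \<open>p \<noteq> m\<close> by metis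
      moreover have "asym (lexord ?r)" by (rule lexord_asym) (auto simp: asym_on_def)
      ultimately show False by (meson asymD)
    qed
  qed
  then show ?thesis using m(1) by simp
qed

context symbols
begin

lemma infinite_UNIV_symbols: "infinite (UNIV :: 'a set)"
  using range_inj_infinite[OF inj_d] finite_subset[of "range d" UNIV] by auto

lemma pSigma_critical_hetsys:
  assumes "p \<in> Ptuples" shows "critical (pSigma a b p)" "\<exists>E. hetsys E (pSigma a b p)"
proof -
  obtain l lam m eps where p: "p = (l, lam, m, eps)" by (cases p)
  interpret pt: ptuple d a b l lam m eps by unfold_locales (use assms p in simp)
  show "critical (pSigma a b p)" "\<exists>E. hetsys E (pSigma a b p)"
    unfolding p using pt.pSigma_critical pt.pSigma_hetsys by auto
qed

lemma in_countable_class_iff: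
  "G \<in> countable_graph_class \<xi> \<longleftrightarrow> (\<exists>C :: (int \<Rightarrow> 'a) set. G = shift_graph C \<and> subsh C \<and> countable C \<and>
     cb_rank (subshift_topology C) \<le> \<xi> \<and> \<not> colorable C)"
  unfolding countable_graph_class_def using subshift_iff[OF infinite_UNIV_symbols] has_cont_2coloring_iff by auto

lemma in_class_iff:
  "G \<in> graph_class \<xi> \<longleftrightarrow> (\<exists>C :: (int \<Rightarrow> 'a) set. G = shift_graph C \<and> subsh C \<and>
     cb_rank (subshift_topology C) \<le> \<xi> \<and> \<not> colorable C)"
  unfolding graph_class_def using subshift_iff[OF infinite_UNIV_symbols] has_cont_2coloring_iff by auto

lemma critical_hetsys_in_class:
  fixes C :: "(int \<Rightarrow> 'a) set"
  assumes "critical C" "\<exists>E. hetsys E C"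
  shows "shift_graph C \<in> countable_graph_class (ord_of_nat 2)"
proof -
  obtain E where E: "hetsys E C" using assms(2) by blast
  have C: "subsh C" "countable C" using hetsys_subsh[OF E] hetsys_countable[OF E] .
  have "cb_rank (subshift_topology C) \<le> ord_of_nat 2"
    using cb_rank_le_2_iff[OF C] hetsys_lim_pts2[OF E] by simp
  then show ?thesis unfolding in_countable_class_iff using C assms(1) unfolding critical_def by blast
qed

text \<open>The rank does not grow in subspaces of a countable space, so a critical subshift below a given one
  has the combinatorial structure to which \<open>critical_rank_two\<close> applies.\<close>

lemma rank_two_above:
  fixes G :: "(int \<Rightarrow> 'a) tgraph"
  assumes "G \<in> countable_graph_class (ord_of_nat 2)"
  shows "(\<exists>n. shift_graph (nSigma d n) \<preceq>ic G) \<or> (\<exists>p\<in>Ptuples. shift_graph (pSigma a b p) \<preceq>ic G)"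
proof -
  obtain C :: "(int \<Rightarrow> 'a) set" where C: "G = shift_graph C" "subsh C" "countable C"
      "cb_rank (subshift_topology C) \<le> ord_of_nat 2" "\<not> colorable C"
    using assms unfolding in_countable_class_iff by blast
  obtain T where T: "T \<subseteq> C" "critical T" using exists_critical[OF C(2,5)] by blast
  have sT: "subsh T" using T(2) by (simp add: critical_def)
  have "lim_pts (lim_pts C) = {}" using cb_rank_le_2_iff[OF C(2,3)] C(4) by simp
  then have "lim_pts (lim_pts T) = {}" using lim_pts_mono[OF lim_pts_mono[OF T(1)]] by blast
  then obtain E where E: "hetsys E T" using rank_two_hetsys[OF sT] by blast
  have up: "shift_graph F \<preceq>ic G" if F: "critical F" "embeds F T" for F :: "(int \<Rightarrow> 'a) set"
  proof -
    have sF: "subsh F" using F(1) by (simp add: critical_def)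
    have "embeds F C" by (rule embeds_trans[OF sF F(2) embeds_subset[OF T(1)]])
    then show ?thesis unfolding C(1) ic_le_iff[OF sF C(2)] .
  qed
  from critical_rank_two[OF E T(2)] show ?thesis
    using up nSigma_critical pSigma_critical_hetsys(1) by blast
qed

lemma Fset_sub: "Fset a b p \<subseteq> Ptuples"
  unfolding Fset_def by blast

lemma lex_min_Fset:
  assumes "p \<in> Ptuples"
  shows "lex_min (Fset a b p) \<in> Ptuples" "shift_graph (pSigma a b (lex_min (Fset a b p))) \<equiv>ic shift_graph (pSigma a b p)"
proof -
  have "p \<in> Fset a b p" using assms ic_equiv_refl unfolding Fset_def by blast
  then have "lex_min (Fset a b p) \<in> Fset a b p" using lex_min_in[OF Fset_sub] by blast
  then show "lex_min (Fset a b p) \<in> Ptuples"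
    "shift_graph (pSigma a b (lex_min (Fset a b p))) \<equiv>ic shift_graph (pSigma a b p)"
    unfolding Fset_def by auto
qed

lemma basis_rank_two: "is_basis (countable_graph_class (ord_of_nat 2)) (basis_family d a b)"
  unfolding is_basis_def
proof (intro conjI ballI subsetI)
  fix G assume "G \<in> basis_family d a b"
  then show "G \<in> countable_graph_class (ord_of_nat 2)"
    unfolding basis_family_def
    using critical_hetsys_in_class[OF nSigma_critical nSigma_hetsys]
      critical_hetsys_in_class[OF pSigma_critical_hetsys] by auto
next
  fix G :: "(int \<Rightarrow> 'a) tgraph" assume "G \<in> countable_graph_class (ord_of_nat 2)"
  from rank_two_above[OF this] show "\<exists>H\<in>basis_family d a b. H \<preceq>ic G"
    unfolding basis_family_def by blast
qed

lemma antichain_family_sub: "antichain_family d a b \<subseteq> basis_family d a b"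
  unfolding antichain_family_def basis_family_def using lex_min_Fset(1) by blast

lemma antichain_basis_rank_two: "is_basis (countable_graph_class (ord_of_nat 2)) (antichain_family d a b)"
  unfolding is_basis_def
proof (intro conjI ballI)
  show "antichain_family d a b \<subseteq> countable_graph_class (ord_of_nat 2)"
    using antichain_family_sub basis_rank_two unfolding is_basis_def by blast
next
  fix G :: "(int \<Rightarrow> 'a) tgraph" assume "G \<in> countable_graph_class (ord_of_nat 2)"
  from rank_two_above[OF this] show "\<exists>H\<in>antichain_family d a b. H \<preceq>ic G"
  proof
    assume "\<exists>n. shift_graph (nSigma d n) \<preceq>ic G"
    then show ?thesis unfolding antichain_family_def by blast
  next
    assume "\<exists>p\<in>Ptuples. shift_graph (pSigma a b p) \<preceq>ic G"
    then obtain p where p: "p \<in> Ptuples" "shift_graph (pSigma a b p) \<preceq>ic G" by blast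
    let ?m = "lex_min (Fset a b p)"
    have "shift_graph (pSigma a b ?m) \<preceq>ic shift_graph (pSigma a b p)"
      using lex_min_Fset(2)[OF p(1)] unfolding ic_equiv_def by simp
    then have "shift_graph (pSigma a b ?m) \<preceq>ic G" using p(2) by (rule ic_le_trans)
    moreover have "shift_graph (pSigma a b ?m) \<in> antichain_family d a b"
      unfolding antichain_family_def using p(1) by blast
    ultimately show ?thesis by blast
  qed
qed

lemma periods_nSigma:
  "periods (nSigma d n) = (if even n \<or> n = 1 then {1, max 1 n} else {n})"
proof (cases "even n \<or> n = 1")
  case True
  have p0: "\<forall>k. sh k (pw [d 0]) = pw [d 0] \<longleftrightarrow> int 1 dvd k" using sh_pw_single by auto
  have pn: "\<forall>k. sh k (pw (right_word n)) = pw (right_word n) \<longleftrightarrow> int (max 1 n) dvd k" using sh_pw_iff[of "right_word n"] by simp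
  have "m \<in> {1, max 1 n}" if m: "m \<in> periods (nSigma d n)" for m
  proof -
    obtain x where x: "m > 0" "x \<in> nSigma d n" "\<forall>k. sh k x = x \<longleftrightarrow> int m dvd k"
      using m unfolding periods_def by blast
    obtain y j where y: "y = pw [d 0] \<or> y = pw (right_word n) \<or> y = en n" "x = sh j y"
      using x(2) unfolding nSigma_even[OF True] orb_eq by blast
    have ym: "\<forall>k. sh k y = y \<longleftrightarrow> int m dvd k" using x(3) unfolding y(2) period_sh .
    have "y \<noteq> en n"
    proof
      assume "y = en n"
      then have "int m = 0" using ym nonper_sh[OF en_nonper[of n], of "int m"] by simp
      then show False using x(1) by simp
    qed
    then show ?thesis using y(1) period_unique[OF ym] p0 pn by blast
  qed
  moreover have "1 \<in> periods (nSigma d n)" "max 1 n \<in> periods (nSigma d n)"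
    unfolding periods_def using p0 pn nSigma_pts[OF True] by auto
  ultimately show ?thesis using True by auto
next
  case False
  then have n: "odd n" "n \<noteq> 1" by auto
  let ?p = "pw (map d [0..<n])"
  have np: "n > 0" using n(1) by (rule odd_pos)
  have p: "\<forall>k. sh k ?p = ?p \<longleftrightarrow> int n dvd k"
    by (subst sh_pw_iff) (use np in \<open>auto simp: distinct_map inj_on_def\<close>)
  have "m = n" if m: "m \<in> periods (nSigma d n)" for m
  proof -
    obtain x where x: "x \<in> nSigma d n" "\<forall>k. sh k x = x \<longleftrightarrow> int m dvd k" using m unfolding periods_def by blast
    obtain j where "x = sh j ?p" using x(1) unfolding nSigma_odd[OF n] orb_eq by blast
    then have "\<forall>k. sh k ?p = ?p \<longleftrightarrow> int m dvd k" using x(2) period_sh by metis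
    then show ?thesis using period_unique p by blast
  qed
  moreover have "n \<in> periods (nSigma d n)" unfolding periods_def nSigma_odd[OF n] using p np by auto
  ultimately show ?thesis using False by auto
qed

lemma periods_pSigma:
  assumes "p \<in> Ptuples" shows "\<forall>n\<in>periods (pSigma a b p). even n"
proof
  fix n assume n: "n \<in> periods (pSigma a b p)"
  obtain l lam m eps where p: "p = (l, lam, m, eps)" by (cases p)
  interpret pt: ptuple d a b l lam m eps by unfold_locales (use assms p in simp)
  obtain x where x: "n > 0" "x \<in> pSigma a b p" "\<forall>k. sh k x = x \<longleftrightarrow> int n dvd k"
    using n unfolding periods_def by blast
  obtain q j where q: "q \<in> pt.ix" "x = sh j (pt.pt q)"
    using x(2) unfolding p pt.pSigma_pt orb_eq by blast
  have qn: "\<forall>k. sh k (pt.pt q) = pt.pt q \<longleftrightarrow> int n dvd k" using x(3) unfolding q(2) period_sh .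
  obtain t i where ti: "q = (t, i)" "i \<le> l" using q(1) unfolding pt.ix_def by (cases q) auto
  show "even n"
  proof (cases t)
    case True
    then have "int n = 0" using qn nonper_sh[OF pt.ep_nonper[OF ti(2)], of "int n"] ti(1) by (simp add: pt.pt_def)
    then show ?thesis using x(1) by simp
  next
    case False
    then have "\<forall>k. sh k (pw (pt.wp i)) = pw (pt.wp i) \<longleftrightarrow> int n dvd k" using qn ti(1) by (simp add: pt.pt_def)
    moreover have "\<forall>k. sh k (pw (pt.wp i)) = pw (pt.wp i) \<longleftrightarrow> int (lam ! i) dvd k"
      using sh_pw_iff[OF pt.wp_simps(2) pt.wp_ne[OF ti(2)]] by simp
    ultimately have "n = lam ! i" by (rule period_unique)
    then show ?thesis using pt.lam_even[OF ti(2)] by simp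
  qed
qed

text \<open>Both have only period one, but the first one has two fixed points and the second one has one.\<close>

lemma nSigma_0_1: "\<not> embeds (nSigma d 1) (nSigma d 0)"
proof
  assume "embeds (nSigma d 1) (nSigma d 0)"
  then obtain h where h: "emb h (nSigma d 1) (nSigma d 0)" unfolding embeds_def by blast
  note eq = embedding_periods(1)[OF nSigma_critical nSigma_critical h]
  have fixed: "y = pw [d 0]" if y: "y \<in> nSigma d 0" "sh 1 y = y" for y
  proof -
    have "periodic y" using y(2) unfolding periodic_def by (intro exI[of _ 1]) simp
    then have "y \<notin> orb (en 0)" using en_nonper[of 0] unfolding orb_eq by auto
    then have "y \<in> orb (pw [d 0])" using y(1) unfolding nSigma_even[of 0, simplified] by (simp add: right_word_def)
    then show ?thesis unfolding orb_eq using sh_pw_single by auto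
  qed
  have im: "h z = pw [d 0]" if z: "z \<in> nSigma d 1" "sh 1 z = z" for z
  proof (rule fixed)
    show "h z \<in> nSigma d 0" using h z(1) unfolding emb_def by blast
    show "sh 1 (h z) = h z" using eq[OF z(1), of 1] z(2) by simp
  qed
  have p: "pw [d 0] \<in> nSigma d 1" "pw [d 1] \<in> nSigma d 1"
    using nSigma_pts[of 1] by (simp_all add: right_word_def)
  have "h (pw [d 0]) = h (pw [d 1])" using im[OF p(1) sh_pw_single] im[OF p(2) sh_pw_single] by simp
  then have "pw [d 0] = pw [d 1]" using h p unfolding emb_def inj_on_def by blast
  then have "pw [d 0] 0 = pw [d 1] 0" by simp
  then show False by (simp add: pw_def)
qed

lemma embeds_nSigma_eq:
  assumes e: "embeds (nSigma d n) (nSigma d m)" shows "n = m"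
proof -
  obtain h where h: "emb h (nSigma d n) (nSigma d m)" using e unfolding embeds_def by blast
  have pe: "periods (nSigma d n) = periods (nSigma d m)"
    by (rule embedding_periods(2)[OF nSigma_critical nSigma_critical h])
  have e': "embeds (nSigma d m) (nSigma d n)" by (rule critical_embedding(2)[OF nSigma_critical nSigma_critical h])
  consider "even n \<or> n = 1" "even m \<or> m = 1" | "even n \<or> n = 1" "odd m" "m \<noteq> 1"
    | "odd n" "n \<noteq> 1" "even m \<or> m = 1" | "odd n" "n \<noteq> 1" "odd m" "m \<noteq> 1" by blast
  then show ?thesis
  proof cases
    case 1
    then have "{1, max 1 n} = {1, max 1 m}" using pe unfolding periods_nSigma by simp
    then have mx: "max 1 n = max 1 m" by (metis doubleton_eq_iff)
    show ?thesis
    proof (rule ccontr)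
      assume "n \<noteq> m"
      then have "(n = 0 \<and> m = 1) \<or> (n = 1 \<and> m = 0)" using mx by (auto simp: max_def split: if_splits)
      then show False using nSigma_0_1 e e' by auto
    qed
  next
    case 2
    then have "1 = m" using pe unfolding periods_nSigma by auto
    then show ?thesis using 2 by simp
  next
    case 3
    then have "1 = n" using pe unfolding periods_nSigma by auto
    then show ?thesis using 3 by simp
  next
    case 4
    then show ?thesis using pe unfolding periods_nSigma by simp
  qed
qed

lemma nSigma_odd_period: "\<exists>k\<in>periods (nSigma d n). odd k"
  unfolding periods_nSigma by auto

text \<open>Comparable critical subshifts are equivalent. Between the two families the parity of the periods
  excludes this, and equivalent members of the second family have the same minimal tuple.\<close>

lemma antichain_rank_two: "is_antichain (antichain_family d a b)"
proof -
  have key: "G = H" if G: "G \<in> antichain_family d a b" and H: "H \<in> antichain_family d a b" and le: "G \<preceq>ic H" for G H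
  proof -
    obtain C where C: "G = shift_graph C" "(\<exists>n. C = nSigma d n) \<or> (\<exists>p\<in>Ptuples. C = pSigma a b (lex_min (Fset a b p)))"
      using G unfolding antichain_family_def by blast
    obtain D where D: "H = shift_graph D" "(\<exists>n. D = nSigma d n) \<or> (\<exists>p\<in>Ptuples. D = pSigma a b (lex_min (Fset a b p)))"
      using H unfolding antichain_family_def by blast
    have cC: "critical C" using C(2) nSigma_critical pSigma_critical_hetsys(1) lex_min_Fset(1) by blast
    have cD: "critical D" using D(2) nSigma_critical pSigma_critical_hetsys(1) lex_min_Fset(1) by blast
    have sC: "subsh C" and sD: "subsh D" using cC cD by (simp_all add: critical_def)
    have e: "embeds C D" using le unfolding C(1) D(1) ic_le_iff[OF sC sD] .
    then obtain h where h: "emb h C D" unfolding embeds_def by blast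
    have pe: "periods C = periods D" by (rule embedding_periods(2)[OF cC cD h])
    have "embeds D C" by (rule critical_embedding(2)[OF cC cD h])
    then have equ: "G \<equiv>ic H" unfolding ic_equiv_def C(1) D(1) ic_le_iff[OF sC sD] ic_le_iff[OF sD sC] using e by simp
    have ev: "\<forall>n\<in>periods (pSigma a b (lex_min (Fset a b p))). even n" if "p \<in> Ptuples" for p
      by (rule periods_pSigma[OF lex_min_Fset(1)[OF that]])
    from C(2) show "G = H"
    proof
      assume "\<exists>n. C = nSigma d n"
      then obtain n where n: "C = nSigma d n" by blast
      from D(2) show ?thesis
      proof
        assume "\<exists>n. D = nSigma d n"
        then show ?thesis using e n embeds_nSigma_eq C(1) D(1) by blast
      next
        assume "\<exists>p\<in>Ptuples. D = pSigma a b (lex_min (Fset a b p))"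
        then show ?thesis using ev pe n nSigma_odd_period[of n] by metis
      qed
    next
      assume "\<exists>p\<in>Ptuples. C = pSigma a b (lex_min (Fset a b p))"
      then obtain p where p: "p \<in> Ptuples" "C = pSigma a b (lex_min (Fset a b p))" by blast
      from D(2) show ?thesis
      proof
        assume "\<exists>n. D = nSigma d n"
        then show ?thesis using ev[OF p(1)] pe p(2) nSigma_odd_period by metis
      next
        assume "\<exists>p\<in>Ptuples. D = pSigma a b (lex_min (Fset a b p))"
        then obtain q where q: "q \<in> Ptuples" "D = pSigma a b (lex_min (Fset a b q))" by blast
        have "shift_graph (pSigma a b p) \<equiv>ic G"
          unfolding C(1) p(2) by (rule ic_equiv_sym[OF lex_min_Fset(2)[OF p(1)]])
        moreover have "H \<equiv>ic shift_graph (pSigma a b q)"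
          unfolding D(1) q(2) by (rule lex_min_Fset(2)[OF q(1)])
        ultimately have pq: "shift_graph (pSigma a b p) \<equiv>ic shift_graph (pSigma a b q)"
          using equ ic_equiv_trans by blast
        have "Fset a b p = Fset a b q"
          unfolding Fset_def using pq ic_equiv_sym ic_equiv_trans by blast
        then show ?thesis using C(1) D(1) p(2) q(2) by simp
      qed
    qed
  qed
  then show ?thesis unfolding is_antichain_def by metis
qed

lemma family_eqpoll: "basis_family d a b \<approx> (UNIV :: nat set)" "antichain_family d a b \<approx> (UNIV :: nat set)"
proof -
  have eq: "basis_family d a b = range (\<lambda>n. shift_graph (nSigma d n)) \<union> (\<lambda>p. shift_graph (pSigma a b p)) ` Ptuples"
    unfolding basis_family_def by blast
  have cb: "countable (basis_family d a b)" unfolding eq by (intro countable_Un countable_image) auto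
  have ca: "countable (antichain_family d a b)" using cb antichain_family_sub countable_subset by blast
  have "inj (\<lambda>n. shift_graph (nSigma d n))"
  proof (rule injI)
    fix n m assume "shift_graph (nSigma d n) = shift_graph (nSigma d m)"
    then have "nSigma d n = nSigma d m" unfolding shift_graph_eq_iff .
    then have "embeds (nSigma d n) (nSigma d m)" using embeds_subset[of "nSigma d n" "nSigma d m"] by simp
    then show "n = m" by (rule embeds_nSigma_eq)
  qed
  then have "infinite (range (\<lambda>n. shift_graph (nSigma d n)))" by (rule range_inj_infinite)
  moreover have "range (\<lambda>n. shift_graph (nSigma d n)) \<subseteq> antichain_family d a b"
    unfolding antichain_family_def by blast
  ultimately have ia: "infinite (antichain_family d a b)" using finite_subset by blast
  then have ib: "infinite (basis_family d a b)" using antichain_family_sub finite_subset by blast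
  show "basis_family d a b \<approx> (UNIV :: nat set)" by (rule countable_infinite_eqpoll[OF cb ib])
  show "antichain_family d a b \<approx> (UNIV :: nat set)" by (rule countable_infinite_eqpoll[OF ca ia])
qed

end

section \<open>Counting classes\<close>

subsection \<open>At most continuum many\<close>

text \<open>Coded over the natural numbers, the words of subshifts over different alphabets can be compared.\<close>

definition words :: "('a \<Rightarrow> nat) \<Rightarrow> (int \<Rightarrow> 'a) set \<Rightarrow> nat list set" where
  "words \<rho> C = {map (\<lambda>k. \<rho> (x k)) [- int N..int N] |x N. x \<in> C}"

lemma map_window_eq_iff:
  "map f [- int N..int N] = map g [- int M..int M] \<longleftrightarrow> N = M \<and> (\<forall>k. \<bar>k\<bar> \<le> int N \<longrightarrow> f k = g k)"
proof
  assume e: "map f [- int N..int N] = map g [- int M..int M]"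
  then have "length [- int N..int N] = length [- int M..int M]" by (metis length_map)
  then have "N = M" by simp
  moreover have "\<forall>k\<in>set [- int N..int N]. f k = g k" using e \<open>N = M\<close> by simp
  moreover have "k \<in> set [- int N..int N]" if "\<bar>k\<bar> \<le> int N" for k using that by simp linarith
  ultimately show "N = M \<and> (\<forall>k. \<bar>k\<bar> \<le> int N \<longrightarrow> f k = g k)" by blast
qed auto

text \<open>The letters with the same code correspond to each other.\<close>

lemma same_words_embeds:
  assumes C: "subsh C" and D: "subsh D" and \<rho>: "inj_on \<rho> (\<Union>x\<in>C. range x)" and \<tau>: "inj_on \<tau> (\<Union>x\<in>D. range x)"
    and w: "words \<rho> C = words \<tau> D"
  shows "embeds C D"
proof -
  define A where "A = (\<Union>x\<in>C. range x)"
  define B where "B = (\<Union>x\<in>D. range x)"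
  define g where "g = inv_into B \<tau>"
  define h where "h x = (\<lambda>k. g (\<rho> (x k)))" for x :: "int \<Rightarrow> 'a"
  have near: "\<exists>z\<in>D. \<forall>k. \<bar>k\<bar> \<le> N \<longrightarrow> \<rho> (x k) = \<tau> (z k)" if x: "x \<in> C" for x N
  proof -
    have "map (\<lambda>k. \<rho> (x k)) [- int (nat N)..int (nat N)] \<in> words \<tau> D"
      using x unfolding w[symmetric] unfolding words_def by blast
    then obtain z M where z: "z \<in> D"
        "map (\<lambda>k. \<rho> (x k)) [- int (nat N)..int (nat N)] = map (\<lambda>k. \<tau> (z k)) [- int M..int M]"
      unfolding words_def by blast
    from z(2) have "\<forall>k. \<bar>k\<bar> \<le> int (nat N) \<longrightarrow> \<rho> (x k) = \<tau> (z k)" unfolding map_window_eq_iff by (rule conjunct2)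
    moreover have "\<bar>k\<bar> \<le> int (nat N)" if "\<bar>k\<bar> \<le> N" for k using that by linarith
    ultimately show ?thesis using z(1) by blast
  qed
  have g: "g (\<tau> (z k)) = z k" if "z \<in> D" for z k
    unfolding g_def using \<tau> that by (intro inv_into_f_f) (auto simp: B_def)
  have \<tau>h: "\<tau> (h x k) = \<rho> (x k)" if x: "x \<in> C" for x k
  proof -
    obtain z where "z \<in> D" "\<rho> (x k) = \<tau> (z k)" using near[OF x, of "\<bar>k\<bar>"] by blast
    then show ?thesis using g unfolding h_def by simp
  qed
  have hD: "h x \<in> D" if x: "x \<in> C" for x
  proof (rule wclosedD[OF subsh_wclosed[OF D]])
    fix N
    obtain z where z: "z \<in> D" "\<forall>k. \<bar>k\<bar> \<le> N \<longrightarrow> \<rho> (x k) = \<tau> (z k)" using near[OF x] by blast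
    have "agree N z (h x)" unfolding agree_def h_def using z g by simp
    then show "\<exists>z\<in>D. agree N z (h x)" using z(1) by blast
  qed
  show ?thesis
    unfolding embeds_def emb_def
  proof (intro exI[of _ h] conjI ballI allI impI)
    show "h ` C \<subseteq> D" using hD by blast
    show "inj_on h C"
    proof (rule inj_onI)
      fix x y assume xy: "x \<in> C" "y \<in> C" "h x = h y"
      have "x k = y k" for k
      proof -
        have "\<rho> (x k) = \<rho> (y k)" using \<tau>h[OF xy(1), of k] \<tau>h[OF xy(2), of k] xy(3) by simp
        moreover have "x k \<in> (\<Union>x\<in>C. range x)" "y k \<in> (\<Union>x\<in>C. range x)" using xy by auto
        ultimately show ?thesis using \<rho> unfolding inj_on_def by blast
      qed
      then show "x = y" by (rule ext)
    qed
    show "\<exists>M. \<forall>x\<in>C. \<forall>y\<in>C. agree M x y \<longrightarrow> agree N (h x) (h y)" for N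
      by (intro exI[of _ N]) (simp add: agree_def h_def)
    show "h (sh 1 x) = sh 1 (h x) \<or> h (sh 1 x) = sh (-1) (h x)" for x
      by (simp add: h_def sh_def)
  qed
qed

lemma ic_class_eq_iff:
  fixes G H :: "'x tgraph"
  defines "E \<equiv> {(G :: 'x tgraph, H :: 'x tgraph). G \<equiv>ic H}"
  shows "E `` {G} = E `` {H} \<longleftrightarrow> G \<equiv>ic H"
proof
  have mem: "L \<in> E `` {K} \<longleftrightarrow> K \<equiv>ic L" for K L unfolding E_def by simp
  {
    assume e: "E `` {G} = E `` {H}"
    have "H \<in> E `` {H}" unfolding mem by (rule ic_equiv_refl)
    then show "G \<equiv>ic H" unfolding e[symmetric] mem .
  next
    assume gh: "G \<equiv>ic H"
    show "E `` {G} = E `` {H}"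
    proof (rule set_eqI)
      fix K :: "'x tgraph"
      have "G \<equiv>ic K \<Longrightarrow> H \<equiv>ic K" by (rule ic_equiv_trans[OF ic_equiv_sym[OF gh]])
      moreover have "H \<equiv>ic K \<Longrightarrow> G \<equiv>ic K" by (rule ic_equiv_trans[OF gh])
      ultimately show "K \<in> E `` {G} \<longleftrightarrow> K \<in> E `` {H}" unfolding mem by (rule iffI)
    qed
  }
qed

text \<open>There are only continuum many sets of words over the natural numbers, and such a set determines
  the subshift up to isomorphism.\<close>

lemma ic_classes_lepoll:
  fixes B :: "(int \<Rightarrow> 'a) tgraph set"
  assumes B: "\<And>G. G \<in> B \<Longrightarrow> \<exists>C. G = shift_graph C \<and> subsh C"
  shows "ic_classes B \<lesssim> (UNIV :: nat set set)"
proof -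
  have "\<forall>G. \<exists>C \<rho>. G \<in> B \<longrightarrow> G = shift_graph C \<and> subsh C \<and> inj_on (\<rho> :: 'a \<Rightarrow> nat) (\<Union>x\<in>C. range x)"
  proof
    fix G
    show "\<exists>C \<rho>. G \<in> B \<longrightarrow> G = shift_graph C \<and> subsh C \<and> inj_on (\<rho> :: 'a \<Rightarrow> nat) (\<Union>x\<in>C. range x)"
    proof (cases "G \<in> B")
      case True
      then obtain C where C: "G = shift_graph C" "subsh C" using B by blast
      then obtain A where A: "finite A" "\<forall>x\<in>C. \<forall>k. x k \<in> A" unfolding subsh_def by blast
      have "finite (\<Union>x\<in>C. range x)" by (rule finite_subset[OF _ A(1)]) (use A(2) in auto)
      then obtain \<rho> :: "'a \<Rightarrow> nat" where "inj_on \<rho> (\<Union>x\<in>C. range x)"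
        using finite_imp_inj_to_nat_seg by metis
      then show ?thesis using C by blast
    qed simp
  qed
  from choice[OF this] obtain C where "\<forall>G. \<exists>\<rho>. G \<in> B \<longrightarrow> G = shift_graph (C G) \<and> subsh (C G) \<and> inj_on (\<rho> :: 'a \<Rightarrow> nat) (\<Union>x\<in>C G. range x)" ..
  from choice[OF this] obtain \<rho> where
    C: "\<forall>G. G \<in> B \<longrightarrow> G = shift_graph (C G) \<and> subsh (C G) \<and> inj_on (\<rho> G :: 'a \<Rightarrow> nat) (\<Union>x\<in>C G. range x)" ..
  define code where "code G = to_nat ` words (\<rho> G) (C G)" for G
  have code: "G \<equiv>ic H" if G: "G \<in> B" and H: "H \<in> B" and e: "code G = code H" for G H
  proof -
    have "inj (to_nat :: nat list \<Rightarrow> nat)" by simp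
    then have w: "words (\<rho> G) (C G) = words (\<rho> H) (C H)" using e unfolding code_def by (simp add: inj_image_eq_iff)
    have "embeds (C G) (C H)" "embeds (C H) (C G)"
      using same_words_embeds[OF _ _ _ _ w] same_words_embeds[OF _ _ _ _ w[symmetric]] C G H by auto
    moreover have "G = shift_graph (C G)" "H = shift_graph (C H)" using C G H by blast+
    ultimately show ?thesis
      unfolding ic_equiv_def using ic_le_iff[of "C G" "C H"] ic_le_iff[of "C H" "C G"] C G H by metis
  qed
  let ?E = "{(G :: (int \<Rightarrow> 'a) tgraph, H :: (int \<Rightarrow> 'a) tgraph). G \<equiv>ic H}"
  have "\<forall>c. \<exists>G. c \<in> ic_classes B \<longrightarrow> G \<in> B \<and> c = ?E `` {G}"
    unfolding ic_classes_def quotient_def by blast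
  from choice[OF this] obtain r where r: "\<forall>c. c \<in> ic_classes B \<longrightarrow> r c \<in> B \<and> c = ?E `` {r c}" ..
  have "inj_on (\<lambda>c. code (r c)) (ic_classes B)"
  proof (rule inj_onI)
    fix c c' assume c: "c \<in> ic_classes B" "c' \<in> ic_classes B" "code (r c) = code (r c')"
    then have "r c \<equiv>ic r c'" using code r by blast
    then have "?E `` {r c} = ?E `` {r c'}" unfolding ic_class_eq_iff .
    then show "c = c'" using r c(1,2) by metis
  qed
  then show ?thesis unfolding lepoll_def by blast
qed

subsection \<open>At least continuum many\<close>

lemma uncountable_nat_sets: "uncountable (UNIV :: nat set set)"
proof
  assume "countable (UNIV :: nat set set)"
  then obtain f :: "nat \<Rightarrow> nat set" where "range f = UNIV" using uncountable_def by (metis UNIV_not_empty)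
  then obtain n where "f n = {n. n \<notin> f n}" by (metis UNIV_I imageE)
  then show False by blast
qed

text \<open>Numbering the fibres embeds the domain into \<open>range F \<times> UNIV\<close>, and the
  countable factor is absorbed, since the range is infinite.\<close>

lemma countable_fibers_lepoll:
  fixes F :: "nat set \<Rightarrow> 'c"
  assumes fib: "\<And>S. countable {R. F R = F S}"
  shows "(UNIV :: nat set set) \<lesssim> range F"
proof -
  have inj: "inj (\<lambda>S. (F S, to_nat_on {R. F R = F S} S))"
  proof (rule injI)
    fix S R assume e: "(F S, to_nat_on {T. F T = F S} S) = (F R, to_nat_on {T. F T = F R} R)"
    then have FS: "F S = F R" and n: "to_nat_on {T. F T = F S} S = to_nat_on {T. F T = F R} R" 
      unfolding prod.inject by blast+
    have m: "to_nat_on {T. F T = F S} S = to_nat_on {T. F T = F S} R" using n by (simp only: FS)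
    show "S = R" by (rule inj_onD[OF inj_on_to_nat_on[OF fib[of S]] m]) (simp_all add: FS)
  qed
  then have le: "(UNIV :: nat set set) \<lesssim> range F \<times> (UNIV :: nat set)" unfolding lepoll_def by blast
  have inf: "infinite (range F)"
  proof
    assume "finite (range F)"
    then have "countable (range F \<times> (UNIV :: nat set))" by (intro countable_SIGMA) (auto intro: countable_finite)
    then show False using countable_lepoll[OF _ le] uncountable_nat_sets by blast
  qed
  then have "(UNIV :: nat set) \<lesssim> range F" by (simp add: infinite_le_lepoll)
  then have "range F \<times> (UNIV :: nat set) \<lesssim> range F \<times> range F" by (intro times_lepoll_mono) auto
  also have "range F \<times> range F \<approx> range F" by (simp add: eqpoll_iff_card_of_ordIso card_of_Times_same_infinite inf)
  finally show ?thesis using le lepoll_trans by blast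
qed

definition wordat :: "nat \<Rightarrow> (int \<Rightarrow> 'a) \<Rightarrow> 'a list" where
  "wordat M x = map x [- int M..int M]"

lemma wordat_eq_iff: "wordat M x = wordat M y \<longleftrightarrow> agree (int M) x y"
  unfolding wordat_def map_window_eq_iff agree_def by simp

text \<open>Along a dense orbit an isomorphism is a block code, possibly composed with the reversal of time,
  and the orbit closure of the image is the whole target. So up to isomorphism each such subshift
  occurs only countably often over a given finite alphabet.\<close>

lemma countable_isomorphic:
  fixes \<Theta> :: "'i \<Rightarrow> (int \<Rightarrow> 'a) set"
  assumes A: "finite A" "\<And>i x k. x \<in> \<Theta> i \<Longrightarrow> x k \<in> A"
    and crit: "\<And>i. critical (\<Theta> i)" and inj: "inj \<Theta>"
    and x: "x \<in> \<Theta> i0" and dense: "\<And>y N. y \<in> \<Theta> i0 \<Longrightarrow> \<exists>k. agree N (sh k x) y"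
  shows "countable {i. embeds (\<Theta> i0) (\<Theta> i)}"
proof -
  define T where "T = \<Theta> i0"
  have sT: "subsh T" using crit unfolding T_def critical_def by blast
  define oc where "oc y = {z. \<forall>N. \<exists>k. agree N (sh k y) z}" for y :: "int \<Rightarrow> 'a"
  \<comment> \<open>The point with block code \<open>\<phi>\<close> of radius \<open>M\<close>, run through in the direction \<open>e\<close>.\<close>
  define blk where "blk M e \<phi> = (\<lambda>k. \<phi> (wordat M (sh (e * k) x)) :: 'a)" for M and e :: int and \<phi> :: "'a list \<Rightarrow> 'a"
  define Y where "Y = (\<Union>M. \<Union>e\<in>{1, -1}. blk M e ` ((wordat M ` T) \<rightarrow>\<^sub>E A))"
  have finW: "finite (wordat M ` T)" for M
  proof -
    have "wordat M ` T \<subseteq> {w. set w \<subseteq> A \<and> length w = length [- int M..int M]}"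
      using A(2) unfolding wordat_def T_def by auto
    then show ?thesis using finite_lists_length_eq[OF A(1)] finite_subset by blast
  qed
  have "countable Y"
    unfolding Y_def using finW A(1)
    by (intro countable_UN countable_image) (auto intro: countable_finite finite_PiE)
  have main: "\<Theta> i \<in> oc ` Y" if "embeds (\<Theta> i0) (\<Theta> i)" for i
  proof -
    obtain h where h: "emb h T (\<Theta> i)" using \<open>embeds (\<Theta> i0) (\<Theta> i)\<close> unfolding embeds_def T_def by blast
    have cT: "critical T" using crit by (simp add: T_def)
    have sI: "subsh (\<Theta> i)" using crit[of i] unfolding critical_def by blast
    have im: "h ` T = \<Theta> i" by (rule critical_embedding(1)[OF cT crit h])
    have xT: "x \<in> T" using x by (simp add: T_def)
    obtain e :: int where e: "e \<in> {1, -1}" "\<forall>k. h (sh k x) = sh (e * k) (h x)"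
    proof -
      from emb_orbit[OF cT h xT] show thesis
        using that[of 1] that[of "-1"] by auto
    qed
    have e2: "e * (e * k) = k" for k using e(1) by auto
    obtain M0 where M0: "\<forall>u\<in>T. \<forall>v\<in>T. agree M0 u v \<longrightarrow> agree 0 (h u) (h v)" using h unfolding emb_def by blast
    define M where "M = nat M0"
    have M: "h u 0 = h v 0" if "u \<in> T" "v \<in> T" "wordat M u = wordat M v" for u v
    proof -
      have "agree (int M) u v" using that(3) unfolding wordat_eq_iff .
      then have "agree M0 u v" by (rule agree_mono) (simp add: M_def)
      then have "agree 0 (h u) (h v)" using M0 that(1,2) by blast
      then show ?thesis by (rule agreeD) simp
    qed
    define \<phi> where "\<phi> = restrict (\<lambda>w. h (SOME u. u \<in> T \<and> wordat M u = w) 0) (wordat M ` T)"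
    have \<phi>: "\<phi> (wordat M u) = h u 0" if u: "u \<in> T" for u
    proof -
      have s: "(SOME v. v \<in> T \<and> wordat M v = wordat M u) \<in> T \<and>
          wordat M (SOME v. v \<in> T \<and> wordat M v = wordat M u) = wordat M u"
        by (rule someI[of "\<lambda>v. v \<in> T \<and> wordat M v = wordat M u" u]) (simp add: u)
      have "\<phi> (wordat M u) = h (SOME v. v \<in> T \<and> wordat M v = wordat M u) 0"
        unfolding \<phi>_def using u by simp
      also have "\<dots> = h u 0" using M s u by blast
      finally show ?thesis .
    qed
    have \<phi>P: "\<phi> \<in> (wordat M ` T) \<rightarrow>\<^sub>E A"
    proof (rule PiE_I)
      fix w assume "w \<in> wordat M ` T"
      then obtain u where u: "u \<in> T" "w = wordat M u" by blast
      then have "\<phi> w = h u 0" using \<phi> by simp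
      moreover have "h u \<in> \<Theta> i" using u(1) im by blast
      ultimately show "\<phi> w \<in> A" using A(2) by simp
    qed (simp add: \<phi>_def)
    have hx: "h x = blk M e \<phi>"
    proof
      fix k
      have "h x k = sh (e * (e * k)) (h x) 0" unfolding e2 by (simp add: sh_apply)
      also have "\<dots> = h (sh (e * k) x) 0" using e(2) by simp
      also have "\<dots> = blk M e \<phi> k" unfolding blk_def using \<phi>[OF subsh_sh[OF sT xT]] by simp
      finally show "h x k = blk M e \<phi> k" .
    qed
    have "blk M e \<phi> \<in> Y" unfolding Y_def using e(1) \<phi>P by blast
    moreover have "\<Theta> i = oc (h x)"
    proof
      show "oc (h x) \<subseteq> \<Theta> i"
      proof
        fix z assume "z \<in> oc (h x)"
        moreover have "sh k (h x) \<in> \<Theta> i" for k using subsh_sh[OF sI] im xT by blast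
        ultimately show "z \<in> \<Theta> i" unfolding oc_def using wclosedD[OF subsh_wclosed[OF sI], of z] by blast
      qed
      show "\<Theta> i \<subseteq> oc (h x)"
      proof
        fix z assume "z \<in> \<Theta> i"
        then obtain u where u: "u \<in> T" "z = h u" using im by blast
        have "\<exists>k. agree N (sh k (h x)) z" for N
        proof -
          obtain L where L: "\<forall>u\<in>T. \<forall>v\<in>T. agree L u v \<longrightarrow> agree N (h u) (h v)" using h unfolding emb_def by blast
          obtain k where "agree L (sh k x) u" using dense u(1) unfolding T_def by blast
          then have "agree N (h (sh k x)) (h u)" using L subsh_sh[OF sT xT] u(1) by blast
          then show ?thesis using e(2) u(2) by auto
        qed
        then show "z \<in> oc (h x)" unfolding oc_def by blast
      qed
    qed
    ultimately show ?thesis using hx by simp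
  qed
  have "countable (\<Theta> ` {i. embeds (\<Theta> i0) (\<Theta> i)})"
    by (rule countable_subset[OF _ countable_image[OF \<open>countable Y\<close>, of oc]]) (use main in auto)
  then show ?thesis by (rule countable_image_inj_on) (use inj in \<open>auto simp: inj_on_def inj_def\<close>)
qed

text \<open>A member of the basis below a critical graph is equivalent to it. So the family is mapped to the
  classes met by the basis, and by \<open>countable_isomorphic\<close> the fibres are countable.\<close>

lemma ic_classes_continuum:
  fixes B Q :: "(int \<Rightarrow> 'a) tgraph set" and \<Theta> :: "nat set \<Rightarrow> (int \<Rightarrow> 'a) set"
  assumes Q: "\<And>G. G \<in> Q \<Longrightarrow> \<exists>C. G = shift_graph C \<and> subsh C \<and> \<not> colorable C"
    and B: "is_basis Q B"
    and A: "finite A" "\<And>S x k. x \<in> \<Theta> S \<Longrightarrow> x k \<in> A"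
    and crit: "\<And>S. critical (\<Theta> S)" and inQ: "\<And>S. shift_graph (\<Theta> S) \<in> Q" and inj: "inj \<Theta>"
    and dense: "\<And>S. \<exists>x\<in>\<Theta> S. \<forall>y\<in>\<Theta> S. \<forall>N. \<exists>k. agree N (sh k x) y"
  shows "ic_classes B \<approx> (UNIV :: nat set set)"
proof (rule lepoll_antisym)
  show "ic_classes B \<lesssim> (UNIV :: nat set set)"
  proof (rule ic_classes_lepoll)
    show "\<exists>C. G = shift_graph C \<and> subsh C" if "G \<in> B" for G
      using Q B that unfolding is_basis_def by blast
  qed
  have s\<Theta>: "subsh (\<Theta> S)" for S using crit[of S] by (simp add: critical_def)
  have "\<forall>S. \<exists>H. H \<in> B \<and> H \<equiv>ic shift_graph (\<Theta> S)"
  proof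
    fix S
    obtain H where H: "H \<in> B" "H \<preceq>ic shift_graph (\<Theta> S)" using B inQ[of S] unfolding is_basis_def by blast
    then have "H \<in> Q" using B unfolding is_basis_def by blast
    then obtain C where C: "H = shift_graph C" "subsh C" "\<not> colorable C" using Q by blast
    have "embeds C (\<Theta> S)" using H(2) unfolding C(1) ic_le_iff[OF C(2) s\<Theta>] .
    then have "embeds (\<Theta> S) C" by (rule critical_minimal[OF crit C(2,3)])
    then have "shift_graph (\<Theta> S) \<preceq>ic H" unfolding C(1) ic_le_iff[OF s\<Theta> C(2)] .
    then show "\<exists>H. H \<in> B \<and> H \<equiv>ic shift_graph (\<Theta> S)" using H unfolding ic_equiv_def by blast
  qed
  from choice[OF this] obtain H where H: "\<forall>S. H S \<in> B \<and> H S \<equiv>ic shift_graph (\<Theta> S)" ..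
  define F where "F S = {(G :: (int \<Rightarrow> 'a) tgraph, H :: (int \<Rightarrow> 'a) tgraph). G \<equiv>ic H} `` {H S}" for S
  have "countable {R. F R = F S}" for S
  proof -
    obtain x where x: "x \<in> \<Theta> S" "\<forall>y\<in>\<Theta> S. \<forall>N. \<exists>k. agree N (sh k x) y" using dense by blast
    have c: "countable {R. embeds (\<Theta> S) (\<Theta> R)}"
      by (rule countable_isomorphic[where A = A and \<Theta> = \<Theta> and x = x])
        (fact A crit inj x(1) | use x(2) in blast)+
    have "{R. F R = F S} \<subseteq> {R. embeds (\<Theta> S) (\<Theta> R)}"
    proof
      fix R assume "R \<in> {R. F R = F S}"
      then have "H R \<equiv>ic H S" unfolding F_def mem_Collect_eq ic_class_eq_iff .
      then have "shift_graph (\<Theta> S) \<equiv>ic shift_graph (\<Theta> R)" using H ic_equiv_sym ic_equiv_trans by metis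
      then show "R \<in> {R. embeds (\<Theta> S) (\<Theta> R)}" unfolding ic_equiv_def ic_le_iff[OF s\<Theta> s\<Theta>] by blast
    qed
    then show ?thesis using c countable_subset by blast
  qed
  then have "(UNIV :: nat set set) \<lesssim> range F" by (rule countable_fibers_lepoll)
  moreover have "range F \<subseteq> ic_classes B" unfolding F_def ic_classes_def quotient_def using H by blast
  ultimately show "(UNIV :: nat set set) \<lesssim> ic_classes B" using subset_imp_lepoll lepoll_trans by blast
qed

section \<open>Continuum many critical subshifts of rank three\<close>

lemma int_less_power:
  assumes "b > (1 :: int)" shows "int n < b ^ n"
proof (induction n)
  case (Suc n)
  then have "0 < b ^ n" by linarith
  then have "2 * b ^ n \<le> b * b ^ n" using assms by (intro mult_right_mono) auto
  then show ?case using Suc \<open>0 < b ^ n\<close> unfolding power_Suc of_nat_Suc by linarith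
qed simp

context symbols
begin

text \<open>The orbit of \<open>xb S\<close> starts along the two-periodic point \<open>pb\<close>, changes
  its phase once and then meets rarer and rarer marks, each of which looks like the single mark of
  \<open>zb\<close>. Membership of \<open>n\<close> in \<open>S\<close> moves the
  \<open>n\<close>-th mark by two, which preserves its parity.\<close>

definition marks :: "nat set \<Rightarrow> int set" where
  "marks S = {2 * 4 ^ n + (if n \<in> S then 2 else 0) |n. True}"

definition pb :: "int \<Rightarrow> 'a" where
  "pb k = d (nat (k mod 2))"

definition zb :: "int \<Rightarrow> 'a" where
  "zb k = d (nat ((k + 1) mod 2) + (if k = 0 then 2 else 0))"

definition xb :: "nat set \<Rightarrow> int \<Rightarrow> 'a" where
  "xb S k = (if k < 0 then d (nat (k mod 2)) else d (nat ((k + 1) mod 2) + (if k \<in> marks S then 2 else 0)))"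

definition Qb :: "(int \<Rightarrow> 'a) set" where "Qb = orb pb \<union> orb zb"

definition \<Theta>b :: "nat set \<Rightarrow> (int \<Rightarrow> 'a) set" where "\<Theta>b S = orb (xb S) \<union> Qb"

text \<open>A mark adds two to the index of a symbol, so the parity of the index does not see the marks, only
  the phase.\<close>

definition odd_symbol :: "'a \<Rightarrow> bool" where "odd_symbol s \<longleftrightarrow> (\<exists>j. s = d j \<and> odd j)"

lemma odd_symbol_d [simp]: "odd_symbol (d j) \<longleftrightarrow> odd j"
  unfolding odd_symbol_def by auto

lemma even_nat_mod2: "even (nat (k mod 2)) \<longleftrightarrow> even (k :: int)"
  by (simp add: even_nat_iff)

lemma odd_pb: "odd_symbol (pb k) \<longleftrightarrow> odd k"
  unfolding pb_def by (simp add: even_nat_mod2)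

lemma odd_zb: "odd_symbol (zb k) \<longleftrightarrow> even k"
  unfolding zb_def using even_nat_mod2[of "k + 1"] by simp

lemma odd_xb: "odd_symbol (xb S k) \<longleftrightarrow> (if k < 0 then odd k else even k)"
  unfolding xb_def using even_nat_mod2[of k] even_nat_mod2[of "k + 1"] by simp

lemma marks_even: "t \<in> marks S \<Longrightarrow> even t"
  by (auto simp: marks_def)

lemma marks_ge2: "t \<in> marks S \<Longrightarrow> t \<ge> 2"
proof -
  assume "t \<in> marks S"
  then obtain n :: nat where n: "t = 2 * 4 ^ n + (if n \<in> S then 2 else 0)" unfolding marks_def by blast
  have "(1 :: int) \<le> 4 ^ n" by simp
  then show ?thesis unfolding n by simp
qed

lemma marks_gap:
  assumes "s \<in> marks S" "t \<in> marks S" "s < t" shows "s + s \<le> t"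
proof -
  obtain n :: nat where n: "s = 2 * 4 ^ n + (if n \<in> S then 2 else 0)" using assms(1) unfolding marks_def by blast
  obtain m :: nat where m: "t = 2 * 4 ^ m + (if m \<in> S then 2 else 0)" using assms(2) unfolding marks_def by blast
  have pos: "(1 :: int) \<le> 4 ^ k" for k by simp
  have bd: "2 * 4 ^ n \<le> s" "s \<le> 2 * 4 ^ n + 2" "2 * 4 ^ m \<le> t" "t \<le> 2 * 4 ^ m + 2" using n m by auto
  have "n < m"
  proof (rule ccontr)
    assume "\<not> n < m"
    then have "n = m \<or> m < n" by auto
    then show False
    proof
      assume "n = m" then show False using n m assms(3) by simp
    next
      assume "m < n"
      then have "(4 :: int) ^ Suc m \<le> 4 ^ n" by (intro power_increasing) auto
      then have "4 * (4 :: int) ^ m \<le> 4 ^ n" by simp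
      then show False using bd assms(3) pos[of m] by linarith
    qed
  qed
  then have "(4 :: int) ^ Suc n \<le> 4 ^ m" by (intro power_increasing) auto
  then have "4 * (4 :: int) ^ n \<le> 4 ^ m" by simp
  then show ?thesis using bd pos[of n] by linarith
qed

lemma marks_unbounded: "\<exists>t\<in>marks S. K \<le> t"
proof -
  let ?t = "2 * 4 ^ nat K + (if nat K \<in> S then 2 else 0) :: int"
  have "int (nat K) < 4 ^ nat K" by (rule int_less_power) simp
  moreover have "(0 :: int) \<le> (if nat K \<in> S then 2 else 0)" by simp
  ultimately have "K \<le> ?t" by linarith
  moreover have "?t \<in> marks S" unfolding marks_def by blast
  ultimately show ?thesis by blast
qed

lemma marks_inj:
  assumes "marks S = marks R" shows "S = R"
proof -
  have key: "n \<in> S \<longleftrightarrow> 2 * 4 ^ n + 2 \<in> marks S" for n S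
  proof
    assume "2 * 4 ^ n + 2 \<in> marks S"
    then obtain m :: nat where m: "2 * 4 ^ n + 2 = 2 * 4 ^ m + (if m \<in> S then 2 else 0 :: int)"
      unfolding marks_def by blast
    show "n \<in> S"
    proof (cases "m \<in> S")
      case True
      then have "(4 :: int) ^ n = 4 ^ m" using m by simp
      then have "n = m" by simp
      then show ?thesis using True by simp
    next
      case False
      then have e: "(4 :: int) ^ n + 1 = 4 ^ m" using m by simp
      show ?thesis
      proof (cases "n = 0")
        case True
        then have "m \<noteq> 0" using e by (intro notI) simp
        then have "(4 :: int) ^ 1 \<le> 4 ^ m" by (intro power_increasing) auto
        then show ?thesis using e True by simp
      next
        case n: False
        then have "odd ((4 :: int) ^ m)" using e[symmetric] by simp
        then have "m = 0" by (cases m) auto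
        then show ?thesis using e by simp
      qed
    qed
  qed (auto simp: marks_def)
  show ?thesis using key[of _ S] key[of _ R] assms by blast
qed

lemma pb_sh: "even k \<Longrightarrow> sh k pb = pb"
  unfolding pb_def sh_def by (intro ext) (simp add: mod_add_right_eq[symmetric] dvd_eq_mod_eq_0)

lemma per_pb: "periodic pb"
  unfolding periodic_def using pb_sh[of 2] by (intro exI[of _ 2]) simp

lemma zb_bwd: "bwd zb (sh 1 pb)"
  unfolding bwd_def by (intro exI[of _ "-1"]) (auto simp: zb_def pb_def sh_apply)

lemma zb_fwd: "fwd zb (sh 1 pb)"
  unfolding fwd_def by (intro exI[of _ 1]) (auto simp: zb_def pb_def sh_apply)

lemma Qb_hetsys: "hetsys {pb, zb} Qb"
  unfolding hetsys_def
proof (intro conjI ballI)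
  show "Qb = (\<Union>e\<in>{pb, zb}. orb e)" unfolding Qb_def by auto
  have q: "pb \<in> Qb" "sh 1 pb \<in> Qb" unfolding Qb_def by auto
  fix e assume "e \<in> {pb, zb}"
  then consider "e = pb" | "e = zb" by blast
  then have "(\<exists>q\<in>Qb. periodic q \<and> fwd e q) \<and> (\<exists>q\<in>Qb. periodic q \<and> bwd e q)"
  proof cases
    case 1
    then show ?thesis using q(1) per_pb fwd_refl bwd_refl by blast
  next
    case 2
    have "periodic (sh 1 pb)" using per_pb by simp
    then show ?thesis using 2 q(2) zb_fwd zb_bwd by blast
  qed
  then show "\<exists>q\<in>Qb. periodic q \<and> fwd e q" "\<exists>q\<in>Qb. periodic q \<and> bwd e q" by blast+
qed simp

lemma Qb_alt:
  assumes "y \<in> Qb" shows "odd_symbol (y (k + 1)) \<noteq> odd_symbol (y k)"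
proof -
  have "\<exists>j. y = sh j pb \<or> y = sh j zb" using assms orbD[of y pb] orbD[of y zb] unfolding Qb_def by auto
  then obtain j where "y = sh j pb \<or> y = sh j zb" ..
  then show ?thesis
  proof
    assume y: "y = sh j pb"
    show ?thesis unfolding y sh_apply odd_pb by auto
  next
    assume y: "y = sh j zb"
    show ?thesis unfolding y sh_apply odd_zb by auto
  qed
qed

text \<open>The change of phase is the only place where the parity fails to alternate. It locates the origin
  in the orbit and keeps the orbit away from \<open>Qb\<close>.\<close>

lemma xb_break: "odd_symbol (xb S (k + 1)) = odd_symbol (xb S k) \<longleftrightarrow> k = -1"
  unfolding odd_xb by auto

lemma xb_notin: "sh k (xb S) \<notin> Qb"
proof
  assume "sh k (xb S) \<in> Qb"
  from Qb_alt[OF this, of "- 1 - k"] show False using xb_break[of S "-1"] by (simp add: sh_apply algebra_simps)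
qed

lemma xb_nonper: "sh k (xb S) = xb R \<Longrightarrow> k = 0"
proof -
  assume e: "sh k (xb S) = xb R"
  have "odd_symbol (xb R (- 1 + 1)) = odd_symbol (xb R (- 1))" unfolding xb_break by simp
  then have "odd_symbol (xb S (- 1 + k + 1)) = odd_symbol (xb S (- 1 + k))"
    unfolding e[symmetric] sh_apply by (simp add: algebra_simps)
  then show "k = 0" unfolding xb_break by simp
qed

lemma xb_neg: "N \<ge> 0 \<Longrightarrow> k < - N \<Longrightarrow> agree N (sh k (xb S)) (sh k pb)"
  unfolding agree_def sh_apply xb_def pb_def by auto

text \<open>Each mark lies at least twice as far out as the previous one, so around a late mark there is no
  other one.\<close>

lemma xb_mark:
  assumes t: "t \<in> marks S" "N \<ge> 0" "t > 2 * N" shows "agree N (sh t (xb S)) zb"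
  unfolding agree_def
proof (intro allI impI)
  fix k :: int assume k: "\<bar>k\<bar> \<le> N"
  have "k + t \<in> marks S \<longleftrightarrow> k = 0"
  proof
    assume m: "k + t \<in> marks S"
    show "k = 0"
    proof (rule ccontr)
      assume "k \<noteq> 0"
      then consider "k + t < t" | "t < k + t" by linarith
      then show False
      proof cases
        case 1
        then show False using marks_gap[OF m t(1) 1] abs_le_D1[OF k] abs_le_D2[OF k] t by linarith
      next
        case 2
        then show False using marks_gap[OF t(1) m 2] abs_le_D1[OF k] abs_le_D2[OF k] t by linarith
      qed
    qed
  qed (use t in simp)
  moreover have "(k + t + 1) mod 2 = (k + 1) mod 2"
    using marks_even[OF t(1)] by presburger
  ultimately show "sh t (xb S) k = zb k" using k t unfolding sh_apply xb_def zb_def by auto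
qed

text \<open>Beyond the bound a window meets at most one mark, because the gaps between marks grow.\<close>

lemma xb_pos:
  assumes N: "N \<ge> 0" and k: "k > 3 * N + 3" shows "\<exists>q\<in>Qb. agree N (sh k (xb S)) q"
proof (cases "\<exists>t\<in>marks S. \<bar>t - k\<bar> \<le> N")
  case True
  then obtain t where t: "t \<in> marks S" "\<bar>t - k\<bar> \<le> N" by blast
  show ?thesis
  proof (intro bexI[of _ "sh (k - t) zb"])
    show "sh (k - t) zb \<in> Qb" unfolding Qb_def by simp
    show "agree N (sh k (xb S)) (sh (k - t) zb)"
      unfolding agree_def
    proof (intro allI impI)
      fix j :: int assume j: "\<bar>j\<bar> \<le> N"
      have "j + k \<in> marks S \<longleftrightarrow> j + (k - t) = 0"
      proof
        assume m: "j + k \<in> marks S"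
        show "j + (k - t) = 0"
        proof (rule ccontr)
          assume "j + (k - t) \<noteq> 0"
          then consider "j + k < t" | "t < j + k" by linarith
          then show False
          proof cases
            case 1
            then show False using marks_gap[OF m t(1) 1] abs_le_D1[OF j] abs_le_D2[OF j] abs_le_D1[OF t(2)] abs_le_D2[OF t(2)] k by linarith
          next
            case 2
            then show False using marks_gap[OF t(1) m 2] abs_le_D1[OF j] abs_le_D2[OF j] abs_le_D1[OF t(2)] abs_le_D2[OF t(2)] k N by linarith
          qed
        qed
      next
        assume "j + (k - t) = 0"
        then have "j + k = t" by simp
        then show "j + k \<in> marks S" using t(1) by simp
      qed
      moreover have "(j + k + 1) mod 2 = (j + (k - t) + 1) mod 2"
        using marks_even[OF t(1)] by presburger
      ultimately show "sh k (xb S) j = sh (k - t) zb j" using j k N unfolding sh_apply xb_def zb_def by auto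
    qed
  qed
next
  case False
  show ?thesis
  proof (intro bexI[of _ "sh (k + 1) pb"])
    show "sh (k + 1) pb \<in> Qb" unfolding Qb_def by simp
    show "agree N (sh k (xb S)) (sh (k + 1) pb)"
      unfolding agree_def
    proof (intro allI impI)
      fix j :: int assume j: "\<bar>j\<bar> \<le> N"
      have "j + k \<notin> marks S" using False j by force
      then show "sh k (xb S) j = sh (k + 1) pb j" using j k N unfolding sh_apply xb_def pb_def by (simp add: add.assoc)
    qed
  qed
qed

lemma \<Theta>b_piece:
  assumes "U \<subseteq> orb (xb S)" shows "wclosed (U \<union> Qb)"
proof (rule wclosed_orbit_piece[OF subsh_wclosed[OF hetsys_subsh[OF Qb_hetsys]] assms])
  fix N :: int
  define M where "M = max 0 N"
  have far: "\<exists>q\<in>Qb. agree N (sh k (xb S)) q" if k: "3 * M + 4 \<le> \<bar>k\<bar>" for k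
  proof (cases "k < 0")
    case True
    then have "k < - M" "M \<ge> 0" using k M_def by linarith+
    then have "agree M (sh k (xb S)) (sh k pb)" by (intro xb_neg)
    then have "agree N (sh k (xb S)) (sh k pb)" by (rule agree_mono) (simp add: M_def)
    then show ?thesis by (intro bexI[of _ "sh k pb"]) (simp_all add: Qb_def)
  next
    case False
    then have "k > 3 * M + 3" using k by linarith
    then have "\<exists>q\<in>Qb. agree M (sh k (xb S)) q" by (intro xb_pos) (simp_all add: M_def)
    then obtain q where q: "q \<in> Qb" "agree M (sh k (xb S)) q" ..
    have "agree N (sh k (xb S)) q" by (rule agree_mono[OF q(2)]) (simp add: M_def)
    then show ?thesis using q(1) ..
  qed
  show "\<exists>K. \<forall>k. K \<le> \<bar>k\<bar> \<and> sh k (xb S) \<in> U \<longrightarrow> (\<exists>q\<in>Qb. agree N (sh k (xb S)) q)"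
    by (intro exI[of _ "3 * M + 4"] allI impI far) (rule conjunct1)
qed

lemma \<Theta>b_alphabet: "x \<in> \<Theta>b S \<Longrightarrow> x k \<in> d ` {..<4}"
proof -
  have b: "nat (i mod 2) < 2" for i :: int by (simp add: nat_less_iff)
  have "pb i \<in> d ` {..<4}" "zb i \<in> d ` {..<4}" "xb S i \<in> d ` {..<4}" for i
    unfolding pb_def zb_def xb_def using b[of i] b[of "i + 1"] by auto
  then show "x \<in> \<Theta>b S \<Longrightarrow> x k \<in> d ` {..<4}" unfolding \<Theta>b_def Qb_def orb_eq by (auto simp: sh_apply)
qed

lemma \<Theta>b_sh: "x \<in> \<Theta>b S \<Longrightarrow> sh k x \<in> \<Theta>b S"
  unfolding \<Theta>b_def Qb_def using sh_orb by blast

lemma \<Theta>b_subsh: "subsh (\<Theta>b S)"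
  unfolding subsh_def
proof (intro conjI ballI allI)
  show "\<exists>A. finite A \<and> (\<forall>x\<in>\<Theta>b S. \<forall>k. x k \<in> A)"
    using \<Theta>b_alphabet by (intro exI[of _ "d ` {..<4}"]) auto
  show "wclosed (\<Theta>b S)" unfolding \<Theta>b_def by (rule \<Theta>b_piece) (rule order_refl)
qed (rule \<Theta>b_sh)

lemma \<Theta>b_countable: "countable (\<Theta>b S)"
  unfolding \<Theta>b_def Qb_def by (simp add: countable_orb)

lemma \<Theta>b_lim: "lim_pts (\<Theta>b S) \<subseteq> Qb"
proof
  fix z assume z: "z \<in> lim_pts (\<Theta>b S)"
  show "z \<in> Qb"
  proof (rule ccontr)
    assume nz: "z \<notin> Qb"
    have "wclosed ((orb (xb S) - {z}) \<union> Qb)" by (rule \<Theta>b_piece) auto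
    moreover have "(orb (xb S) - {z}) \<union> Qb = \<Theta>b S - {z}" using nz unfolding \<Theta>b_def by blast
    ultimately show False using wclosed_remove_lim[of "\<Theta>b S" z] z by simp
  qed
qed

lemma \<Theta>b_rank: "cb_rank (subshift_topology (\<Theta>b S)) \<le> ord_of_nat 3"
proof (rule cb_rank_le_3)
  have "lim_pts (lim_pts (lim_pts (\<Theta>b S))) \<subseteq> lim_pts (lim_pts Qb)"
    by (intro lim_pts_mono \<Theta>b_lim)
  then show "lim_pts (lim_pts (lim_pts (\<Theta>b S))) = {}" using hetsys_lim_pts2[OF Qb_hetsys] by simp
qed

lemma \<Theta>b_dense:
  assumes y: "y \<in> \<Theta>b S" shows "\<exists>k. agree N (sh k (xb S)) y"
proof -
  have "\<exists>j. y = sh j (xb S) \<or> y = sh j pb \<or> y = sh j zb"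
    using y orbD[of y "xb S"] orbD[of y pb] orbD[of y zb] unfolding \<Theta>b_def Qb_def by auto
  then obtain j where "y = sh j (xb S) \<or> y = sh j pb \<or> y = sh j zb" ..
  then consider "y = sh j (xb S)" | "y = sh j pb" | "y = sh j zb" by blast
  then show ?thesis
  proof cases
    case 1
    then show ?thesis using agree_refl by blast
  next
    case 2
    define k where "k = j + (- 2 * (\<bar>N\<bar> + \<bar>j\<bar> + 1))"
    have "agree \<bar>N\<bar> (sh k (xb S)) (sh k pb)" by (rule xb_neg) (auto simp: k_def)
    moreover have "sh k pb = sh j pb" unfolding k_def by (rule sh_add_eq, rule pb_sh) simp
    ultimately have "agree \<bar>N\<bar> (sh k (xb S)) y" using 2 by simp
    then have "agree N (sh k (xb S)) y" by (rule agree_mono) simp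
    then show ?thesis by blast
  next
    case 3
    obtain t where t: "t \<in> marks S" "2 * (\<bar>N\<bar> + \<bar>j\<bar>) + 1 \<le> t" using marks_unbounded by blast
    have "agree (\<bar>N\<bar> + \<bar>j\<bar>) (sh t (xb S)) zb" by (rule xb_mark) (use t in auto)
    then have "agree N (sh j (sh t (xb S))) (sh j zb)" by (rule agree_sh) simp
    then show ?thesis unfolding 3 by auto
  qed
qed

lemma \<Theta>b_in: "xb S \<in> \<Theta>b S" "pb \<in> \<Theta>b S" "zb \<in> \<Theta>b S"
  unfolding \<Theta>b_def Qb_def by auto

text \<open>The phase change at the origin contradicts a colouring: the colour of \<open>xb S\<close> agrees with that
  of \<open>pb\<close> on the left, and with that of \<open>zb\<close>, which runs in the other phase, at the marks.\<close>

lemma \<Theta>b_noncolorable: "\<not> colorable (\<Theta>b S)"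
proof
  let ?X = "\<Theta>b S"
  have X: "subsh ?X" by (rule \<Theta>b_subsh)
  assume "colorable ?X"
  then obtain c :: "_ \<Rightarrow> bool" and M where M: "\<forall>x\<in>?X. \<forall>y\<in>?X. agree M x y \<longrightarrow> c x = c y"
    and c: "\<forall>x\<in>?X. sh 1 x \<noteq> x \<longrightarrow> c (sh 1 x) \<noteq> c x" by (rule colorableE)
  have np: "sh 1 y \<noteq> y" if "y \<in> Qb" for y
  proof
    assume "sh 1 y = y"
    then have "y (0 + 1) = y 0" using sh_apply[of 1 y 0] by simp
    then show False using Qb_alt[OF that, of 0] by simp
  qed
  have Q: "pb \<in> Qb" "zb \<in> Qb" "sh 1 pb \<in> Qb" unfolding Qb_def by auto
  have nx: "sh 1 (xb S) \<noteq> xb S" using xb_nonper[of 1 S S] by auto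
  have "bwd (xb S) pb" unfolding bwd_def xb_def pb_def by (intro exI[of _ "-1"]) auto
  then have 1: "c (xb S) = c pb"
    by (rule color_bwd[OF X c M \<Theta>b_in(1) nx \<Theta>b_in(2) np[OF Q(1)]])
  have 2: "c zb = c (sh 1 pb)"
    by (rule color_fwd[OF X c M \<Theta>b_in(3) np[OF Q(2)] \<Theta>b_sh[OF \<Theta>b_in(2)] np[OF Q(3)] zb_fwd])
  have 3: "c (sh 1 pb) \<noteq> c pb" using c \<Theta>b_in(2) np[OF Q(1)] by blast
  obtain t where t: "t \<in> marks S" "2 * \<bar>M\<bar> + 1 \<le> t" using marks_unbounded by blast
  have "agree \<bar>M\<bar> (sh t (xb S)) zb" by (rule xb_mark) (use t in auto)
  then have "agree M (sh t (xb S)) zb" by (rule agree_mono) simp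
  then have "c (sh t (xb S)) = c zb" using M \<Theta>b_sh[OF \<Theta>b_in(1)] \<Theta>b_in(3) by blast
  moreover have "c (sh t (xb S)) = c (xb S)"
    using color_alternates[OF X c \<Theta>b_in(1) nx, of t] marks_even[OF t(1)] by simp
  ultimately show False using 1 2 3 by simp
qed

text \<open>The orbit of \<open>xb S\<close> is dense, so a proper subshift lies in \<open>Qb\<close>, where
  the parity alternates.\<close>

lemma \<Theta>b_critical: "critical (\<Theta>b S)"
proof -
  have "colorable D" if D: "subsh D" "D \<subset> \<Theta>b S" for D
  proof -
    have "xb S \<notin> D"
    proof
      assume x: "xb S \<in> D"
      have "y \<in> D" if y: "y \<in> \<Theta>b S" for y
      proof (rule wclosedD[OF subsh_wclosed[OF D(1)]])
        fix N
        show "\<exists>z\<in>D. agree N z y" using \<Theta>b_dense[OF y, of N] subsh_sh[OF D(1) x] by blast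
      qed
      then show False using D(2) by blast
    qed
    have inQ: "y \<in> Qb" if y: "y \<in> D" for y
    proof (rule ccontr)
      assume "y \<notin> Qb"
      then have "y \<in> orb (xb S)" using y D(2) unfolding \<Theta>b_def by auto
      then obtain k where "y = sh k (xb S)" using orbD[of y "xb S"] by auto
      then have "xb S = sh (- k) y" by simp
      then show False using \<open>xb S \<notin> D\<close> subsh_sh[OF D(1) y] by metis
    qed
    show ?thesis
    proof (rule colorable_by_symbol[where \<kappa> = odd_symbol])
      fix y assume "y \<in> D"
      from Qb_alt[OF inQ[OF this], of 0] show "odd_symbol (y 1) \<noteq> odd_symbol (y 0)" by simp
    qed
  qed
  then show ?thesis unfolding critical_def using \<Theta>b_subsh \<Theta>b_noncolorable by blast
qed

lemma \<Theta>b_inj: "inj \<Theta>b"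
proof (rule injI)
  fix S R assume e: "\<Theta>b S = \<Theta>b R"
  have "xb S \<notin> Qb" using xb_notin[of 0 S] by simp
  then have "xb S \<in> orb (xb R)" using \<Theta>b_in(1)[of S] e unfolding \<Theta>b_def by blast
  then obtain k where k: "xb S = sh k (xb R)" using orbD[of "xb S" "xb R"] by auto
  then have "k = 0" using xb_nonper[of k R S] by simp
  then have eq: "xb S = xb R" using k by simp
  have mk: "t \<in> marks U \<longleftrightarrow> 0 \<le> t \<and> xb U t \<in> {d 2, d 3}" for t U
  proof -
    have b: "nat ((t + 1) mod 2) < 2" by (simp add: nat_less_iff)
    have "0 \<le> t" if "t \<in> marks U" using marks_ge2[OF that] by simp
    then show ?thesis using b unfolding xb_def by auto
  qed
  have "marks S = marks R" by (intro set_eqI) (simp only: mk eq)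
  then show "S = R" by (rule marks_inj)
qed

end

section \<open>Continuum many perfect critical subshifts\<close>

text \<open>A Toeplitz sequence: the value at \<open>k\<close> depends on the lowest nonzero digit of
  \<open>k\<close> in base three and, if this digit is two, on whether \<open>S\<close> contains its
  position. The periods of its skeleton are odd, which is what excludes colourings.\<close>

function xt :: "nat set \<Rightarrow> int \<Rightarrow> nat" where
  "xt S k = (if k = 0 \<or> k mod 3 = 1 then 0 else if k mod 3 = 2 then (if 0 \<in> S then 2 else 1)
     else xt {n. Suc n \<in> S} (k div 3))"
  by pat_completeness auto
termination
proof (relation "Wellfounded.measure (\<lambda>(S, k). nat \<bar>k\<bar>)")
  fix S :: "nat set" and k :: int
  assume k: "\<not> (k = 0 \<or> k mod 3 = 1)" "k mod 3 \<noteq> 2"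
  then have "k mod 3 = 0" "k \<noteq> 0" by linarith+
  then have "3 * (k div 3) = k" by (metis add.right_neutral mult_div_mod_eq)
  then have "\<bar>k div 3\<bar> < \<bar>k\<bar>" using \<open>k \<noteq> 0\<close> by linarith
  then show "(({n. Suc n \<in> S}, k div 3), S, k) \<in> Wellfounded.measure (\<lambda>(S, k). nat \<bar>k\<bar>)" by simp
qed simp

declare xt.simps [simp del]

lemma xt_0 [simp]: "xt S 0 = 0" and xt_1: "k mod 3 = 1 \<Longrightarrow> xt S k = 0"
  and xt_2: "k mod 3 = 2 \<Longrightarrow> xt S k = (if 0 \<in> S then 2 else 1)"
  by (simp_all add: xt.simps, auto)

lemma xt_3: "xt S (3 * k) = xt {n. Suc n \<in> S} k"
  by (cases "k = 0") (simp, subst xt.simps, simp)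

lemma xt_le: "xt S k \<le> 2"
  by (induction S k rule: xt.induct) (subst xt.simps, simp)

lemma mod3_cases: "(k mod 3 = 1 \<or> k mod 3 = 2 \<or> (\<exists>j. k = 3 * j))" for k :: int
proof -
  have "k mod 3 = 1 \<or> k mod 3 = 2 \<or> k mod 3 = 0" by linarith
  then show ?thesis by (metis add.right_neutral mult_div_mod_eq)
qed

lemma xt_skeleton: "j \<noteq> 0 \<Longrightarrow> \<bar>j\<bar> < 3 ^ n \<Longrightarrow> xt S (j + 3 ^ n * t) = xt S j"
proof (induction n arbitrary: S j)
  case (Suc n)
  have m: "(j + 3 ^ Suc n * t) mod 3 = j mod 3" by (simp add: mult.assoc)
  consider "j mod 3 = 1" | "j mod 3 = 2" | i where "j = 3 * i" using mod3_cases by blast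
  then show ?case
  proof cases
    case 3
    then have "i \<noteq> 0" "\<bar>i\<bar> < 3 ^ n" using Suc.prems by auto
    then have "xt {n. Suc n \<in> S} (i + 3 ^ n * t) = xt {n. Suc n \<in> S} i" by (rule Suc.IH)
    moreover have "j + 3 ^ Suc n * t = 3 * (i + 3 ^ n * t)" using 3 by simp
    ultimately show ?thesis unfolding 3 using xt_3 by metis
  qed (use m xt_1 xt_2 in metis)+
qed simp

text \<open>Together with \<open>xt_skeleton\<close>, which leaves out the entry at zero, this yields the
  return times to the window around the origin.\<close>

lemma xt_zero: "xt S (3 ^ n * (3 * t + 1)) = 0"
proof (induction n arbitrary: S)
  case 0
  show ?case by (rule xt_1) simp
next
  case (Suc n)
  have "(3 :: int) ^ Suc n * (3 * t + 1) = 3 * (3 ^ n * (3 * t + 1))" by simp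
  then show ?case using Suc xt_3 by metis
qed

lemma xt_aperiodic: "k \<noteq> 0 \<Longrightarrow> xt S k \<noteq> 0 \<or> xt S (2 * k) \<noteq> 0"
proof (induction S k rule: xt.induct)
  case (1 S k)
  consider "k mod 3 = 1" | "k mod 3 = 2" | i where "k = 3 * i" using mod3_cases by blast
  then show ?case
  proof cases
    case 1
    then have "(2 * k) mod 3 = 2" by presburger
    then show ?thesis using xt_2 by simp
  next
    case 2
    then show ?thesis using xt_2 by simp
  next
    case 3
    then have "xt {n. Suc n \<in> S} (k div 3) \<noteq> 0 \<or> xt {n. Suc n \<in> S} (2 * (k div 3)) \<noteq> 0"
      using "1.IH" "1.prems" by simp
    moreover have "xt S k = xt {n. Suc n \<in> S} (k div 3)" "xt S (2 * k) = xt {n. Suc n \<in> S} (2 * (k div 3))"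
      using 3 xt_3[of S i] xt_3[of S "2 * i"] by simp_all
    ultimately show ?thesis by simp
  qed
qed

text \<open>The zeros of the sequence fill the residue class of one modulo three, whereas each of the other
  two classes contains a nonzero value at a place between 2 and 6. So a window of radius six
  determines a shift modulo three, and division by three lowers \<open>v\<close>.\<close>

lemma xt_determines:
  "\<forall>N. \<exists>s. \<forall>k. \<bar>k\<bar> \<le> N \<longrightarrow> xt R (k + s) = xt S k \<Longrightarrow> v \<in> S \<longleftrightarrow> v \<in> R"
proof (induction v arbitrary: S R)
  have res: "s mod 3 = 0" if s: "\<forall>k. \<bar>k\<bar> \<le> N \<longrightarrow> xt R (k + s) = xt S k" "N \<ge> 6" for N s S R
  proof (rule ccontr)
    assume "s mod 3 \<noteq> 0"
    then consider "s mod 3 = 1" | "s mod 3 = 2" by linarith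
    then show False
    proof cases
      case 1
      then have "(6 + s) mod 3 = 1" by presburger
      then have "xt R (6 + s) = 0" by (rule xt_1)
      then have "xt S 6 = 0" using s(1)[rule_format, of 6] s(2) by simp
      moreover have "xt S 6 = xt {n. Suc n \<in> S} 2" using xt_3[of S 2] by simp
      ultimately show False using xt_2[of 2] by (simp split: if_splits)
    next
      case 2
      then have "(2 + s) mod 3 = 1" by presburger
      then have "xt R (2 + s) = 0" by (rule xt_1)
      moreover have "xt R (2 + s) = xt S 2" using s(1)[rule_format, of 2] s(2) by simp
      ultimately have "xt S 2 = 0" by simp
      then show False using xt_2[of 2] by (simp split: if_splits)
    qed
  qed
  {
    case 0
    then obtain s where s: "\<forall>k. \<bar>k\<bar> \<le> 6 \<longrightarrow> xt R (k + s) = xt S k" by blast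
    have "s mod 3 = 0" by (rule res[OF s]) simp
    then have "(2 + s) mod 3 = 2" by presburger
    then have 1: "xt R (2 + s) = (if 0 \<in> R then 2 else 1)" by (rule xt_2)
    have 2: "xt S 2 = (if 0 \<in> S then 2 else 1)" by (rule xt_2) simp
    have "xt R (2 + s) = xt S 2" by (rule s[rule_format]) simp
    then have "(if 0 \<in> R then 2 else 1 :: nat) = (if 0 \<in> S then 2 else 1)" unfolding 1 2 .
    then show ?case by (simp split: if_splits)
  next
    case (Suc v)
    have "\<exists>s. \<forall>k. \<bar>k\<bar> \<le> N \<longrightarrow> xt {n. Suc n \<in> R} (k + s) = xt {n. Suc n \<in> S} k" for N
    proof -
      obtain s where s: "\<forall>k. \<bar>k\<bar> \<le> max 6 (3 * N) \<longrightarrow> xt R (k + s) = xt S k" using Suc.prems by blast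
      have "s mod 3 = 0" using res[OF s] by simp
      then obtain i where i: "s = 3 * i" by auto
      have "xt {n. Suc n \<in> R} (k + i) = xt {n. Suc n \<in> S} k" if "\<bar>k\<bar> \<le> N" for k
      proof -
        have "\<bar>3 * k\<bar> \<le> max 6 (3 * N)" using that by (simp add: abs_mult)
        then have "xt R (3 * k + s) = xt S (3 * k)" using s by blast
        moreover have "3 * k + s = 3 * (k + i)" using i by simp
        ultimately show ?thesis using xt_3 by metis
      qed
      then show ?thesis by blast
    qed
    then show ?case using Suc.IH[of "{n. Suc n \<in> R}" "{n. Suc n \<in> S}"] by simp
  }
qed

context symbols
begin

definition xc :: "nat set \<Rightarrow> int \<Rightarrow> 'a" where "xc S k = d (xt S k)"

text \<open>The orbit closure of \<open>xc S\<close>.\<close>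

definition \<Theta>c :: "nat set \<Rightarrow> (int \<Rightarrow> 'a) set" where
  "\<Theta>c S = {y. \<forall>N. \<exists>s. agree N (sh s (xc S)) y}"

lemma xc_recurs: "\<exists>n. \<forall>t. agree N (sh (3 ^ n * (3 * t + 1)) (xc S)) (xc S)"
proof -
  have "int (nat N) < 3 ^ nat N" by (rule int_less_power) simp
  then have n: "N < 3 ^ nat N" by linarith
  have "xt S (k + 3 ^ nat N * (3 * t + 1)) = xt S k" if "\<bar>k\<bar> \<le> N" for k t
    using xt_zero xt_skeleton[of k "nat N" S "3 * t + 1"] n that by (cases "k = 0") auto
  then show ?thesis unfolding agree_def xc_def sh_apply by auto
qed

lemma xc_aperiodic: "sh k (xc S) = xc S \<Longrightarrow> k = 0"
proof (rule ccontr)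
  assume e: "sh k (xc S) = xc S" and "k \<noteq> 0"
  have "sh k (xc S) 0 = xc S 0" "sh (2 * k) (xc S) 0 = xc S 0" using e sh_mult[OF e, of 2] by simp_all
  then have "xt S k = 0" "xt S (2 * k) = 0" unfolding sh_apply xc_def by simp_all
  then show False using xt_aperiodic[OF \<open>k \<noteq> 0\<close>] by blast
qed

lemma \<Theta>c_in: "sh k (xc S) \<in> \<Theta>c S"
  unfolding \<Theta>c_def using agree_refl by blast

lemma \<Theta>c_alphabet: "y \<in> \<Theta>c S \<Longrightarrow> y k \<in> d ` {..2}"
proof -
  assume "y \<in> \<Theta>c S"
  then obtain s where "agree \<bar>k\<bar> (sh s (xc S)) y" unfolding \<Theta>c_def by blast
  then have "sh s (xc S) k = y k" by (rule agreeD) simp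
  then have "y k = d (xt S (k + s))" by (simp add: sh_apply xc_def)
  then show ?thesis using xt_le[of S "k + s"] by simp
qed

lemma \<Theta>c_subsh: "subsh (\<Theta>c S)"
  unfolding subsh_def
proof (intro conjI ballI allI)
  show "\<exists>A. finite A \<and> (\<forall>x\<in>\<Theta>c S. \<forall>k. x k \<in> A)"
    using \<Theta>c_alphabet by (intro exI[of _ "d ` {..2}"]) auto
  show "wclosed (\<Theta>c S)"
    unfolding wclosed_def
  proof (intro allI impI)
    fix y assume a: "\<forall>N. \<exists>z\<in>\<Theta>c S. agree N z y"
    have "\<exists>s. agree N (sh s (xc S)) y" for N
    proof -
      obtain z where z: "z \<in> \<Theta>c S" "agree N z y" using a by blast
      then obtain s where "agree N (sh s (xc S)) z" unfolding \<Theta>c_def by blast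
      then show ?thesis using z(2) agree_trans by blast
    qed
    then show "y \<in> \<Theta>c S" unfolding \<Theta>c_def by blast
  qed
  fix y k assume y: "y \<in> \<Theta>c S"
  have "\<exists>s. agree N (sh s (xc S)) (sh k y)" for N
  proof -
    obtain s where "agree (N + \<bar>k\<bar>) (sh s (xc S)) y" using y unfolding \<Theta>c_def by blast
    then have "agree N (sh k (sh s (xc S))) (sh k y)" by (rule agree_sh) simp
    then show ?thesis by auto
  qed
  then show "sh k y \<in> \<Theta>c S" unfolding \<Theta>c_def by blast
qed

text \<open>The return times to a window contain an arithmetic progression, so every point of the orbit
  closure sees that window, too.\<close>

lemma \<Theta>c_minimal:
  assumes D: "subsh D" "D \<subseteq> \<Theta>c S" "D \<noteq> {}" shows "D = \<Theta>c S"
proof -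
  obtain y where y: "y \<in> D" using D(3) by blast
  have "xc S \<in> D"
  proof (rule wclosedD[OF subsh_wclosed[OF D(1)]])
    fix N
    obtain n where n: "\<forall>t. agree N (sh (3 ^ n * (3 * t + 1)) (xc S)) (xc S)" using xc_recurs by blast
    define L :: int where "L = 3 ^ Suc n"
    have L: "L > 0" by (simp add: L_def)
    obtain s where s: "agree (N + L) (sh s (xc S)) y" using y D(2) unfolding \<Theta>c_def by blast
    define u where "u = (3 ^ n - s) mod L"
    have u: "0 \<le> u" "u < L" using L by (simp_all add: u_def)
    have "u = 3 ^ n - s - L * ((3 ^ n - s) div L)" unfolding u_def by (simp add: minus_mult_div_eq_mod)
    then have us: "u + s = 3 ^ n * (3 * (- ((3 ^ n - s) div L)) + 1)" by (simp add: L_def algebra_simps)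
    have "agree N (sh u (sh s (xc S))) (sh u y)" by (rule agree_sh[OF s]) (use u in simp)
    then have "agree N (sh (u + s) (xc S)) (sh u y)" by simp
    moreover have "agree N (sh (u + s) (xc S)) (xc S)" unfolding us using n by blast
    ultimately have "agree N (sh u y) (xc S)" using agree_sym agree_trans by blast
    then show "\<exists>z\<in>D. agree N z (xc S)" using subsh_sh[OF D(1) y] by blast
  qed
  have "z \<in> D" if z: "z \<in> \<Theta>c S" for z
  proof (rule wclosedD[OF subsh_wclosed[OF D(1)]])
    fix N
    show "\<exists>w\<in>D. agree N w z" using z subsh_sh[OF D(1) \<open>xc S \<in> D\<close>] unfolding \<Theta>c_def by blast
  qed
  then show ?thesis using D(2) by blast
qed

text \<open>The odd number \<open>3 ^ n\<close> is a return time to a given window.\<close>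

lemma \<Theta>c_noncolorable: "\<not> colorable (\<Theta>c S)"
proof
  assume "colorable (\<Theta>c S)"
  then obtain c :: "_ \<Rightarrow> bool" and M where M: "\<forall>x\<in>\<Theta>c S. \<forall>y\<in>\<Theta>c S. agree M x y \<longrightarrow> c x = c y"
    and c: "\<forall>x\<in>\<Theta>c S. sh 1 x \<noteq> x \<longrightarrow> c (sh 1 x) \<noteq> c x" by (rule colorableE)
  obtain n where n: "\<forall>t. agree M (sh (3 ^ n * (3 * t + 1)) (xc S)) (xc S)" using xc_recurs by blast
  have "agree M (sh (3 ^ n) (xc S)) (xc S)" using n[rule_format, of 0] by simp
  moreover have x: "xc S \<in> \<Theta>c S" using \<Theta>c_in[of 0 S] by simp
  ultimately have "c (sh (3 ^ n) (xc S)) = c (xc S)" using M \<Theta>c_in by blast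
  moreover have "sh 1 (xc S) \<noteq> xc S" using xc_aperiodic[of 1 S] by auto
  ultimately show False using color_alternates[OF \<Theta>c_subsh c x, of "3 ^ n"] by simp
qed

lemma \<Theta>c_critical: "critical (\<Theta>c S)"
proof -
  have "colorable D" if "subsh D" "D \<subset> \<Theta>c S" for D
  proof -
    have "D = {}" using \<Theta>c_minimal[of D S] that by blast
    then show ?thesis unfolding colorable_def by blast
  qed
  then show ?thesis unfolding critical_def using \<Theta>c_subsh \<Theta>c_noncolorable by blast
qed

text \<open>The generating point returns to every window without being periodic.\<close>

lemma \<Theta>c_perfect: "lim_pts (\<Theta>c S) = \<Theta>c S"
proof
  show "\<Theta>c S \<subseteq> lim_pts (\<Theta>c S)"
  proof
    fix y assume y: "y \<in> \<Theta>c S"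
    have "\<exists>z\<in>\<Theta>c S. z \<noteq> y \<and> agree N y z" for N
    proof -
      obtain s where s: "agree N (sh s (xc S)) y" using y unfolding \<Theta>c_def by blast
      show ?thesis
      proof (cases "sh s (xc S) = y")
        case False
        then show ?thesis using \<Theta>c_in agree_sym[OF s] by blast
      next
        case True
        obtain n where n: "\<forall>t. agree (N + \<bar>s\<bar>) (sh (3 ^ n * (3 * t + 1)) (xc S)) (xc S)" using xc_recurs by blast
        have "agree (N + \<bar>s\<bar>) (sh (3 ^ n) (xc S)) (xc S)" using n[rule_format, of 0] by simp
        then have "agree N (sh s (sh (3 ^ n) (xc S))) (sh s (xc S))" by (rule agree_sh) simp
        then have "agree N y (sh (s + 3 ^ n) (xc S))" using True agree_sym by simp
        moreover have "sh (s + 3 ^ n) (xc S) \<noteq> y"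
        proof
          assume "sh (s + 3 ^ n) (xc S) = y"
          then have "sh (3 ^ n) (xc S) = xc S" unfolding True[symmetric] by (simp add: sh_eq_iff)
          then show False using xc_aperiodic[of "3 ^ n" S] by simp
        qed
        ultimately show ?thesis using \<Theta>c_in by blast
      qed
    qed
    then show "y \<in> lim_pts (\<Theta>c S)" using y unfolding lim_pts_def by blast
  qed
qed (rule lim_pts_subset)

lemma \<Theta>c_inj: "inj \<Theta>c"
proof (rule injI)
  fix S R assume e: "\<Theta>c S = \<Theta>c R"
  have "xc S \<in> \<Theta>c R" using \<Theta>c_in[of 0 S] e by simp
  then have "\<forall>N. \<exists>s. \<forall>k. \<bar>k\<bar> \<le> N \<longrightarrow> xt R (k + s) = xt S k"
    unfolding \<Theta>c_def agree_def xc_def sh_apply by simp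
  then have "v \<in> S \<longleftrightarrow> v \<in> R" for v by (rule xt_determines)
  then show "S = R" by blast
qed

end

section \<open>Bases of minimal elements\<close>

context symbols
begin

text \<open>Subshifts of countable ones inherit countability and the bound on the rank, so the critical
  members are a basis.\<close>

lemma critical_basis:
  "is_basis_of_minimals (countable_graph_class \<xi> :: (int \<Rightarrow> 'a) tgraph set)
     {G \<in> countable_graph_class \<xi>. \<exists>C. G = shift_graph C \<and> critical C}"
  (is "is_basis_of_minimals ?Q ?B")
  unfolding is_basis_of_minimals_def is_basis_def
proof (intro conjI ballI)
  show "?B \<subseteq> ?Q" by blast
next
  fix G assume "G \<in> ?Q"
  then obtain C where C: "G = shift_graph C" "subsh C" "countable C"
      "cb_rank (subshift_topology C) \<le> \<xi>" "\<not> colorable C"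
    unfolding in_countable_class_iff by blast
  obtain T where T: "T \<subseteq> C" "critical T" using exists_critical[OF C(2,5)] by blast
  have sT: "subsh T" "\<not> colorable T" using T(2) by (simp_all add: critical_def)
  have "cb_rank (subshift_topology T) \<le> \<xi>" using cb_rank_mono[OF C(2,3) T(1)] C(4) by (rule order.trans)
  moreover have "countable T" using T(1) C(3) countable_subset by blast
  ultimately have "shift_graph T \<in> ?Q" unfolding in_countable_class_iff using sT by blast
  then have "shift_graph T \<in> ?B" using T(2) by blast
  moreover have "shift_graph T \<preceq>ic G" unfolding C(1) ic_le_iff[OF sT(1) C(2)] by (rule embeds_subset[OF T(1)])
  ultimately show "\<exists>H\<in>?B. H \<preceq>ic G" by blast
next
  fix M assume M: "M \<in> ?B"
  then obtain C where C: "M = shift_graph C" "critical C" by blast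
  have sC: "subsh C" using C(2) by (simp add: critical_def)
  show "is_minimal_in ?Q M"
    unfolding is_minimal_in_def
  proof (intro conjI ballI impI)
    show "M \<in> ?Q" using M by blast
    fix G assume "G \<in> ?Q" and le: "G \<preceq>ic M"
    then obtain D where D: "G = shift_graph D" "subsh D" "\<not> colorable D"
      unfolding in_countable_class_iff by blast
    have "embeds D C" using le unfolding C(1) D(1) ic_le_iff[OF D(2) sC] .
    then have "embeds C D" by (rule critical_minimal[OF C(2) D(2,3)])
    then show "M \<preceq>ic G" unfolding C(1) D(1) ic_le_iff[OF sC D(2)] .
  qed
qed

lemma countable_class_continuum:
  assumes \<xi>: "ord_of_nat 3 \<le> \<xi>" and B: "is_basis (countable_graph_class \<xi> :: (int \<Rightarrow> 'a) tgraph set) B"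
  shows "ic_classes B \<approx> (UNIV :: nat set set)"
proof (rule ic_classes_continuum[OF _ B, where A = "d ` {..<4}" and \<Theta> = \<Theta>b])
  show "\<exists>C. G = shift_graph C \<and> subsh C \<and> \<not> colorable C"
    if "G \<in> countable_graph_class \<xi>" for G :: "(int \<Rightarrow> 'a) tgraph"
    using that unfolding in_countable_class_iff by blast
  show "shift_graph (\<Theta>b S) \<in> countable_graph_class \<xi>" for S
    unfolding in_countable_class_iff
    using \<Theta>b_subsh \<Theta>b_countable order.trans[OF \<Theta>b_rank \<xi>] \<Theta>b_noncolorable by blast
  show "\<exists>x\<in>\<Theta>b S. \<forall>y\<in>\<Theta>b S. \<forall>N. \<exists>k. agree N (sh k x) y" for S
    using \<Theta>b_in(1) \<Theta>b_dense by blast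
qed (use \<Theta>b_alphabet \<Theta>b_critical \<Theta>b_inj in auto)

lemma class_continuum:
  assumes B: "is_basis (graph_class \<xi> :: (int \<Rightarrow> 'a) tgraph set) B"
  shows "ic_classes B \<approx> (UNIV :: nat set set)"
proof (rule ic_classes_continuum[OF _ B, where A = "d ` {..2}" and \<Theta> = \<Theta>c])
  show "\<exists>C. G = shift_graph C \<and> subsh C \<and> \<not> colorable C"
    if "G \<in> graph_class \<xi>" for G :: "(int \<Rightarrow> 'a) tgraph"
    using that unfolding in_class_iff by blast
  show "shift_graph (\<Theta>c S) \<in> graph_class \<xi>" for S
    unfolding in_class_iff using \<Theta>c_subsh cb_rank_perfect[OF \<Theta>c_perfect] \<Theta>c_noncolorable by blast
  show "\<exists>x\<in>\<Theta>c S. \<forall>y\<in>\<Theta>c S. \<forall>N. \<exists>k. agree N (sh k x) y" for S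
    using \<Theta>c_in[of 0 S] unfolding \<Theta>c_def by auto
qed (use \<Theta>c_alphabet \<Theta>c_critical \<Theta>c_inj in auto)

end

theorem theorem1p6:
  fixes d :: "nat \<Rightarrow> 'a" and a :: "nat \<Rightarrow> nat \<Rightarrow> 'a" and b :: "nat \<Rightarrow> 'a"
  assumes "inj d" and "inj (\<lambda>(i, j). a i j)" and "inj b"
    and "range (\<lambda>(i, j). a i j) \<inter> range b = {}"
  shows "(is_basis (countable_graph_class (ord_of_nat 2)) (basis_family d a b) \<and>
          basis_family d a b \<approx> (UNIV :: nat set) \<and>
          is_basis (countable_graph_class (ord_of_nat 2)) (antichain_family d a b) \<and>
          is_antichain (antichain_family d a b) \<and>
          antichain_family d a b \<approx> (UNIV :: nat set))
       \<and> (\<forall>\<xi>\<ge>ord_of_nat 3.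
            (\<exists>B. is_basis_of_minimals (countable_graph_class \<xi> :: (int \<Rightarrow> 'a) tgraph set) B) \<and>
            (\<forall>B. is_basis_of_minimals (countable_graph_class \<xi> :: (int \<Rightarrow> 'a) tgraph set) B \<longrightarrow>
                 ic_classes B \<approx> (UNIV :: nat set set)))
       \<and> (\<forall>\<xi> B. is_basis_of_minimals (graph_class \<xi> :: (int \<Rightarrow> 'a) tgraph set) B \<longrightarrow>
            ic_classes B \<approx> (UNIV :: nat set set))"
proof -
  interpret symbols d a b by unfold_locales (rule assms)+
  show ?thesis
  proof (intro conjI allI impI)
    show "is_basis (countable_graph_class (ord_of_nat 2)) (basis_family d a b)"
      by (rule basis_rank_two)
    show "basis_family d a b \<approx> (UNIV :: nat set)" by (rule family_eqpoll(1))
    show "is_basis (countable_graph_class (ord_of_nat 2)) (antichain_family d a b)"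
      by (rule antichain_basis_rank_two)
    show "is_antichain (antichain_family d a b)" by (rule antichain_rank_two)
    show "antichain_family d a b \<approx> (UNIV :: nat set)" by (rule family_eqpoll(2))
    fix \<xi> assume \<xi>: "ord_of_nat 3 \<le> \<xi>"
    show "\<exists>B. is_basis_of_minimals (countable_graph_class \<xi> :: (int \<Rightarrow> 'a) tgraph set) B"
      using critical_basis by blast
    show "ic_classes B \<approx> (UNIV :: nat set set)"
      if "is_basis_of_minimals (countable_graph_class \<xi> :: (int \<Rightarrow> 'a) tgraph set) B" for B
      using countable_class_continuum[OF \<xi>] that unfolding is_basis_of_minimals_def by blast
  next
    fix \<xi> and B :: "(int \<Rightarrow> 'a) tgraph set"
    assume "is_basis_of_minimals (graph_class \<xi>) B"
    then show "ic_classes B \<approx> (UNIV :: nat set set)"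
      using class_continuum unfolding is_basis_of_minimals_def by blast
  qed
qed

end
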